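(* The generating series $$\vec{\mathbf H}=\vec{\mathbf H}(z,t,p,q)=\sum_{d\ge1}\ \sum_{r\ge0}\ \sum_{\alpha,\beta\vdash d}\frac{z^d}{d!}t^rp_\alpha q_\beta\,\vec H^r(\alpha,\beta)$$ for the monotone double Hurwitz numbers satisfies the equation $$\begin{aligned}\frac{1}{2t}\Bigg(z\frac{\partial\vec{\mathbf H}}{\partial z}-zp_1q_1-z^2\frac{\partial}{\partial z}\sum_{\substack{i,j\ge1\\ d\ge i,j\\ r\ge0}}\ \sum_{\substack{\alpha\vdash d-i\\ \beta\vdash d-j}}\frac{z^d}{d!}t^rp_\alpha p_{i+1}q_\beta q_{j+1}\,N^r(\alpha,i;\beta,j)\Bigg)\\=\frac12\sum_{i,j\ge1}\left((i+j)p_ip_j\frac{\partial\vec{\mathbf H}}{\partial p_{i+j}}+ij\,p_{i+j}\frac{\partial^2\vec{\mathbf H}}{\partial p_i\partial p_j}+ij\,p_{i+j}\frac{\partial\vec{\mathbf H}}{\partial p_i}\frac{\partial\vec{\mathbf H}}{\partial p_j}\right).\end{aligned}$$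
   Context: For $d\ge1$, $r\ge0$, a transitive monotone solution of $\sigma\rho\,(a_1\,b_1)(a_2\,b_2)\cdots(a_r\,b_r)=\mathrm{id}$ is a tuple of permutations $\sigma,\rho$ and transpositions $(a_i\,b_i)$, $a_i<b_i$, in the symmetric group on $\{1,\dots,d\}$ satisfying this equation, with $b_1\le b_2\le\dots\le b_r$, and such that the group $\langle\sigma,\rho,(a_1\,b_1),\dots,(a_r\,b_r)\rangle$ acts transitively on $\{1,\dots,d\}$. For a partition $\lambda\vdash d$, $C_\lambda$ is the conjugacy class of permutations of cycle type $\lambda$. For $\alpha,\beta\vdash d$, the monotone double Hurwitz number $\vec H^r(\alpha,\beta)$ is the number of transitive monotone solutions with $\sigma\in C_\alpha$ and $\rho\in C_\beta$. For $1\le i,j\le d$, $\alpha\vdash d-i$, $\beta\vdash d-j$ (possibly empty), $N^r(\alpha,i;\beta,j)$ is the number of transitive monotone solutions (in the symmetric group on $\{1,\dots,d\}$) with $\sigma\in C_{\alpha\cup\{i\}}$, $\rho\in C_{\beta\cup\{j\}}$, and such that the element $d$ is in a cycle of length $i$ of $\sigma$ and in a cycle of length $j$ of $\rho$. Here $\alpha\cup\{i\}$ is the partition obtained by adding a part $i$; $z,t,p_1,p_2,\dots,q_1,q_2,\dots$ are indeterminates, $p_\alpha=\prod_ip_{\alpha_i}$, $q_\beta=\prod_iq_{\beta_i}$. *)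

theory Defs
  imports
    "HOL-Library.Multiset_Order"
    "HOL-Library.Countable"
    "HOL-Computational_Algebra.Polynomial_Factorial"
    "HOL-Combinatorics.Orbits"
    "HOL-Algebra.Sym_Groups"
begin

section \<open>Formal power series in arbitrarily many indeterminates\<close>

text \<open>
  A monomial over the indeterminates \<open>'v\<close> is a finite multiset of indeterminates, the
  multiplicity being the exponent.  A power series is an arbitrary function from monomials
  to coefficients.
\<close>

typedef ('v, 'a) mps = "UNIV :: ('v multiset \<Rightarrow> 'a) set"
  morphisms mps_coeff Mps ..

lemma mps_coeff_Mps [simp]: "mps_coeff (Mps f) = f"
  by (simp add: Mps_inverse)

lemma mps_eqI: "(\<And>m. mps_coeff f m = mps_coeff g m) \<Longrightarrow> f = g"
  by (metis ext mps_coeff_inject)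

definition splits :: "'v multiset \<Rightarrow> ('v multiset \<times> 'v multiset) set" where
  "splits m = {(a, b). a + b = m}"

lemma in_splits [simp]: "(a, b) \<in> splits m \<longleftrightarrow> a + b = m"
  by (simp add: splits_def)

lemma finite_submultisets: "finite {a. a \<subseteq># (m :: 'v multiset)}"
proof (induction m)
  case (add x m)
  have "{a. a \<subseteq># add_mset x m} \<subseteq> {a. a \<subseteq># m} \<union> add_mset x ` {a. a \<subseteq># m}"
  proof
    fix a assume "a \<in> {a. a \<subseteq># add_mset x m}"
    hence a: "a \<subseteq># add_mset x m" by simp
    show "a \<in> {a. a \<subseteq># m} \<union> add_mset x ` {a. a \<subseteq># m}"
    proof (cases "x \<in># a")
      case True
      then obtain b where "a = add_mset x b" by (metis multi_member_split)
      with a show ?thesis by auto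
    next
      case False
      with a have "a \<subseteq># m"
        by (metis add_mset_remove_trivial diff_single_trivial subset_eq_diff_conv
            add_mset_add_single)
      thus ?thesis by simp
    qed
  qed
  thus ?case by (rule finite_subset) (use add in auto)
qed simp

lemma finite_splits [simp]: "finite (splits m)"
proof (rule finite_subset)
  show "splits m \<subseteq> {a. a \<subseteq># m} \<times> {a. a \<subseteq># m}" by auto
qed (use finite_submultisets in auto)

instantiation mps :: (type, comm_ring_1) comm_ring_1
begin

definition "0 = Mps (\<lambda>_. 0)"
definition "1 = Mps (\<lambda>m. if m = {#} then 1 else 0)"
definition "f + g = Mps (\<lambda>m. mps_coeff f m + mps_coeff g m)"
definition "f - g = Mps (\<lambda>m. mps_coeff f m - mps_coeff g m)"
definition "- f = Mps (\<lambda>m. - mps_coeff f m)"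
definition "f * g = Mps (\<lambda>m. \<Sum>(a, b)\<in>splits m. mps_coeff f a * mps_coeff g b)"

lemma mps_coeff_0 [simp]: "mps_coeff 0 m = 0"
  and mps_coeff_1: "mps_coeff 1 m = (if m = {#} then 1 else 0)"
  and mps_coeff_add [simp]: "mps_coeff (f + g) m = mps_coeff f m + mps_coeff g m"
  and mps_coeff_diff [simp]: "mps_coeff (f - g) m = mps_coeff f m - mps_coeff g m"
  and mps_coeff_uminus [simp]: "mps_coeff (- f) m = - mps_coeff f m"
  and mps_coeff_mult:
    "mps_coeff (f * g) m = (\<Sum>(a, b)\<in>splits m. mps_coeff f a * mps_coeff g b)"
  by (simp_all add: zero_mps_def one_mps_def plus_mps_def minus_mps_def uminus_mps_def
      times_mps_def)

instance
proof
  fix f g h :: "('a, 'b) mps"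
  show "f * g * h = f * (g * h)"
  proof (rule mps_eqI)
    fix m
    let ?F = mps_coeff
    have "?F (f * g * h) m =
        (\<Sum>(x, y)\<in>(SIGMA p:splits m. splits (fst p)). ?F f (fst y) * ?F g (snd y) * ?F h (snd x))"
      by (simp add: mps_coeff_mult sum_distrib_right case_prod_beta sum.Sigma)
    also have "\<dots> =
        (\<Sum>(x, y)\<in>(SIGMA p:splits m. splits (snd p)). ?F f (fst x) * (?F g (fst y) * ?F h (snd y)))"
      by (rule sum.reindex_bij_witness
            [where i = "\<lambda>((a, bc), (b, c)). ((a + b, c), (a, b))"
               and j = "\<lambda>((ab, c), (a, b)). ((a, b + c), (b, c))"])
         (auto simp: ac_simps)
    also have "\<dots> = ?F (f * (g * h)) m"
      by (simp add: mps_coeff_mult sum_distrib_left case_prod_beta sum.Sigma)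
    finally show "?F (f * g * h) m = ?F (f * (g * h)) m" .
  qed
  show "f * g = g * f"
  proof (rule mps_eqI)
    fix m
    show "mps_coeff (f * g) m = mps_coeff (g * f) m"
      unfolding mps_coeff_mult
      by (rule sum.reindex_bij_witness[where i = prod.swap and j = prod.swap])
         (auto simp: ac_simps)
  qed
  show "1 * f = f"
  proof (rule mps_eqI)
    fix m
    have "mps_coeff (1 * f) m =
        (\<Sum>(a, b)\<in>{({#}, m)}. mps_coeff 1 a * mps_coeff f b)"
      unfolding mps_coeff_mult
      by (rule sum.mono_neutral_right) (auto simp: mps_coeff_1 split: if_splits)
    thus "mps_coeff (1 * f) m = mps_coeff f m" by (simp add: mps_coeff_1)
  qed
  show "(f + g) * h = f * h + g * h"
    by (rule mps_eqI)
       (simp add: mps_coeff_mult case_prod_beta distrib_right sum.distrib)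
  have "mps_coeff (0 :: ('a, 'b) mps) {#} \<noteq> mps_coeff 1 {#}" by (simp add: mps_coeff_1)
  thus "(0 :: ('a, 'b) mps) \<noteq> 1" by metis
qed (rule mps_eqI; simp add: ac_simps)+

end

text \<open>
  The integral domain property gives access to the field of fractions, in which \<open>1 / (2 t)\<close>
  makes sense: the product of the smallest monomials of two non-zero series occurs in the product.
\<close>

lemma mps_lowest_monomial:
  fixes f :: "('v :: countable, 'a :: comm_ring_1) mps"
  assumes "f \<noteq> 0"
  obtains m where "mps_coeff f m \<noteq> 0"
    and "\<And>n. mps_coeff f n \<noteq> 0 \<Longrightarrow> image_mset to_nat m \<le> image_mset to_nat n"
proof -
  from assms obtain m0 where m0: "mps_coeff f m0 \<noteq> 0"
    by (metis mps_eqI mps_coeff_0)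
  define K where "K = (\<lambda>k. \<exists>m. mps_coeff f m \<noteq> 0 \<and> k = image_mset (to_nat :: 'v \<Rightarrow> nat) m)"
  have "K (image_mset to_nat m0)" using m0 by (auto simp: K_def)
  hence "K (LEAST k. K k)" by (rule LeastI)
  then obtain m where m: "mps_coeff f m \<noteq> 0" "(LEAST k. K k) = image_mset to_nat m"
    by (auto simp: K_def)
  show ?thesis
  proof
    show "mps_coeff f m \<noteq> 0" by fact
    fix n assume "mps_coeff f n \<noteq> 0"
    hence "K (image_mset to_nat n)" by (auto simp: K_def)
    thus "image_mset to_nat m \<le> image_mset (to_nat :: 'v \<Rightarrow> nat) n"
      using m(2) by (metis Least_le)
  qed
qed

instance mps :: (countable, idom) idom
proof
  fix f g :: "('a, 'b) mps"
  assume "f \<noteq> 0" "g \<noteq> 0"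
  from mps_lowest_monomial[OF \<open>f \<noteq> 0\<close>] obtain m where m: "mps_coeff f m \<noteq> 0"
    "\<And>n. mps_coeff f n \<noteq> 0 \<Longrightarrow> image_mset to_nat m \<le> image_mset to_nat n" by metis
  from mps_lowest_monomial[OF \<open>g \<noteq> 0\<close>] obtain n where n: "mps_coeff g n \<noteq> 0"
    "\<And>k. mps_coeff g k \<noteq> 0 \<Longrightarrow> image_mset to_nat n \<le> image_mset to_nat k" by metis
  have "a = m \<and> b = n"
    if "a + b = m + n" "mps_coeff f a \<noteq> 0" "mps_coeff g b \<noteq> 0" for a b
  proof -
    let ?k = "image_mset (to_nat :: 'a \<Rightarrow> nat)"
    have eq: "?k a + ?k b = ?k m + ?k n" using that(1) by (metis image_mset_union)
    have "?k m \<le> ?k a" "?k n \<le> ?k b" using m n that by auto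
    hence "?k a = ?k m"
      using eq add_less_le_mono[of "?k m" "?k a" "?k n" "?k b"] by (metis less_irrefl order_less_le)
    moreover have "image_mset from_nat (?k c) = c" for c
      by (simp add: image_mset.compositionality comp_def)
    ultimately have "a = m" by metis
    thus ?thesis using that(1) by simp
  qed
  hence *: "\<forall>p\<in>splits (m + n) - {(m, n)}. (case p of (a, b) \<Rightarrow> mps_coeff f a * mps_coeff g b) = 0"
    by (auto simp: split_beta)
  have "mps_coeff (f * g) (m + n) = (\<Sum>(a, b)\<in>{(m, n)}. mps_coeff f a * mps_coeff g b)"
    unfolding mps_coeff_mult by (rule sum.mono_neutral_right) (use * in auto)
  hence "mps_coeff (f * g) (m + n) \<noteq> 0" using m n by simp
  thus "f * g \<noteq> 0" by auto
qed

definition mps_const :: "'a \<Rightarrow> ('v, 'a :: zero) mps" where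
  "mps_const c = Mps (\<lambda>m. if m = {#} then c else 0)"

definition mps_var :: "'v \<Rightarrow> ('v, 'a :: zero_neq_one) mps" where
  "mps_var x = Mps (\<lambda>m. if m = {#x#} then 1 else 0)"

definition mps_deriv :: "'v \<Rightarrow> ('v, 'a :: semiring_1) mps \<Rightarrow> ('v, 'a) mps" where
  "mps_deriv x f = Mps (\<lambda>m. of_nat (count m x + 1) * mps_coeff f (add_mset x m))"

text \<open>
  Infinite sums are formal: each coefficient of the sum is a finite sum.  This is meaningful for
  locally finite families, i.e. under \<open>mps_summable\<close>, which is proved below for every
  family that occurs.
\<close>

definition mps_summable :: "('i \<Rightarrow> ('v, 'a :: comm_ring_1) mps) \<Rightarrow> 'i set \<Rightarrow> bool" where
  "mps_summable F I \<longleftrightarrow> (\<forall>m. finite {i \<in> I. mps_coeff (F i) m \<noteq> 0})"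

definition mps_sum :: "('i \<Rightarrow> ('v, 'a :: comm_ring_1) mps) \<Rightarrow> 'i set \<Rightarrow> ('v, 'a) mps" where
  "mps_sum F I = Mps (\<lambda>m. \<Sum>i\<in>{i \<in> I. mps_coeff (F i) m \<noteq> 0}. mps_coeff (F i) m)"


section \<open>Monotone double Hurwitz numbers\<close>

definition partitions :: "nat \<Rightarrow> nat multiset set" where
  "partitions d = {\<alpha>. 0 \<notin># \<alpha> \<and> sum_mset \<alpha> = d}"

text \<open>Fixed points count as cycles of length 1.\<close>

definition cycle_type :: "nat \<Rightarrow> (nat \<Rightarrow> nat) \<Rightarrow> nat multiset" where
  "cycle_type d \<sigma> = image_mset card (mset_set (Orbits.orbit \<sigma> ` {1..d}))"

definition conj_class :: "nat \<Rightarrow> nat multiset \<Rightarrow> (nat \<Rightarrow> nat) set" where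
  "conj_class d \<nu> = {\<sigma>. \<sigma> permutes {1..d} \<and> cycle_type d \<sigma> = \<nu>}"

definition transp :: "nat \<times> nat \<Rightarrow> nat \<Rightarrow> nat" where
  "transp = (\<lambda>(a, b). transpose a b)"

definition transitive_on :: "nat \<Rightarrow> (nat \<Rightarrow> nat) set \<Rightarrow> bool" where
  "transitive_on d G \<longleftrightarrow> (\<forall>x\<in>{1..d}. \<forall>y\<in>{1..d}. \<exists>g\<in>G. g x = y)"

text \<open>
  The transpositions are recorded as the list of pairs \<open>(a\<^sub>i, b\<^sub>i)\<close> with \<open>a\<^sub>i < b\<^sub>i\<close>.
  Products are read as compositions of functions; with the opposite convention one obtains the
  same numbers, by inverting \<open>\<sigma>\<close> and \<open>\<rho>\<close>.
\<close>

definition monotone_solutions ::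
    "nat \<Rightarrow> nat \<Rightarrow> ((nat \<Rightarrow> nat) \<times> (nat \<Rightarrow> nat) \<times> (nat \<times> nat) list) set" where
  "monotone_solutions d r = {(\<sigma>, \<rho>, \<tau>).
     \<sigma> permutes {1..d} \<and> \<rho> permutes {1..d} \<and>
     length \<tau> = r \<and> (\<forall>(a, b)\<in>set \<tau>. 1 \<le> a \<and> a < b \<and> b \<le> d) \<and>
     sorted (map snd \<tau>) \<and>
     \<sigma> \<circ> \<rho> \<circ> foldr (\<circ>) (map transp \<tau>) id = id \<and>
     transitive_on d (generate (sym_group d) ({\<sigma>, \<rho>} \<union> transp ` set \<tau>))}"

definition mono_hurwitz :: "nat \<Rightarrow> nat \<Rightarrow> nat multiset \<Rightarrow> nat multiset \<Rightarrow> nat" where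
  "mono_hurwitz d r \<alpha> \<beta> =
     card {(\<sigma>, \<rho>, \<tau>) \<in> monotone_solutions d r. \<sigma> \<in> conj_class d \<alpha> \<and> \<rho> \<in> conj_class d \<beta>}"

definition mono_N :: "nat \<Rightarrow> nat \<Rightarrow> nat multiset \<Rightarrow> nat \<Rightarrow> nat multiset \<Rightarrow> nat \<Rightarrow> nat" where
  "mono_N d r \<alpha> i \<beta> j =
     card {(\<sigma>, \<rho>, \<tau>) \<in> monotone_solutions d r.
       \<sigma> \<in> conj_class d (add_mset i \<alpha>) \<and> \<rho> \<in> conj_class d (add_mset j \<beta>) \<and>
       card (Orbits.orbit \<sigma> d) = i \<and> card (Orbits.orbit \<rho> d) = j}"


section \<open>Generating series\<close>

text \<open>\<open>PVar 0\<close> and \<open>QVar 0\<close> are present in the type but never used.\<close>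

datatype indet = ZVar | TVar | PVar nat | QVar nat

instance indet :: countable by countable_datatype

type_synonym series = "(indet, rat) mps"

abbreviation zz :: series where "zz \<equiv> mps_var ZVar"
abbreviation tt :: series where "tt \<equiv> mps_var TVar"
abbreviation pp :: "nat \<Rightarrow> series" where "pp i \<equiv> mps_var (PVar i)"
abbreviation qq :: "nat \<Rightarrow> series" where "qq j \<equiv> mps_var (QVar j)"

abbreviation d_z :: "series \<Rightarrow> series" where "d_z \<equiv> mps_deriv ZVar"
abbreviation d_p :: "nat \<Rightarrow> series \<Rightarrow> series" where "d_p i \<equiv> mps_deriv (PVar i)"

definition pp_part :: "nat multiset \<Rightarrow> series" where "pp_part \<alpha> = (\<Prod>i\<in>#\<alpha>. pp i)"
definition qq_part :: "nat multiset \<Rightarrow> series" where "qq_part \<beta> = (\<Prod>j\<in>#\<beta>. qq j)"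

definition H_index :: "(nat \<times> nat \<times> nat multiset \<times> nat multiset) set" where
  "H_index = {(d, r, \<alpha>, \<beta>). d \<ge> 1 \<and> \<alpha> \<in> partitions d \<and> \<beta> \<in> partitions d}"

definition H_term :: "nat \<times> nat \<times> nat multiset \<times> nat multiset \<Rightarrow> series" where
  "H_term = (\<lambda>(d, r, \<alpha>, \<beta>).
     mps_const (1 / fact d) * zz ^ d * tt ^ r * pp_part \<alpha> * qq_part \<beta> *
     of_nat (mono_hurwitz d r \<alpha> \<beta>))"

definition H_series :: series where
  "H_series = mps_sum H_term H_index"

definition N_index :: "(nat \<times> nat \<times> nat \<times> nat \<times> nat multiset \<times> nat multiset) set" where
  "N_index = {(i, j, d, r, \<alpha>, \<beta>). i \<ge> 1 \<and> j \<ge> 1 \<and> d \<ge> i \<and> d \<ge> j \<and>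
     \<alpha> \<in> partitions (d - i) \<and> \<beta> \<in> partitions (d - j)}"

definition N_term :: "nat \<times> nat \<times> nat \<times> nat \<times> nat multiset \<times> nat multiset \<Rightarrow> series" where
  "N_term = (\<lambda>(i, j, d, r, \<alpha>, \<beta>).
     mps_const (1 / fact d) * zz ^ d * tt ^ r * pp_part \<alpha> * pp (i + 1) * qq_part \<beta> * qq (j + 1) *
     of_nat (mono_N d r \<alpha> i \<beta> j))"

definition N_series :: series where
  "N_series = mps_sum N_term N_index"


subsection \<open>The families being summed are locally finite\<close>

definition mps_monom :: "'a \<Rightarrow> 'v multiset \<Rightarrow> ('v, 'a :: zero) mps" where
  "mps_monom c m = Mps (\<lambda>n. if n = m then c else 0)"

lemma mps_coeff_monom: "mps_coeff (mps_monom c m) n = (if n = m then c else 0)"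
  by (simp add: mps_monom_def)

lemma mps_const_monom: "mps_const c = mps_monom c {#}"
  by (simp add: mps_const_def mps_monom_def)

lemma mps_var_monom: "mps_var x = mps_monom 1 {#x#}"
  by (simp add: mps_var_def mps_monom_def)

lemma mps_one_monom: "1 = mps_monom 1 {#}"
  by (rule mps_eqI) (simp add: mps_coeff_1 mps_coeff_monom)

lemma mps_monom_mult:
  "mps_monom c a * mps_monom d b = (mps_monom (c * d) (a + b) :: ('v, 'a :: comm_ring_1) mps)"
proof (rule mps_eqI)
  fix m :: "'v multiset"
  have "mps_coeff (mps_monom c a * mps_monom d b) m =
      (\<Sum>p\<in>splits m. if p = (a, b) then c * d else 0)"
    unfolding mps_coeff_mult by (rule sum.cong) (auto simp: mps_coeff_monom split: if_splits)
  also have "\<dots> = mps_coeff (mps_monom (c * d) (a + b)) m"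
    by (auto simp: mps_coeff_monom)
  finally show "mps_coeff (mps_monom c a * mps_monom d b) m
      = mps_coeff (mps_monom (c * d) (a + b)) m" .
qed

lemma mps_of_nat_monom: "of_nat n = (mps_monom (of_nat n) {#} :: ('v, 'a :: comm_ring_1) mps)"
  by (induction n; rule mps_eqI) (auto simp: mps_coeff_monom mps_coeff_1)

lemma mps_var_power: "mps_var x ^ n = (mps_monom 1 (replicate_mset n x) :: ('v, 'a :: comm_ring_1) mps)"
  by (induction n) (simp_all add: mps_one_monom mps_var_monom mps_monom_mult)

lemma mps_prod_var:
  "(\<Prod>i\<in>#\<alpha>. mps_var (f i)) = (mps_monom 1 (image_mset f \<alpha>) :: ('v, 'a :: comm_ring_1) mps)"
  by (induction \<alpha>) (simp_all add: mps_one_monom mps_var_monom mps_monom_mult)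

lemma H_term_monom:
  "H_term (d, r, \<alpha>, \<beta>) = mps_monom (of_nat (mono_hurwitz d r \<alpha> \<beta>) / fact d)
     (replicate_mset d ZVar + replicate_mset r TVar + image_mset PVar \<alpha> + image_mset QVar \<beta>)"
  unfolding H_term_def pp_part_def qq_part_def mps_prod_var mps_var_power prod.case
  by (simp add: mps_const_monom mps_of_nat_monom mps_var_monom mps_monom_mult ac_simps)

lemma N_term_monom:
  "N_term (i, j, d, r, \<alpha>, \<beta>) = mps_monom (of_nat (mono_N d r \<alpha> i \<beta> j) / fact d)
     (replicate_mset d ZVar + replicate_mset r TVar + image_mset PVar (add_mset (i + 1) \<alpha>)
        + image_mset QVar (add_mset (j + 1) \<beta>))"
  unfolding N_term_def pp_part_def qq_part_def mps_prod_var mps_var_power prod.case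
  by (simp add: mps_const_monom mps_of_nat_monom mps_var_monom mps_monom_mult ac_simps)

lemma indet_monom_components:
  assumes "m = replicate_mset d ZVar + replicate_mset r TVar + image_mset PVar \<alpha> + image_mset QVar \<beta>"
  shows "d = count m ZVar" "r = count m TVar"
    "\<alpha> = image_mset (\<lambda>v. case v of PVar i \<Rightarrow> i | _ \<Rightarrow> 0) {#v \<in># m. case v of PVar _ \<Rightarrow> True | _ \<Rightarrow> False#}"
    "\<beta> = image_mset (\<lambda>v. case v of QVar i \<Rightarrow> i | _ \<Rightarrow> 0) {#v \<in># m. case v of QVar _ \<Rightarrow> True | _ \<Rightarrow> False#}"
proof -
  have [simp]: "count (image_mset PVar \<alpha>) ZVar = 0" "count (image_mset QVar \<beta>) ZVar = 0"
    "count (image_mset PVar \<alpha>) TVar = 0" "count (image_mset QVar \<beta>) TVar = 0"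
    by (auto simp: count_eq_zero_iff)
  show "d = count m ZVar" "r = count m TVar" by (simp_all add: assms)
  have *: "filter_mset Q (replicate_mset n (x :: indet)) = (if Q x then replicate_mset n x else {#})"
    for Q n x by (induction n) auto
  show "\<alpha> = image_mset (\<lambda>v. case v of PVar i \<Rightarrow> i | _ \<Rightarrow> 0) {#v \<in># m. case v of PVar _ \<Rightarrow> True | _ \<Rightarrow> False#}"
    "\<beta> = image_mset (\<lambda>v. case v of QVar i \<Rightarrow> i | _ \<Rightarrow> 0) {#v \<in># m. case v of QVar _ \<Rightarrow> True | _ \<Rightarrow> False#}"
    by (simp_all add: assms * filter_mset_image_mset image_mset.compositionality comp_def)
qed

lemma mps_summable_H: "mps_summable H_term H_index"
  unfolding mps_summable_def
proof
  fix m
  have "{x \<in> H_index. mps_coeff (H_term x) m \<noteq> 0} \<subseteq>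
    {(d, r, \<alpha>, \<beta>). m = replicate_mset d ZVar + replicate_mset r TVar + image_mset PVar \<alpha> + image_mset QVar \<beta>}"
    by (auto simp: H_term_monom mps_coeff_monom split: if_splits)
  also have "\<dots> \<subseteq> {(count m ZVar, count m TVar,
      image_mset (\<lambda>v. case v of PVar i \<Rightarrow> i | _ \<Rightarrow> 0) {#v \<in># m. case v of PVar _ \<Rightarrow> True | _ \<Rightarrow> False#},
      image_mset (\<lambda>v. case v of QVar i \<Rightarrow> i | _ \<Rightarrow> 0) {#v \<in># m. case v of QVar _ \<Rightarrow> True | _ \<Rightarrow> False#})}"
    using indet_monom_components by fast
  finally show "finite {x \<in> H_index. mps_coeff (H_term x) m \<noteq> 0}"
    by (rule finite_subset) simp
qed

lemma mps_summable_N: "mps_summable N_term N_index"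
  unfolding mps_summable_def
proof
  fix m
  let ?A = "image_mset (\<lambda>v. case v of PVar i \<Rightarrow> i | _ \<Rightarrow> 0) {#v \<in># m. case v of PVar _ \<Rightarrow> True | _ \<Rightarrow> False#}"
  let ?B = "image_mset (\<lambda>v. case v of QVar i \<Rightarrow> i | _ \<Rightarrow> 0) {#v \<in># m. case v of QVar _ \<Rightarrow> True | _ \<Rightarrow> False#}"
  have "{x \<in> N_index. mps_coeff (N_term x) m \<noteq> 0} \<subseteq>
    (\<lambda>(a, b). (a - 1, b - 1, count m ZVar, count m TVar, ?A - {#a#}, ?B - {#b#}))
      ` (set_mset ?A \<times> set_mset ?B)"
  proof
    fix x assume x: "x \<in> {x \<in> N_index. mps_coeff (N_term x) m \<noteq> 0}"
    obtain i j d r \<alpha> \<beta> where [simp]: "x = (i, j, d, r, \<alpha>, \<beta>)" by (metis prod_cases6)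
    have "m = replicate_mset d ZVar + replicate_mset r TVar + image_mset PVar (add_mset (i + 1) \<alpha>)
        + image_mset QVar (add_mset (j + 1) \<beta>)"
      using x by (auto simp: N_term_monom mps_coeff_monom split: if_splits)
    note c = indet_monom_components[OF this]
    have "x = (\<lambda>(a, b). (a - 1, b - 1, count m ZVar, count m TVar, ?A - {#a#}, ?B - {#b#})) (i + 1, j + 1)"
      by (simp flip: c)
    moreover have "(i + 1, j + 1) \<in> set_mset ?A \<times> set_mset ?B"
      by (simp flip: c)
    ultimately show "x \<in> (\<lambda>(a, b). (a - 1, b - 1, count m ZVar, count m TVar, ?A - {#a#}, ?B - {#b#}))
      ` (set_mset ?A \<times> set_mset ?B)" by (rule image_eqI)
  qed
  thus "finite {x \<in> N_index. mps_coeff (N_term x) m \<noteq> 0}"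
    by (rule finite_subset) simp
qed

lemma mps_coeff_var_mult_eq_0:
  fixes f :: "('v, 'a :: comm_ring_1) mps"
  assumes "x \<notin># m"
  shows "mps_coeff (mps_var x * f) m = 0"
  unfolding mps_coeff_mult using assms by (intro sum.neutral) (auto simp: mps_var_def)

lemma mps_summable_join_cut:
  "mps_summable
     (\<lambda>(i, j). of_nat (i + j) * pp i * pp j * d_p (i + j) H
        + of_nat (i * j) * pp (i + j) * d_p i (d_p j H)
        + of_nat (i * j) * pp (i + j) * d_p i H * d_p j H) ({1..} \<times> {1..})"
  (is "mps_summable ?F ?I")
  unfolding mps_summable_def
proof
  fix m
  define S where "S = {k. PVar k \<in># m}"
  have "finite (PVar -` set_mset m)" by (rule finite_vimageI) (auto simp: inj_def)
  hence fin: "finite S" by (simp add: S_def vimage_def)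
  have sub: "{x \<in> ?I. mps_coeff (?F x) m \<noteq> 0} \<subseteq> S \<times> S \<union> (\<Union>k\<in>S. {..k} \<times> {..k})"
  proof clarify
    fix i j :: nat
    assume nz: "mps_coeff (of_nat (i + j) * pp i * pp j * d_p (i + j) H
        + of_nat (i * j) * pp (i + j) * d_p i (d_p j H)
        + of_nat (i * j) * pp (i + j) * d_p i H * d_p j H) m \<noteq> 0"
      and n: "(i, j) \<notin> (\<Union>k\<in>S. {..k} \<times> {..k})"
    let ?a = "of_nat (i + j) * d_p (i + j) H"
    let ?b = "of_nat (i * j) * (d_p i (d_p j H) + d_p i H * d_p j H)"
    have eq: "of_nat (i + j) * pp i * pp j * d_p (i + j) H
        + of_nat (i * j) * pp (i + j) * d_p i (d_p j H)
        + of_nat (i * j) * pp (i + j) * d_p i H * d_p j H = pp i * (pp j * ?a) + pp (i + j) * ?b"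
      by (simp only: algebra_simps)
    have "i + j \<notin> S" using n by force
    hence "mps_coeff (pp (i + j) * ?b) m = 0"
      by (intro mps_coeff_var_mult_eq_0) (simp add: S_def)
    hence "mps_coeff (pp i * (pp j * ?a)) m \<noteq> 0"
      using nz unfolding eq mps_coeff_add by simp
    moreover have "pp i * (pp j * ?a) = pp j * (pp i * ?a)" by (simp only: ac_simps)
    ultimately have "PVar i \<in># m" "PVar j \<in># m"
      by (metis mps_coeff_var_mult_eq_0)+
    thus "i \<in> S \<and> j \<in> S" by (simp add: S_def)
  qed
  show "finite {x \<in> ?I. mps_coeff (?F x) m \<noteq> 0}"
    by (rule finite_subset[OF sub]) (use fin in auto)
qed

text \<open>Division by \<open>2 t\<close> in the field of fractions is genuine.\<close>

lemma two_t_nonzero: "2 * to_fract tt \<noteq> 0"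
proof -
  have "mps_coeff (tt + tt) {#TVar#} \<noteq> 0"
    unfolding mps_coeff_add mps_var_def mps_coeff_Mps by simp
  hence "tt + tt \<noteq> 0" by (metis mps_coeff_0)
  hence "to_fract (tt + tt) \<noteq> 0" by simp
  moreover have "to_fract (tt + tt) = to_fract tt + to_fract tt" by (rule to_fract_add)
  ultimately show ?thesis by (metis mult_2)
qed

end

theory Submission
  imports Defs "HOL-Library.Function_Algebras"
begin

text \<open>
  Remove the label \<open>d\<close> from a transitive monotone solution.  If no transposition moves \<open>d\<close>, then
  \<open>\<rho>\<close> sends \<open>d\<close> to some \<open>x\<close> which \<open>\<sigma>\<close> sends back to \<open>d\<close>, and cutting \<open>d\<close> out of both cycles leaves a
  solution on \<open>d - 1\<close> labels with the marked label \<open>x\<close>.  Otherwise the last transposition is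
  \<open>(a d)\<close> by monotonicity, and it can be moved into \<open>\<sigma>\<close>, cutting or joining cycles of \<open>\<sigma>\<close>; the
  remaining tuple is either transitive or splits into two transitive tuples on complementary sets of
  labels, whose monotone words are merged in a unique way.

  In both cases a single label, \<open>x = d - 1\<close> or \<open>d\<close>, has to be replaced by an average over all
  labels.  This is possible because the number of monotone words with a given product and given
  connected components is invariant under relabelling: the generating function of the words is a
  complete symmetric polynomial in Jucys--Murphy elements that also keep track of connectivity.
\<close>

section \<open>Relabelling invariance of monotone words\<close>

text \<open>Monotonicity refers to the order of the labels, so relabelling gives no evident
  bijection between solutions. What survives is an equality of sums. A monotone word picks a
  monomial in the Jucys--Murphy elements J_b, the sum of the transpositions (a b) with a < b, and
  the sum over all words of length r is h_r(J_2, ..., J_d). In the group algebra, being symmetric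
  makes it central. Centrality alone does not suffice here, because the product of a word does not
  determine which labels the word connects; and once connections are recorded, a transposition has
  no inverse. Conjugation by an adjacent transposition therefore enters as a relabelling operator of
  its own, and only relations that survive without inverses are used. The average over labels
  explains the factors. With d! multiplied out, z d/dz contributes the factor d that turns the sum
  with marked label d into a sum over all ordered pairs of distinct labels; cutting or joining at
  these pairs gives the right-hand side with ordered (i, j). The halves on the two sides of the
  equation cancel.\<close>

text \<open>
  Connectivity is recorded by the family of all label sets that are unions of connected components,
  so that joining two components amounts to an intersection of such families.
\<close>

definition together :: "nat \<Rightarrow> nat \<Rightarrow> nat set set" where
  "together a b = {X. a \<in> X \<longleftrightarrow> b \<in> X}"

definition unsep :: "(nat \<times> nat) list \<Rightarrow> nat set set" where
  "unsep \<tau> = (\<Inter>(a, b)\<in>set \<tau>. together a b)"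

lemma unsep_simps [simp]:
  "unsep [] = UNIV"
  "unsep ((a, b) # \<tau>) = together a b \<inter> unsep \<tau>"
  by (simp_all add: unsep_def)

lemma unsep_append: "unsep (\<tau> @ \<tau>') = unsep \<tau> \<inter> unsep \<tau>'"
  by (auto simp: unsep_def)

text \<open>The label set is arbitrary because a disconnected tuple will be split into words on
  complementary sets of labels.\<close>

definition words :: "nat set \<Rightarrow> nat \<Rightarrow> (nat \<times> nat) list set" where
  "words A r = {\<tau>. length \<tau> = r \<and> (\<forall>(a, b)\<in>set \<tau>. a \<in> A \<and> b \<in> A \<and> a < b) \<and> sorted (map snd \<tau>)}"

lemma finite_words:
  assumes "finite A"
  shows "finite (words A r)"
proof (rule finite_subset)
  show "words A r \<subseteq> {\<tau>. set \<tau> \<subseteq> A \<times> A \<and> length \<tau> = r}"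
    by (auto simp: words_def)
  show "finite {\<tau>. set \<tau> \<subseteq> A \<times> A \<and> length \<tau> = r}"
    by (rule finite_lists_length_eq) (use assms in auto)
qed

lemma words_0 [simp]: "words A 0 = {[]}"
  by (auto simp: words_def)

lemma words_empty [simp]: "words {} (Suc r) = {}"
  by (auto simp: words_def length_Suc_conv) blast

lemma words_snoc:
  "\<tau> @ [(a, b)] \<in> words {1..Suc d} (Suc r) \<longleftrightarrow>
    \<tau> \<in> words {1..b} r \<and> 1 \<le> a \<and> a < b \<and> b \<le> Suc d"
  by (fastforce simp: words_def sorted_append)

text \<open>Second entries increase weakly, so the last letter alone shows whether the largest label
  moves. The empty word is listed separately, since \<open>last []\<close> has no specified
  value.\<close>

lemma words_Suc_not_last:
  "{\<tau> \<in> words {1..Suc d} r. \<tau> = [] \<or> snd (last \<tau>) \<noteq> Suc d} = words {1..d} r"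
proof (cases r)
  case (Suc k)
  have "\<tau> \<in> words {1..Suc d} r \<and> (\<tau> = [] \<or> snd (last \<tau>) \<noteq> Suc d) \<longleftrightarrow> \<tau> \<in> words {1..d} r" for \<tau>
  proof (cases \<tau> rule: rev_cases)
    case (snoc ys y)
    obtain a b where y: "y = (a, b)" by (cases y)
    show ?thesis
      by (auto simp: snoc y words_def sorted_append Suc)
  qed (auto simp: words_def Suc)
  thus ?thesis by blast
qed auto

lemma words_Suc_last:
  "{\<tau> \<in> words {1..Suc d} (Suc r). snd (last \<tau>) = Suc d} =
    (\<lambda>(\<tau>, a). \<tau> @ [(a, Suc d)]) ` (words {1..Suc d} r \<times> {1..d})"
proof (intro equalityI subsetI)
  fix \<tau> assume \<tau>: "\<tau> \<in> {\<tau> \<in> words {1..Suc d} (Suc r). snd (last \<tau>) = Suc d}"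
  show "\<tau> \<in> (\<lambda>(\<tau>, a). \<tau> @ [(a, Suc d)]) ` (words {1..Suc d} r \<times> {1..d})"
  proof (cases \<tau> rule: rev_cases)
    case (snoc ys y)
    obtain a b where y: "y = (a, b)" by (cases y)
    have "ys @ [(a, b)] \<in> words {1..Suc d} (Suc r)" "b = Suc d" using \<tau> by (auto simp: snoc y)
    hence "ys \<in> words {1..Suc d} r" "a \<in> {1..d}" "\<tau> = ys @ [(a, Suc d)]"
      using snoc y unfolding words_snoc by auto
    thus ?thesis by force
  qed (use \<tau> in \<open>auto simp: words_def\<close>)
next
  fix \<tau> assume "\<tau> \<in> (\<lambda>(\<tau>, a). \<tau> @ [(a, Suc d)]) ` (words {1..Suc d} r \<times> {1..d})"
  then obtain ys a where "\<tau> = ys @ [(a, Suc d)]" "ys \<in> words {1..Suc d} r" "a \<in> {1..d}" by auto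
  thus "\<tau> \<in> {\<tau> \<in> words {1..Suc d} (Suc r). snd (last \<tau>) = Suc d}"
    using words_snoc by auto
qed

text \<open>Splitting words by whether the last letter moves the largest label is the recurrence
  h_{r+1}(x_1, ..., x_{d+1}) = h_{r+1}(x_1, ..., x_d) + h_r(x_1, ..., x_{d+1}) x_{d+1}.\<close>

lemma sum_words_Suc:
  fixes f :: "(nat \<times> nat) list \<Rightarrow> 'v :: comm_monoid_add"
  shows "(\<Sum>\<tau>\<in>words {1..Suc d} (Suc r). f \<tau>) =
    (\<Sum>\<tau>\<in>words {1..d} (Suc r). f \<tau>) +
    (\<Sum>\<tau>\<in>words {1..Suc d} r. \<Sum>a\<in>{1..d}. f (\<tau> @ [(a, Suc d)]))"
proof -
  let ?W = "words {1..Suc d} (Suc r)"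
  let ?L = "{\<tau> \<in> ?W. snd (last \<tau>) = Suc d}"
  have "?W = {\<tau> \<in> ?W. \<tau> = [] \<or> snd (last \<tau>) \<noteq> Suc d} \<union> ?L"
    by auto
  hence W: "?W = words {1..d} (Suc r) \<union> ?L"
    unfolding words_Suc_not_last .
  have "words {1..d} (Suc r) \<inter> ?L = {}"
  proof -
    have "snd (last \<tau>) \<noteq> Suc d" if "\<tau> \<in> words {1..d} (Suc r)" for \<tau>
    proof -
      from that have "last \<tau> \<in> set \<tau>" by (intro last_in_set) (auto simp: words_def)
      moreover have "\<forall>x\<in>set \<tau>. snd x \<le> d" using that by (auto simp: words_def)
      ultimately show ?thesis by fastforce
    qed
    thus ?thesis by auto
  qed
  hence "sum f ?W = sum f (words {1..d} (Suc r)) + sum f ?L"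
    by (subst W, subst sum.union_disjoint) (auto simp: finite_words)
  also have "sum f ?L = (\<Sum>(\<tau>, a)\<in>words {1..Suc d} r \<times> {1..d}. f (\<tau> @ [(a, Suc d)]))"
    unfolding words_Suc_last by (subst sum.reindex) (auto simp: inj_on_def case_prod_beta)
  finally show ?thesis by (simp add: sum.cartesian_product)
qed

text \<open>\<open>A\<close> and \<open>B\<close> stand for consecutive Jucys--Murphy operators,
  \<open>C\<close> for conjugation by the adjacent transposition, \<open>A'\<close> for the
  conjugate of \<open>A\<close>, and \<open>S\<close> for the transposition itself. The sum is
  h_n(A, B). \<open>C\<close> exchanges \<open>A\<close> and \<open>A'\<close>, so it commutes with
  A + B and with AB, hence with every symmetric polynomial in them; after expanding
  \<open>B\<close>, the last hypothesis says that \<open>A\<close> and \<open>B\<close>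
  commute.\<close>

lemma complete_symmetric_commute:
  fixes A B A' S C :: "'x :: ab_group_add \<Rightarrow> 'x"
  assumes add: "\<And>x y. A (x + y) = A x + A y" "\<And>x y. B (x + y) = B x + B y"
    "\<And>x y. C (x + y) = C x + C y" "\<And>x y. A' (x + y) = A' x + A' y"
  assumes B: "\<And>x. B x = A' x + S x"
    and C: "\<And>x. C (A x) = A' (C x)" "\<And>x. C (A' x) = A (C x)" "\<And>x. C (S x) = S (C x)"
    and SA: "\<And>x. S (A x) = A' (S x)"
    and AA: "\<And>x. A (A' x) + A (S x) = A' (A x) + A' (S x)"
  shows "C (\<Sum>l\<le>n. (A ^^ (n - l)) ((B ^^ l) x)) = (\<Sum>l\<le>n. (A ^^ (n - l)) ((B ^^ l) (C x)))"
proof -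
  define h where "h = (\<lambda>n x. \<Sum>l\<le>n. (A ^^ (n - l)) ((B ^^ l) x))"
  have AB: "A (B x) = B (A x)" for x
    using AA[of x] by (simp add: B add SA)
  have diff: "f (x - y) = f x - f y" if "\<And>x y. f (x + y) = f x + f y" for f :: "'x \<Rightarrow> 'x" and x y
    using that[of "x - y" y] by (simp add: algebra_simps)
  have zero: "A 0 = 0" using add(1)[of 0 0] by simp
  have sumA: "A (sum f I) = (\<Sum>i\<in>I. A (f i))" for f and I :: "nat set"
    by (induction I rule: infinite_finite_induct) (auto simp: zero add)
  have h0: "h 0 x = x" for x by (simp add: h_def)
  have hSuc: "h (Suc n) x = A (h n x) + (B ^^ Suc n) x" for n x
  proof -
    have "(\<Sum>l\<le>n. (A ^^ (Suc n - l)) ((B ^^ l) x)) = (\<Sum>l\<le>n. A ((A ^^ (n - l)) ((B ^^ l) x)))"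
      by (rule sum.cong) (auto simp: Suc_diff_le)
    thus ?thesis by (simp add: h_def sumA)
  qed
  \<comment> \<open>The generating series of the h_n is 1 / ((1 - A u)(1 - B u)), which gives a
    recurrence whose coefficients are A + B and AB. It has order two, so the induction below carries
    two consecutive values.\<close>
  have h2: "h (Suc (Suc n)) x = A (h (Suc n) x) + B (h (Suc n) x) - A (B (h n x))" for n x
    unfolding hSuc[of "Suc n"] by (simp add: hSuc[of n] add AB)
  have C1: "C (A x) + C (B x) = A (C x) + B (C x)" for x
    by (simp add: B add C)
  have C2: "C (A (B x)) = A (B (C x))" for x
    by (simp add: B add C SA AA)
  have main: "C (h n x) = h n (C x) \<and> C (h (Suc n) x) = h (Suc n) (C x)" for n
  proof (induction n)
    case 0
    show ?case using C1[of x] by (simp add: h0 hSuc add)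
  next
    case (Suc n)
    have "C (h (Suc (Suc n)) x) = C (A (h (Suc n) x)) + C (B (h (Suc n) x)) - C (A (B (h n x)))"
      unfolding h2 by (simp add: add diff)
    also have "\<dots> = h (Suc (Suc n)) (C x)"
      using Suc by (simp add: C1 C2 h2)
    finally show ?case using Suc by simp
  qed
  thus ?thesis by (simp add: h_def)
qed

text \<open>The operators act on all functions of a permutation and a recorded family at once, so an
  operator identity applies to every statistic of the product and the connectivity of a
  word.\<close>

type_synonym 'v state_fun = "(nat \<Rightarrow> nat) \<Rightarrow> nat set set \<Rightarrow> 'v"

definition step_op :: "nat \<Rightarrow> nat \<Rightarrow> 'v state_fun \<Rightarrow> 'v state_fun" where
  "step_op a b F = (\<lambda>g J. F (g \<circ> transpose a b) (J \<inter> together a b))"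

text \<open>The Jucys--Murphy element (1 k) + ... + (k-1 k), acting by right multiplication on the
  group argument, while the family loses the sets that separate a from k.\<close>

definition jm_op :: "nat \<Rightarrow> 'v :: comm_monoid_add state_fun \<Rightarrow> 'v state_fun" where
  "jm_op k F = (\<lambda>g J. \<Sum>a\<in>{1..<k}. step_op a k F g J)"

text \<open>Intersecting with \<open>together a b\<close> cannot be undone, so conjugation is not a
  product of steps. It renames labels in both arguments instead.\<close>

definition conj_op :: "nat \<Rightarrow> nat \<Rightarrow> 'v state_fun \<Rightarrow> 'v state_fun" where
  "conj_op a b F = (\<lambda>g J. F (transpose a b \<circ> g \<circ> transpose a b) ((`) (transpose a b) ` J))"

text \<open>The complete symmetric polynomial h_r in the operators \<open>jm_op 2\<close>, ...,
  \<open>jm_op d\<close>.\<close>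

definition words_op :: "nat \<Rightarrow> nat \<Rightarrow> 'v :: comm_monoid_add state_fun \<Rightarrow> 'v state_fun" where
  "words_op d r F = (\<lambda>g J. \<Sum>\<tau>\<in>words {1..d} r. F (g \<circ> apply_transps \<tau>) (J \<inter> unsep \<tau>))"

lemma op_add:
  "step_op a b (F + G) = step_op a b F + step_op a b G"
  "jm_op k (F + G) = jm_op k F + jm_op k G"
  "conj_op a b (F + G) = conj_op a b F + conj_op a b G"
  "words_op d r (F + G) = words_op d r F + words_op d r G"
  by (simp_all add: fun_eq_iff step_op_def jm_op_def conj_op_def words_op_def sum.distrib)

lemma op_zero:
  "conj_op a b 0 = 0" "words_op d r 0 = 0"
  by (simp_all add: fun_eq_iff conj_op_def words_op_def)

lemma op_sum:
  "conj_op a b (sum F I) = (\<Sum>i\<in>I. conj_op a b (F i))"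
  "words_op d r (sum F I) = (\<Sum>i\<in>I. words_op d r (F i))"
  by (induction I rule: infinite_finite_induct;
      simp only: sum.infinite sum.empty sum.insert op_add op_zero not_False_eq_True)+

lemma words_op_Suc:
  "words_op (Suc d) (Suc r) F = words_op d (Suc r) F + words_op (Suc d) r (jm_op (Suc d) F)"
proof (intro ext)
  fix g :: "nat \<Rightarrow> nat" and J
  have *: "{Suc 0..<Suc d} = {Suc 0..d}" by auto
  show "words_op (Suc d) (Suc r) F g J = (words_op d (Suc r) F + words_op (Suc d) r (jm_op (Suc d) F)) g J"
    unfolding words_op_def sum_words_Suc jm_op_def step_op_def
    by (simp add: * unsep_append comp_assoc Int_assoc del: sum.op_ivl_Suc sum.cl_ivl_Suc)
qed

lemma words_op_0: "words_op d 0 F = F"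
  by (simp add: words_op_def)

text \<open>Sorting by the exponent l of the last variable: h_r(x_1, ..., x_{d+1}) is the sum of
  h_{r-l}(x_1, ..., x_d) x_{d+1}^l.\<close>

lemma words_op_expand:
  "words_op (Suc d) r F = (\<Sum>l\<le>r. words_op d (r - l) ((jm_op (Suc d) ^^ l) F))"
proof (induction r arbitrary: F)
  case (Suc r)
  have "words_op (Suc d) (Suc r) F = words_op d (Suc r) F +
      (\<Sum>l\<le>r. words_op d (r - l) ((jm_op (Suc d) ^^ Suc l) F))"
    by (simp add: words_op_Suc Suc funpow_swap1)
  also have "\<dots> = (\<Sum>l\<le>Suc r. words_op d (Suc r - l) ((jm_op (Suc d) ^^ l) F))"
    by (subst sum.atMost_Suc_shift) simp
  finally show ?case .
qed (simp add: words_op_0)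

lemma comp_transpose:
  assumes "inj f"
  shows "f \<circ> transpose a b = transpose (f a) (f b) \<circ> f"
  using assms by (auto simp: fun_eq_iff transpose_def inj_eq)

lemma conj_step_op:
  "conj_op x y (step_op a b F) = step_op (transpose x y a) (transpose x y b) (conj_op x y F)"
proof (intro ext)
  fix g :: "nat \<Rightarrow> nat" and J
  let ?s = "transpose x y"
  have 1: "?s \<circ> g \<circ> ?s \<circ> transpose a b = ?s \<circ> (g \<circ> transpose (?s a) (?s b)) \<circ> ?s"
    using comp_transpose[of ?s a b] by (simp add: comp_assoc)
  have mem: "c \<in> ?s ` X \<longleftrightarrow> ?s c \<in> X" for c X
    by (metis image_iff transpose_involutory)
  have 2: "(`) ?s ` J \<inter> together a b = (`) ?s ` (J \<inter> together (?s a) (?s b))"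
    by (auto simp: together_def mem)
  show "conj_op x y (step_op a b F) g J = step_op (?s a) (?s b) (conj_op x y F) g J"
    by (simp only: conj_op_def step_op_def 1 2)
qed

lemma step_op_swap:
  assumes "transpose a b \<circ> transpose c d = transpose a' b' \<circ> transpose c' d'"
    "together a b \<inter> together c d = together a' b' \<inter> together c' d'"
  shows "step_op a b (step_op c d F) = step_op a' b' (step_op c' d' F)"
  using assms by (simp add: step_op_def comp_assoc Int_assoc)

text \<open>For n above k + 2 the swap permutes the summands (a n); for n at most k it fixes every
  label involved.\<close>

lemma conj_op_jm_commute:
  assumes "n \<noteq> Suc k" "n \<noteq> Suc (Suc k)"
  shows "conj_op (Suc k) (Suc (Suc k)) (jm_op n F) = jm_op n (conj_op (Suc k) (Suc (Suc k)) F)"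
proof (intro ext)
  fix g :: "nat \<Rightarrow> nat" and J
  let ?s = "transpose (Suc k) (Suc (Suc k))"
  have "conj_op (Suc k) (Suc (Suc k)) (jm_op n F) g J =
      (\<Sum>a\<in>{1..<n}. conj_op (Suc k) (Suc (Suc k)) (step_op a n F) g J)"
    by (simp add: conj_op_def jm_op_def)
  also have "\<dots> = (\<Sum>a\<in>{1..<n}. step_op (?s a) n (conj_op (Suc k) (Suc (Suc k)) F) g J)"
    using assms by (simp add: conj_step_op transpose_def)
  also have "\<dots> = (\<Sum>a\<in>{1..<n}. step_op a n (conj_op (Suc k) (Suc (Suc k)) F) g J)"
    by (rule sum.reindex_bij_witness[where i = ?s and j = ?s])
       (use assms in \<open>auto simp: transpose_def split: if_splits\<close>)
  finally show "conj_op (Suc k) (Suc (Suc k)) (jm_op n F) g J = jm_op n (conj_op (Suc k) (Suc (Suc k)) F) g J"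
    by (simp add: jm_op_def)
qed

text \<open>
  The Jucys--Murphy relation behind this lemma is \<open>J\<^bsub>k+1\<^esub> = s J\<^bsub>k\<^esub> s + s\<close>, with the
  summand \<open>s\<close> also recording that \<open>k\<close> and \<open>k + 1\<close> have become connected.
\<close>

lemma conj_op_jm_complete_symmetric:
  fixes F :: "'v :: ab_group_add state_fun"
    and k n :: nat
  defines "C \<equiv> conj_op (Suc k) (Suc (Suc k))"
  shows "C (\<Sum>l\<le>n. (jm_op (Suc k) ^^ (n - l)) ((jm_op (Suc (Suc k)) ^^ l) F)) =
    (\<Sum>l\<le>n. (jm_op (Suc k) ^^ (n - l)) ((jm_op (Suc (Suc k)) ^^ l) (C F)))"
proof -
  let ?p = "Suc k" and ?q = "Suc (Suc k)"
  let ?s = "transpose ?p ?q"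
  define A' :: "'v state_fun \<Rightarrow> 'v state_fun" where
    "A' F = (\<lambda>g J. \<Sum>a\<in>{1..<?p}. step_op a ?q F g J)" for F
  define S :: "'v state_fun \<Rightarrow> 'v state_fun" where
    "S = step_op ?p ?q"
  show ?thesis
  proof (rule complete_symmetric_commute[where A' = A' and S = S])
    fix x :: "'v state_fun"
    have Cs: "C (step_op a b x) = step_op (?s a) (?s b) (C x)" for a b and x :: "'v state_fun"
      unfolding C_def by (rule conj_step_op)
    show "jm_op ?q x = A' x + S x"
      by (simp add: fun_eq_iff jm_op_def A'_def S_def)
    show "C (S x) = S (C x)"
      unfolding S_def Cs by (simp add: step_op_def transpose_commute together_def eq_commute)
    show "C (jm_op ?p x) = A' (C x)"
    proof (intro ext)
      fix g J
      have "C (jm_op ?p x) g J = (\<Sum>a\<in>{1..<?p}. C (step_op a ?p x) g J)"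
        by (simp add: C_def conj_op_def jm_op_def)
      also have "\<dots> = A' (C x) g J"
        unfolding A'_def Cs by (rule sum.cong) (auto simp: transpose_def)
      finally show "C (jm_op ?p x) g J = A' (C x) g J" .
    qed
    show "C (A' x) = jm_op ?p (C x)"
    proof (intro ext)
      fix g J
      have "C (A' x) g J = (\<Sum>a\<in>{1..<?p}. C (step_op a ?q x) g J)"
        by (simp add: C_def conj_op_def A'_def)
      also have "\<dots> = jm_op ?p (C x) g J"
        unfolding jm_op_def Cs by (rule sum.cong) (auto simp: transpose_def)
      finally show "C (A' x) g J = jm_op ?p (C x) g J" .
    qed
    have 1: "step_op ?p ?q (step_op a ?p x) = step_op a ?q (step_op ?p ?q x)" if "a < ?p" for a
      by (rule step_op_swap) (use that in \<open>auto simp: fun_eq_iff transpose_def together_def\<close>)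
    show "S (jm_op ?p x) = A' (S x)"
    proof (intro ext)
      fix g J
      have "S (jm_op ?p x) g J = (\<Sum>a\<in>{1..<?p}. step_op ?p ?q (step_op a ?p x) g J)"
        by (simp add: S_def jm_op_def step_op_def)
      also have "\<dots> = A' (S x) g J"
        unfolding A'_def S_def by (rule sum.cong) (auto simp: 1)
      finally show "S (jm_op ?p x) g J = A' (S x) g J" .
    qed
    have 2: "step_op a ?p (step_op b ?q x) = step_op b ?q (step_op a ?p x)"
      if "a < ?p" "b < ?p" "a \<noteq> b" for a b
      by (rule step_op_swap) (use that in \<open>auto simp: fun_eq_iff transpose_def\<close>)
    \<comment> \<open>The terms with equal small labels live on the three labels a, k + 1, k + 2.
      Each product is a 3-cycle and connects the same three labels, so both the permutation and the
      recorded family agree.\<close>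
    have 3: "step_op a ?p (step_op a ?q x) = step_op a ?q (step_op ?p ?q x)" if "a < ?p" for a
      by (rule step_op_swap) (use that in \<open>auto simp: fun_eq_iff transpose_def together_def\<close>)
    have 4: "step_op a ?p (step_op ?p ?q x) = step_op a ?q (step_op a ?p x)" if "a < ?p" for a
      by (rule step_op_swap) (use that in \<open>auto simp: fun_eq_iff transpose_def together_def\<close>)
    show "jm_op ?p (A' x) + jm_op ?p (S x) = A' (jm_op ?p x) + A' (S x)"
    proof (intro ext)
      fix g J
      let ?I = "{1..<?p}"
      have split: "(\<Sum>a\<in>?I. \<Sum>b\<in>?I. f a b) = (\<Sum>a\<in>?I. f a a) + (\<Sum>a\<in>?I. \<Sum>b\<in>?I - {a}. f a b)"
        for f :: "nat \<Rightarrow> nat \<Rightarrow> 'v"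
        unfolding sum.distrib[symmetric] by (rule sum.cong) (auto simp: sum.remove simp del: sum.op_ivl_Suc)
      have swap: "(\<Sum>a\<in>?I. \<Sum>b\<in>?I - {a}. step_op a ?p (step_op b ?q x) g J) =
          (\<Sum>a\<in>?I. \<Sum>b\<in>?I - {a}. step_op a ?q (step_op b ?p x) g J)"
      proof -
        have "(\<Sum>a\<in>?I. \<Sum>b\<in>?I - {a}. step_op a ?p (step_op b ?q x) g J) =
            (\<Sum>a\<in>?I. \<Sum>b\<in>?I - {a}. step_op b ?q (step_op a ?p x) g J)"
          by (intro sum.cong refl) (simp add: 2)
        also have "\<dots> = (\<Sum>(a, b)\<in>(SIGMA a:?I. ?I - {a}). step_op b ?q (step_op a ?p x) g J)"
          by (rule sum.Sigma) auto
        also have "\<dots> = (\<Sum>(a, b)\<in>(SIGMA a:?I. ?I - {a}). step_op a ?q (step_op b ?p x) g J)"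
          by (rule sum.reindex_bij_witness[where i = prod.swap and j = prod.swap]) auto
        also have "\<dots> = (\<Sum>a\<in>?I. \<Sum>b\<in>?I - {a}. step_op a ?q (step_op b ?p x) g J)"
          by (rule sum.Sigma[symmetric]) auto
        finally show ?thesis .
      qed
      have "jm_op ?p (A' x) g J + jm_op ?p (S x) g J =
          (\<Sum>a\<in>?I. \<Sum>b\<in>?I. step_op a ?p (step_op b ?q x) g J) +
          (\<Sum>a\<in>?I. step_op a ?p (step_op ?p ?q x) g J)"
        by (simp add: jm_op_def A'_def S_def step_op_def)
      also have "\<dots> = (\<Sum>a\<in>?I. step_op a ?q (step_op ?p ?q x) g J) +
          (\<Sum>a\<in>?I. \<Sum>b\<in>?I - {a}. step_op a ?q (step_op b ?p x) g J) +
          (\<Sum>a\<in>?I. step_op a ?q (step_op a ?p x) g J)"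
        unfolding split swap using 3 4 by simp
      also have "\<dots> = (\<Sum>a\<in>?I. \<Sum>b\<in>?I. step_op a ?q (step_op b ?p x) g J) +
          (\<Sum>a\<in>?I. step_op a ?q (step_op ?p ?q x) g J)"
        unfolding split by (simp only: ac_simps)
      also have "\<dots> = A' (jm_op ?p x) g J + A' (S x) g J"
        by (simp add: jm_op_def A'_def S_def step_op_def)
      finally show "(jm_op ?p (A' x) + jm_op ?p (S x)) g J = (A' (jm_op ?p x) + A' (S x)) g J"
        by simp
    qed
  qed (simp_all only: C_def op_add, simp add: A'_def fun_eq_iff op_add sum.distrib)
qed

text \<open>Passes from d to d + 1 when the conjugation commutes with the new variable on its
  own.\<close>

lemma conj_op_words_step:
  assumes "\<And>r F. C (words_op d r F) = words_op d r (C F)"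
    and "\<And>F. C (jm_op (Suc d) F) = jm_op (Suc d) (C F)"
    and "C = conj_op a b"
  shows "C (words_op (Suc d) r F) = words_op (Suc d) r (C F)"
proof -
  have "C ((jm_op (Suc d) ^^ l) F) = (jm_op (Suc d) ^^ l) (C F)" for l
    by (induction l) (simp_all add: assms(2))
  moreover have "C (sum f I) = (\<Sum>i\<in>I. C (f i))" for f and I :: "nat set"
    unfolding assms(3) by (rule op_sum)
  ultimately show ?thesis by (simp add: words_op_expand assms(1))
qed

lemma conj_op_words_low:
  assumes "d \<le> k"
  shows "conj_op (Suc k) (Suc (Suc k)) (words_op d r F) = words_op d r (conj_op (Suc k) (Suc (Suc k)) F)"
  using assms
proof (induction d arbitrary: r F)
  case 0
  show ?case
  proof (cases r)
    case (Suc n)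
    thus ?thesis by (simp add: words_op_def conj_op_def)
  qed (simp add: words_op_0)
next
  case (Suc d)
  show ?case
    by (rule conj_op_words_step[OF _ _ refl]) (use Suc in \<open>auto simp: conj_op_jm_commute\<close>)
qed

text \<open>The variables of index k + 1 and k + 2 do not commute with the conjugation one at a
  time, so the induction starts at d = k + 2, where they enter together through h_n; later variables
  commute individually.\<close>

lemma conj_op_words:
  fixes F :: "'v :: ab_group_add state_fun"
  assumes "Suc (Suc k) \<le> d"
  shows "conj_op (Suc k) (Suc (Suc k)) (words_op d r F) = words_op d r (conj_op (Suc k) (Suc (Suc k)) F)"
  using assms
proof (induction d arbitrary: r F rule: dec_induct)
  case base
  let ?C = "conj_op (Suc k) (Suc (Suc k))"
  \<comment> \<open>h_r in all variables is the sum over n of h_{r-n} in the first k variables times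
    h_n in the last two.\<close>
  have two: "words_op (Suc (Suc k)) r F = (\<Sum>n\<le>r. words_op k (r - n)
      (\<Sum>l\<le>n. (jm_op (Suc k) ^^ (n - l)) ((jm_op (Suc (Suc k)) ^^ l) F)))"
    for F :: "'v state_fun" and r
  proof -
    have "words_op (Suc (Suc k)) r F = (\<Sum>(l, m)\<in>(SIGMA l:{..r}. {..r - l}).
        words_op k (r - l - m) ((jm_op (Suc k) ^^ m) ((jm_op (Suc (Suc k)) ^^ l) F)))"
      by (simp add: words_op_expand sum.Sigma)
    also have "\<dots> = (\<Sum>(n, l)\<in>(SIGMA n:{..r}. {..n}).
        words_op k (r - n) ((jm_op (Suc k) ^^ (n - l)) ((jm_op (Suc (Suc k)) ^^ l) F)))"
      by (rule sum.reindex_bij_witness[where i = "\<lambda>(n, l). (l, n - l)" and j = "\<lambda>(l, m). (l + m, l)"])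
         auto
    finally show ?thesis by (simp add: sum.Sigma op_sum)
  qed
  show ?case
    unfolding two by (simp only: op_sum(1)[of _ _ _ "{..r}"] conj_op_words_low[OF order.refl]
        conj_op_jm_complete_symmetric)
next
  case (step n)
  show ?case
    by (rule conj_op_words_step[OF _ _ refl]) (use step in \<open>auto simp: conj_op_jm_commute\<close>)
qed

text \<open>Evaluates the commutation at the identity and the full family, both of which are fixed
  by relabelling. Conjugating the letters of a word can break monotonicity, so this is an equality
  of sums only.\<close>

lemma sum_words_conj:
  fixes F :: "'v :: ab_group_add state_fun"
  assumes "Suc (Suc k) \<le> d" and s: "s = transpose (Suc k) (Suc (Suc k))"
  shows "(\<Sum>\<tau>\<in>words {1..d} r. F (s \<circ> apply_transps \<tau> \<circ> s) ((`) s ` unsep \<tau>)) =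
    (\<Sum>\<tau>\<in>words {1..d} r. F (apply_transps \<tau>) (unsep \<tau>))"
proof -
  have "surj ((`) s)"
    by (intro surjI[where f = "(`) s"]) (simp add: s image_comp)
  hence "conj_op (Suc k) (Suc (Suc k)) (words_op d r F) id UNIV = words_op d r F id UNIV"
    by (simp add: conj_op_def s)
  thus ?thesis
    unfolding conj_op_words[OF assms(1)] by (simp add: words_op_def conj_op_def s)
qed

section \<open>Cycle types under multiplication by a transposition\<close>

text \<open>\<open>cycle_type\<close> for an arbitrary carrier, so that it also applies to the
  blocks of a disconnected tuple.\<close>

definition ctype :: "'a set \<Rightarrow> ('a \<Rightarrow> 'a) \<Rightarrow> nat multiset" where
  "ctype A \<sigma> = image_mset card (mset_set (orbit \<sigma> ` A))"

abbreviation clen :: "('a \<Rightarrow> 'a) \<Rightarrow> 'a \<Rightarrow> nat" where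
  "clen \<sigma> x \<equiv> card (orbit \<sigma> x)"

lemma orbit_subset_closed:
  assumes "x \<in> X" "\<And>z. z \<in> X \<Longrightarrow> f z \<in> X"
  shows "orbit f x \<subseteq> X"
proof
  fix y assume "y \<in> orbit f x"
  thus "y \<in> X" by induction (use assms in auto)
qed

context
  fixes \<sigma> :: "'a \<Rightarrow> 'a" and A :: "'a set"
  assumes finA: "finite A" and perm: "\<sigma> permutes A"
begin

lemma permutation_of: "permutation \<sigma>"
  using finA perm permutation_permutes by blast

lemma self_in_orbit: "x \<in> orbit \<sigma> x"
  by (rule permutation_self_in_orbit[OF permutation_of])

lemma orbit_eq_of_mem: "y \<in> orbit \<sigma> x \<Longrightarrow> orbit \<sigma> y = orbit \<sigma> x"
  by (meson orbit_swap orbit_trans self_in_orbit subsetI subset_antisym)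

lemma orbit_eq_iff: "orbit \<sigma> y = orbit \<sigma> x \<longleftrightarrow> y \<in> orbit \<sigma> x"
  using orbit_eq_of_mem self_in_orbit by blast

lemma orbit_in_carrier: "x \<in> A \<Longrightarrow> orbit \<sigma> x \<subseteq> A"
  by (rule orbit_subset_closed) (use perm in \<open>auto simp: permutes_in_image\<close>)

lemma finite_orbit_of: "finite (orbit \<sigma> x)"
  by (rule finite_orbit[OF self_in_orbit])

lemma clen_pos: "clen \<sigma> x > 0"
  using finite_orbit_of self_in_orbit[of x] by (auto simp: card_gt_0_iff)

lemma clen_cong: "y \<in> orbit \<sigma> x \<Longrightarrow> clen \<sigma> y = clen \<sigma> x"
  by (simp add: orbit_eq_of_mem)

lemma orbit_step_iff: "\<sigma> z \<in> orbit \<sigma> x \<longleftrightarrow> z \<in> orbit \<sigma> x"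
  by (metis orbit.base orbit.step orbit_eq_iff)

lemma orbits_disjoint:
  assumes "P \<in> orbit \<sigma> ` A" "Q \<in> orbit \<sigma> ` A" "P \<noteq> Q"
  shows "P \<inter> Q = {}"
  using assms orbit_eq_of_mem by blast

text \<open>Each cycle of length i holds i points. This is the origin of the factors i, j and i + j
  that accompany the derivatives in the equation.\<close>

lemma count_ctype: "card {x \<in> A. clen \<sigma> x = i} = i * count (ctype A \<sigma>) i"
proof -
  let ?O = "{P \<in> orbit \<sigma> ` A. card P = i}"
  have "{x \<in> A. clen \<sigma> x = i} = \<Union>?O"
    using self_in_orbit orbit_in_carrier clen_cong by fastforce
  also have "card \<dots> = (\<Sum>P\<in>?O. card P)"
    by (rule card_Union_disjoint)
       (use orbits_disjoint in \<open>auto simp: finite_orbit_of pairwise_def disjnt_def\<close>)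
  also have "\<dots> = i * card ?O" by simp
  also have "card ?O = count (ctype A \<sigma>) i"
  proof -
    have "{P \<in> orbit \<sigma> ` A. i = card P} = {P \<in> orbit \<sigma> ` A. card P = i}" by auto
    thus ?thesis using finA by (simp add: ctype_def count_image_mset' count_mset_set' sum.If_cases)
  qed
  finally show ?thesis .
qed

lemma clen_in_ctype: "x \<in> A \<Longrightarrow> clen \<sigma> x \<in># ctype A \<sigma>"
  using finA by (simp add: ctype_def)

text \<open>Removing the cycle of x lowers the count only at its own length. This feeds the second
  derivative, where the second label lies in a different cycle from the first.\<close>

lemma count_ctype_minus:
  assumes "x \<in> A"
  shows "card {y \<in> A. y \<notin> orbit \<sigma> x \<and> clen \<sigma> y = j} = j * count (ctype A \<sigma> - {#clen \<sigma> x#}) j"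
proof (cases "clen \<sigma> x = j")
  case True
  have "{y \<in> A. y \<notin> orbit \<sigma> x \<and> clen \<sigma> y = j} = {y \<in> A. clen \<sigma> y = j} - orbit \<sigma> x"
    by auto
  moreover have "orbit \<sigma> x \<subseteq> {y \<in> A. clen \<sigma> y = j}"
    using orbit_in_carrier[OF assms] clen_cong True by auto
  ultimately have "card {y \<in> A. y \<notin> orbit \<sigma> x \<and> clen \<sigma> y = j} = j * count (ctype A \<sigma>) j - j"
    using card_Diff_subset[OF finite_orbit_of] True by (simp add: count_ctype)
  thus ?thesis by (simp add: True diff_mult_distrib2)
next
  case False
  hence "{y \<in> A. y \<notin> orbit \<sigma> x \<and> clen \<sigma> y = j} = {y \<in> A. clen \<sigma> y = j}"
    using clen_cong by auto
  thus ?thesis using False by (simp add: count_ctype)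
qed

lemma ctype_partition: "0 \<notin># ctype A \<sigma>" "sum_mset (ctype A \<sigma>) = card A"
proof -
  show "0 \<notin># ctype A \<sigma>"
    using finA clen_pos by (auto simp: ctype_def) (metis less_irrefl)
  have "sum_mset (ctype A \<sigma>) = (\<Sum>P\<in>orbit \<sigma> ` A. card P)"
    by (simp add: ctype_def sum_unfold_sum_mset)
  also have "\<dots> = card (\<Union>(orbit \<sigma> ` A))"
    by (rule card_Union_disjoint[symmetric])
       (use orbits_disjoint in \<open>auto simp: finite_orbit_of pairwise_def disjnt_def\<close>)
  also have "\<Union>(orbit \<sigma> ` A) = A"
    using self_in_orbit orbit_in_carrier by blast
  finally show "sum_mset (ctype A \<sigma>) = card A" .
qed

lemma ctype_remove:
  assumes "finite P" "P \<subseteq> orbit \<sigma> ` A"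
  shows "ctype A \<sigma> = image_mset card (mset_set (orbit \<sigma> ` A - P)) + image_mset card (mset_set P)"
proof -
  have "mset_set (orbit \<sigma> ` A) = mset_set (orbit \<sigma> ` A - P) + mset_set P"
    using assms finA by (metis Diff_partition Diff_disjoint add.commute finite_imageI finite_Diff mset_set_Union)
  thus ?thesis by (simp add: ctype_def)
qed

section \<open>Transpositions that join two cycles\<close>

lemma permutes_transpose_comp:
  assumes "x \<in> A" "y \<in> A"
  shows "transpose x y \<circ> \<sigma> permutes A"
  by (intro permutes_compose perm permutes_swap_id assms)

text \<open>Starting at x, the product follows the cycle of x until the step that would return to x,
  which leads to y instead; then it follows the cycle of y and closes at x.\<close>

lemma join_orbit:
  assumes "x \<in> A" "y \<in> A" "y \<notin> orbit \<sigma> x"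
  shows "orbit (transpose x y \<circ> \<sigma>) x = orbit \<sigma> x \<union> orbit \<sigma> y"
proof (rule antisym)
  let ?\<sigma> = "transpose x y \<circ> \<sigma>"
  have self: "x \<in> orbit ?\<sigma> x"
    by (rule permutation_self_in_orbit)
       (use finA permutes_transpose_comp assms permutation_permutes in blast)
  have step: "?\<sigma> z \<in> orbit ?\<sigma> x" if "z \<in> orbit ?\<sigma> x" for z
    by (rule orbit.step[OF that])
  show "orbit ?\<sigma> x \<subseteq> orbit \<sigma> x \<union> orbit \<sigma> y"
    by (rule orbit_subset_closed) (auto simp: self_in_orbit transpose_def orbit_step_iff)
  have 1: "orbit \<sigma> x \<subseteq> orbit \<sigma> x \<inter> orbit ?\<sigma> x"
  proof (rule orbit_subset_closed)
    fix z assume z: "z \<in> orbit \<sigma> x \<inter> orbit ?\<sigma> x"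
    hence "\<sigma> z \<noteq> y" using assms orbit_step_iff by blast
    thus "\<sigma> z \<in> orbit \<sigma> x \<inter> orbit ?\<sigma> x"
      using step[of z] z self by (auto simp: orbit_step_iff transpose_def split: if_splits)
  qed (use self self_in_orbit in auto)
  \<comment> \<open>The predecessor of x is the point from which the cycle is redirected to
    y.\<close>
  have "inv' \<sigma> x \<in> orbit \<sigma> x"
    by (metis orbit_step_iff perm permutes_inverses(1) self_in_orbit)
  hence "?\<sigma> (inv' \<sigma> x) \<in> orbit ?\<sigma> x" using 1 step by blast
  hence y: "y \<in> orbit ?\<sigma> x" by (simp add: permutes_inverses(1)[OF perm])
  have "orbit \<sigma> y \<subseteq> orbit ?\<sigma> x"
    by (rule orbit_subset_closed[OF y])
       (use step self y in \<open>fastforce simp: transpose_def split: if_splits\<close>)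
  thus "orbit \<sigma> x \<union> orbit \<sigma> y \<subseteq> orbit ?\<sigma> x" using 1 by auto
qed

lemma join_orbit':
  assumes "x \<in> A" "y \<in> A" "y \<notin> orbit \<sigma> x" "z \<in> orbit \<sigma> x \<union> orbit \<sigma> y"
  shows "orbit (transpose x y \<circ> \<sigma>) z = orbit \<sigma> x \<union> orbit \<sigma> y"
proof -
  have "permutation (transpose x y \<circ> \<sigma>)"
    using finA permutes_transpose_comp[OF assms(1,2)] permutation_permutes by blast
  moreover have "z \<in> orbit (transpose x y \<circ> \<sigma>) x" using join_orbit assms by simp
  ultimately have "orbit (transpose x y \<circ> \<sigma>) z = orbit (transpose x y \<circ> \<sigma>) x"
    by (meson orbit_swap orbit_trans permutation_self_in_orbit subsetI subset_antisym)
  thus ?thesis using join_orbit assms by simp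
qed

lemma join_orbit_other:
  assumes "z \<notin> orbit \<sigma> x" "z \<notin> orbit \<sigma> y"
  shows "orbit (transpose x y \<circ> \<sigma>) z = orbit \<sigma> z"
proof -
  have "transpose x y (\<sigma> w) = \<sigma> w" if "w \<in> orbit \<sigma> z" for w
  proof -
    have "\<sigma> w \<in> orbit \<sigma> z" using that orbit_step_iff by blast
    hence "\<sigma> w \<noteq> x" "\<sigma> w \<noteq> y" using assms by (metis orbit_eq_iff)+
    thus ?thesis by (simp add: transpose_def)
  qed
  thus ?thesis by (intro orbit_cong[OF self_in_orbit]) auto
qed

text \<open>Stating both cycle types with the shared remainder \<open>K\<close> of the other cycles
  lets the lemma be read backwards for a cut.\<close>

lemma ctype_join:
  assumes "x \<in> A" "y \<in> A" "y \<notin> orbit \<sigma> x"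
  obtains K where "ctype A \<sigma> = add_mset (clen \<sigma> x) (add_mset (clen \<sigma> y) K)"
    "ctype A (transpose x y \<circ> \<sigma>) = add_mset (clen \<sigma> x + clen \<sigma> y) K"
proof -
  let ?\<sigma> = "transpose x y \<circ> \<sigma>" and ?x = "orbit \<sigma> x" and ?y = "orbit \<sigma> y"
  let ?K = "image_mset card (mset_set (orbit \<sigma> ` A - {?x, ?y}))"
  have ne: "?x \<noteq> ?y" using assms orbit_eq_iff by blast
  have "?x \<inter> ?y = {}" using orbits_disjoint assms ne by blast
  hence card: "card (?x \<union> ?y) = clen \<sigma> x + clen \<sigma> y"
    by (simp add: card_Un_disjoint finite_orbit_of)
  have 1: "ctype A \<sigma> = add_mset (clen \<sigma> x) (add_mset (clen \<sigma> y) ?K)"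
    using ctype_remove[of "{?x, ?y}"] assms ne by simp
  have "orbit ?\<sigma> ` A = insert (?x \<union> ?y) (orbit \<sigma> ` A - {?x, ?y})"
  proof (intro equalityI subsetI)
    fix P assume "P \<in> orbit ?\<sigma> ` A"
    then obtain z where z: "z \<in> A" "P = orbit ?\<sigma> z" by auto
    show "P \<in> insert (?x \<union> ?y) (orbit \<sigma> ` A - {?x, ?y})"
    proof (cases "z \<in> ?x \<union> ?y")
      case True
      thus ?thesis using join_orbit'[OF assms] z by simp
    next
      case False
      thus ?thesis using join_orbit_other[of z x y] z orbit_eq_iff by auto
    qed
  next
    fix P assume P: "P \<in> insert (?x \<union> ?y) (orbit \<sigma> ` A - {?x, ?y})"
    show "P \<in> orbit ?\<sigma> ` A"
    proof (cases "P = ?x \<union> ?y")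
      case True
      thus ?thesis using join_orbit[OF assms] assms(1) by auto
    next
      case False
      then obtain z where z: "z \<in> A" "P = orbit \<sigma> z" "P \<noteq> ?x" "P \<noteq> ?y" using P by auto
      hence "orbit ?\<sigma> z = P" using join_orbit_other[of z x y] orbit_eq_iff by simp
      thus ?thesis using z by auto
    qed
  qed
  moreover have "?x \<union> ?y \<notin> orbit \<sigma> ` A - {?x, ?y}"
  proof
    assume "?x \<union> ?y \<in> orbit \<sigma> ` A - {?x, ?y}"
    then obtain z where "?x \<union> ?y = orbit \<sigma> z" "orbit \<sigma> z \<noteq> ?x" by auto
    thus False using self_in_orbit[of x] orbit_eq_iff[of x z] by auto
  qed
  ultimately have "ctype A ?\<sigma> = add_mset (card (?x \<union> ?y)) ?K"
    using finA by (simp add: ctype_def)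
  thus ?thesis using that 1 card by simp
qed

section \<open>Transpositions that cut a cycle\<close>

lemma orbit_powers:
  "(\<lambda>i. (\<sigma> ^^ i) x) ` {..<clen \<sigma> x} = orbit \<sigma> x"
  "inj_on (\<lambda>i. (\<sigma> ^^ i) x) {..<clen \<sigma> x}"
proof -
  let ?n = "funpow_dist1 \<sigma> x x"
  have 1: "orbit \<sigma> x = (\<lambda>i. (\<sigma> ^^ i) x) ` {0..<?n}"
    by (rule orbit_conv_funpow_dist1[OF self_in_orbit])
  have 2: "inj_on (\<lambda>i. (\<sigma> ^^ i) x) {0..<?n}"
    by (rule inj_on_funpow_dist1[OF self_in_orbit])
  have "clen \<sigma> x = ?n" unfolding 1 by (simp add: card_image[OF 2])
  thus "(\<lambda>i. (\<sigma> ^^ i) x) ` {..<clen \<sigma> x} = orbit \<sigma> x" "inj_on (\<lambda>i. (\<sigma> ^^ i) x) {..<clen \<sigma> x}"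
    using 1 2 by (simp_all add: atLeast0LessThan)
qed

text \<open>The first i points are visited unchanged; the step that would reach the i-th iterate is
  redirected to x.\<close>

lemma cut_orbit:
  assumes i: "0 < i" "i < clen \<sigma> x"
  shows "orbit (transpose x ((\<sigma> ^^ i) x) \<circ> \<sigma>) x = (\<lambda>k. (\<sigma> ^^ k) x) ` {..<i}"
proof -
  let ?y = "(\<sigma> ^^ i) x"
  let ?\<sigma> = "transpose x ?y \<circ> \<sigma>"
  have ne: "(\<sigma> ^^ a) x \<noteq> (\<sigma> ^^ b) x" if "a \<noteq> b" "a < clen \<sigma> x" "b < clen \<sigma> x" for a b
    using orbit_powers(2) that by (auto simp: inj_on_def)
  have pow: "(?\<sigma> ^^ k) x = (\<sigma> ^^ k) x" if "k < i" for k
    using that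
  proof (induction k)
    case (Suc k)
    have "(\<sigma> ^^ Suc k) x \<noteq> x" "(\<sigma> ^^ Suc k) x \<noteq> ?y"
      using ne[of "Suc k" 0] ne[of "Suc k" i] Suc.prems i by auto
    thus ?case using Suc by (simp add: transpose_def)
  qed simp
  obtain k where k: "i = Suc k" using i by (cases i) auto
  have "(?\<sigma> ^^ i) x = x" using pow[of k] by (simp add: k)
  hence "orbit ?\<sigma> x = {(?\<sigma> ^^ m) x |m. m < i}"
    by (rule orbit_altdef_bounded) (use i in auto)
  also have "\<dots> = (\<lambda>k. (?\<sigma> ^^ k) x) ` {..<i}" by auto
  also have "\<dots> = (\<lambda>k. (\<sigma> ^^ k) x) ` {..<i}" by (rule image_cong) (auto simp: pow)
  finally show ?thesis .
qed

end

lemma transpose_comp_twice [simp]: "transpose x y \<circ> (transpose x y \<circ> f) = f"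
  by (simp add: fun_eq_iff)

text \<open>Only the part containing x is computed. Since a transposition is an involution, joining
  the two parts gives back the cycle of \<open>\<sigma>\<close>, which forces the length of the
  other part.\<close>

lemma cut_lengths:
  assumes A: "finite A" "\<sigma> permutes A" "x \<in> A" and i: "0 < i" "i < clen \<sigma> x"
  defines "y \<equiv> (\<sigma> ^^ i) x"
  defines "\<sigma>' \<equiv> transpose x y \<circ> \<sigma>"
  shows "clen \<sigma>' x = i" "clen \<sigma>' y = clen \<sigma> x - i" "y \<notin> orbit \<sigma>' x"
proof -
  note inj = orbit_powers(2)[OF A(1,2), of x]
  have y: "y \<in> A"
    using A permutes_in_image[OF permutes_funpow[OF A(2)]] by (simp add: y_def)
  have perm: "\<sigma>' permutes A"
    unfolding \<sigma>'_def using permutes_transpose_comp[OF A(1,2)] A y by blast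
  have orb: "orbit \<sigma>' x = (\<lambda>k. (\<sigma> ^^ k) x) ` {..<i}"
    unfolding \<sigma>'_def y_def by (rule cut_orbit[OF A(1,2) i])
  show 1: "clen \<sigma>' x = i"
    unfolding orb using inj_on_subset[OF inj, of "{..<i}"] i by (subst card_image) auto
  show ny: "y \<notin> orbit \<sigma>' x"
  proof
    assume "y \<in> orbit \<sigma>' x"
    then obtain k where "k < i" "(\<sigma> ^^ i) x = (\<sigma> ^^ k) x" by (auto simp: orb y_def)
    thus False using inj_onD[OF inj, of i k] i by auto
  qed
  have "orbit \<sigma> x = orbit \<sigma>' x \<union> orbit \<sigma>' y"
    using join_orbit[OF A(1) perm A(3) y ny] by (simp add: \<sigma>'_def)
  moreover have "orbit \<sigma>' x \<inter> orbit \<sigma>' y = {}"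
    using orbits_disjoint[OF A(1) perm] orbit_eq_iff[OF A(1) perm, of y x] A y ny by blast
  ultimately have "clen \<sigma> x = clen \<sigma>' x + clen \<sigma>' y"
    by (simp add: card_Un_disjoint finite_orbit_of[OF A(1) perm])
  thus "clen \<sigma>' y = clen \<sigma> x - i" using 1 by simp
qed

text \<open>The other points of the cycle are the iterates of x with exponents i from 1 to the
  length minus 1, and exponent i splits off exactly i points: each ordered way of cutting occurs
  once.\<close>

lemma sum_cut:
  fixes F :: "nat multiset \<Rightarrow> 'v :: comm_monoid_add"
  assumes A: "finite A" "\<sigma> permutes A" "x \<in> A"
  shows "(\<Sum>y\<in>orbit \<sigma> x - {x}. F (ctype A (transpose x y \<circ> \<sigma>))) =
    (\<Sum>i\<in>{1..<clen \<sigma> x}. F (add_mset i (add_mset (clen \<sigma> x - i) (ctype A \<sigma> - {#clen \<sigma> x#}))))"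
proof -
  let ?g = "\<lambda>i. (\<sigma> ^^ i) x"
  note pow = orbit_powers[OF A(1,2), of x]
  have inj: "inj_on ?g {1..<clen \<sigma> x}"
    by (rule inj_on_subset[OF pow(2)]) auto
  have "?g ` ({..<clen \<sigma> x} - {0}) = ?g ` {..<clen \<sigma> x} - ?g ` {0}"
    by (rule inj_on_image_set_diff[OF pow(2)]) (use clen_pos[OF A(1,2), of x] in auto)
  moreover have "{..<clen \<sigma> x} - {0} = {1..<clen \<sigma> x}" by auto
  ultimately have im: "?g ` {1..<clen \<sigma> x} = orbit \<sigma> x - {x}" using pow(1) by simp
  have ct: "ctype A (transpose x (?g i) \<circ> \<sigma>) =
      add_mset i (add_mset (clen \<sigma> x - i) (ctype A \<sigma> - {#clen \<sigma> x#}))" if "i \<in> {1..<clen \<sigma> x}" for i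
  proof -
    let ?y = "?g i"
    let ?\<sigma> = "transpose x ?y \<circ> \<sigma>"
    have i: "0 < i" "i < clen \<sigma> x" using that by auto
    note cut = cut_lengths[OF A i]
    have y: "?y \<in> A"
      using A permutes_in_image[OF permutes_funpow[OF A(2)]] by simp
    have perm: "?\<sigma> permutes A" using permutes_transpose_comp[OF A(1,2)] A y by blast
    from ctype_join[OF A(1) perm A(3) y cut(3)] obtain K where
      K: "ctype A ?\<sigma> = add_mset (clen ?\<sigma> x) (add_mset (clen ?\<sigma> ?y) K)"
        "ctype A (transpose x ?y \<circ> ?\<sigma>) = add_mset (clen ?\<sigma> x + clen ?\<sigma> ?y) K" .
    from K(2) have "ctype A \<sigma> = add_mset (clen \<sigma> x) K"
      unfolding transpose_comp_twice cut(1,2) using i by simp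
    with K(1) show ?thesis by (simp add: cut(1,2))
  qed
  show ?thesis
    unfolding im[symmetric] by (subst sum.reindex[OF inj]) (auto intro!: sum.cong simp: ct)
qed

lemma ctype_join_eq:
  assumes A: "finite A" "\<sigma> permutes A" "x \<in> A" "y \<in> A" "y \<notin> orbit \<sigma> x"
  shows "ctype A (transpose x y \<circ> \<sigma>) =
      add_mset (clen \<sigma> x + clen \<sigma> y) (ctype A \<sigma> - {#clen \<sigma> x#} - {#clen \<sigma> y#})"
    "clen \<sigma> y \<in># ctype A \<sigma> - {#clen \<sigma> x#}"
  by (rule ctype_join[OF A]; simp)+

section \<open>Cycle types under bijections and disjoint unions\<close>

lemma orbit_map:
  assumes "bij_betw f A B" "finite A" "\<sigma> permutes A" "\<And>x. x \<in> A \<Longrightarrow> \<sigma>' (f x) = f (\<sigma> x)" "x \<in> A"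
  shows "orbit \<sigma>' (f x) = f ` orbit \<sigma> x"
  by (rule orbit_inverse[symmetric, OF self_in_orbit[OF assms(2,3)]])
     (use orbit_in_carrier[OF assms(2,3,5)] assms(4) in auto)

lemma clen_map:
  assumes "bij_betw f A B" "finite A" "\<sigma> permutes A" "\<And>x. x \<in> A \<Longrightarrow> \<sigma>' (f x) = f (\<sigma> x)" "x \<in> A"
  shows "clen \<sigma>' (f x) = clen \<sigma> x"
proof -
  have "inj_on f (orbit \<sigma> x)"
    by (rule inj_on_subset[of f A])
       (use assms(1) orbit_in_carrier[OF assms(2,3,5)] in \<open>auto simp: bij_betw_def\<close>)
  moreover have "orbit \<sigma>' (f x) = f ` orbit \<sigma> x"
    by (rule orbit_map) (use assms in auto)
  ultimately show ?thesis by (simp add: card_image)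
qed

lemma ctype_map:
  assumes "bij_betw f A B" "finite A" "\<sigma> permutes A" "\<And>x. x \<in> A \<Longrightarrow> \<sigma>' (f x) = f (\<sigma> x)"
  shows "ctype B \<sigma>' = ctype A \<sigma>"
proof -
  have "orbit \<sigma>' ` B = (`) f ` orbit \<sigma> ` A"
    using assms(1) orbit_map[OF assms] by (auto simp: bij_betw_def image_image)
  moreover have inj: "inj_on f A" using assms(1) by (simp add: bij_betw_def)
  moreover have "inj_on ((`) f) (orbit \<sigma> ` A)"
    using orbit_in_carrier[OF assms(2,3)] inj
    by (intro inj_on_subset[OF inj_on_image_Pow]) auto
  ultimately have "ctype B \<sigma>' = image_mset card (image_mset ((`) f) (mset_set (orbit \<sigma> ` A)))"
    by (simp add: ctype_def image_mset_mset_set)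
  also have "\<dots> = image_mset card (mset_set (orbit \<sigma> ` A))"
    unfolding image_mset.compositionality
    by (rule image_mset_cong)
       (use assms(2) orbit_in_carrier[OF assms(2,3)] inj in \<open>auto intro!: card_image intro: inj_on_subset\<close>)
  finally show ?thesis by (simp add: ctype_def)
qed

lemma orbit_agree:
  assumes "finite A" "\<sigma> permutes A" "\<And>x. x \<in> A \<Longrightarrow> \<sigma>' x = \<sigma> x" "x \<in> A"
  shows "orbit \<sigma>' x = orbit \<sigma> x"
  using orbit_map[of id A A \<sigma> \<sigma>' x] assms by simp

lemma ctype_Un:
  assumes "finite A" "finite B" "A \<inter> B = {}" "\<sigma> permutes A" "\<sigma>' permutes B"
    "\<And>x. x \<in> A \<Longrightarrow> \<rho> x = \<sigma> x" "\<And>x. x \<in> B \<Longrightarrow> \<rho> x = \<sigma>' x"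
  shows "ctype (A \<union> B) \<rho> = ctype A \<sigma> + ctype B \<sigma>'"
proof -
  have A: "orbit \<rho> x = orbit \<sigma> x" if "x \<in> A" for x by (rule orbit_agree) (use assms that in auto)
  have B: "orbit \<rho> x = orbit \<sigma>' x" if "x \<in> B" for x by (rule orbit_agree) (use assms that in auto)
  have "orbit \<sigma> ` A \<inter> orbit \<sigma>' ` B = {}"
    using orbit_in_carrier[OF assms(1,4)] orbit_in_carrier[OF assms(2,5)]
      self_in_orbit[OF assms(1,4)] assms(3) by fastforce
  moreover have "orbit \<rho> ` (A \<union> B) = orbit \<sigma> ` A \<union> orbit \<sigma>' ` B"
    using A B by (auto simp: image_Un)
  ultimately show ?thesis
    using assms by (simp add: ctype_def mset_set_Union)
qed

section \<open>Coefficients of the generating series\<close>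

text \<open>Transitivity phrased without a group: there is no proper nonempty invariant union of
  components. A letter merely intersects \<open>J\<close> with another family, so letters can be
  moved in and out of \<open>\<sigma>\<close> without any reference to generated subgroups.\<close>

definition connected_by :: "nat set \<Rightarrow> (nat \<Rightarrow> nat) \<Rightarrow> (nat \<Rightarrow> nat) \<Rightarrow> nat set set \<Rightarrow> bool" where
  "connected_by A \<sigma> \<rho> J \<longleftrightarrow>
    (\<forall>X\<in>J. X \<subseteq> A \<longrightarrow> \<sigma> ` X = X \<longrightarrow> \<rho> ` X = X \<longrightarrow> X = {} \<or> X = A)"

text \<open>Transitivity is left out, since moving the last letter into \<open>\<sigma>\<close> can
  disconnect the tuple.\<close>

definition factorizations ::
    "nat set \<Rightarrow> nat \<Rightarrow> ((nat \<Rightarrow> nat) \<times> (nat \<Rightarrow> nat) \<times> (nat \<times> nat) list) set" where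
  "factorizations A r = {(\<sigma>, \<rho>, \<tau>). \<sigma> permutes A \<and> \<rho> permutes A \<and> \<tau> \<in> words A r \<and>
     \<sigma> \<circ> \<rho> \<circ> apply_transps \<tau> = id}"

definition trans_fact ::
    "nat set \<Rightarrow> nat \<Rightarrow> ((nat \<Rightarrow> nat) \<times> (nat \<Rightarrow> nat) \<times> (nat \<times> nat) list) set" where
  "trans_fact A r = {(\<sigma>, \<rho>, \<tau>) \<in> factorizations A r. connected_by A \<sigma> \<rho> (unsep \<tau>)}"

lemma finite_factorizations [simp]:
  assumes "finite A"
  shows "finite (factorizations A r)"
  by (rule finite_subset[of _ "{p. p permutes A} \<times> {p. p permutes A} \<times> words A r"])
     (auto simp: factorizations_def finite_permutations finite_words assms)

lemma finite_trans_fact [simp]: "finite A \<Longrightarrow> finite (trans_fact A r)"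
  by (rule finite_subset[OF _ finite_factorizations]) (auto simp: trans_fact_def)

section \<open>Transitivity through invariant sets\<close>

lemma transpose_image_eq_iff: "transpose a b ` X = X \<longleftrightarrow> (a \<in> X \<longleftrightarrow> b \<in> X)"
proof
  assume "transpose a b ` X = X"
  thus "a \<in> X \<longleftrightarrow> b \<in> X" by (metis image_eqI transpose_apply_first transpose_apply_second)
next
  assume *: "a \<in> X \<longleftrightarrow> b \<in> X"
  hence "transpose a b ` X \<subseteq> X" by (auto simp: transpose_def)
  moreover from this have "transpose a b ` transpose a b ` X \<subseteq> transpose a b ` X" by (rule image_mono)
  ultimately show "transpose a b ` X = X" by (auto simp: image_image)
qed

lemma unsep_iff_image: "X \<in> unsep \<tau> \<longleftrightarrow> (\<forall>g\<in>transp ` set \<tau>. g ` X = X)"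
proof -
  have "X \<in> (case p of (a, b) \<Rightarrow> together a b) \<longleftrightarrow> transp p ` X = X" for p
    by (cases p) (simp add: together_def transp_def transpose_image_eq_iff)
  thus ?thesis by (simp add: unsep_def)
qed

lemma generate_image_eq:
  assumes "g \<in> generate (sym_group d) G" "G \<subseteq> carrier (sym_group d)" "\<And>h. h \<in> G \<Longrightarrow> h ` X = X"
  shows "g ` X = X"
  using assms(1)
proof induction
  case one
  show ?case by (simp add: sym_group_one)
next
  case (inv h)
  hence "inv' h ` X = X"
    using assms(2,3) by (metis bij_is_inj image_inv_f_f permutes_bij subsetD sym_group_carrier)
  moreover have "inv\<^bsub>sym_group d\<^esub> h = inv' h"
    using assms(2) inv by (intro sym_group_inv_equality) auto
  ultimately show ?case by simp
next
  case (eng g h)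
  thus ?case by (metis image_comp sym_group_mult)
qed (use assms in auto)

text \<open>An orbit of the group is invariant under the generators; conversely, a set invariant
  under the generators is invariant under the whole group and so is a union of orbits.\<close>

lemma transitive_on_generate_iff:
  assumes G: "G \<subseteq> carrier (sym_group d)"
  shows "transitive_on d (generate (sym_group d) G) \<longleftrightarrow>
    (\<forall>X\<subseteq>{1..d}. (\<forall>g\<in>G. g ` X = X) \<longrightarrow> X = {} \<or> X = {1..d})"
proof (intro iffI allI impI)
  fix X assume tr: "transitive_on d (generate (sym_group d) G)" and X: "X \<subseteq> {1..d}" "\<forall>g\<in>G. g ` X = X"
  have "y \<in> X" if "x \<in> X" "y \<in> {1..d}" for x y
  proof -
    from X(1) that(1) have x: "x \<in> {1..d}" by (rule subsetD)
    obtain g where g: "g \<in> generate (sym_group d) G" and "g x = y"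
      using bspec[OF bspec[OF tr[unfolded transitive_on_def] x] \<open>y \<in> {1..d}\<close>] by blast
    have "g ` X = X" by (rule generate_image_eq[OF g G]) (use X(2) in simp)
    thus ?thesis using \<open>g x = y\<close> \<open>x \<in> X\<close> by blast
  qed
  thus "X = {} \<or> X = {1..d}" using X(1) by blast
next
  assume *: "\<forall>X\<subseteq>{1..d}. (\<forall>g\<in>G. g ` X = X) \<longrightarrow> X = {} \<or> X = {1..d}"
  interpret group "sym_group d" by (rule sym_group_is_group)
  show "transitive_on d (generate (sym_group d) G)"
    unfolding transitive_on_def
  proof (intro ballI)
    fix x y assume xy: "x \<in> {1..d}" "y \<in> {1..d}"
    let ?X = "(\<lambda>g. g x) ` generate (sym_group d) G"
    have perm: "g permutes {1..d}" if "g \<in> generate (sym_group d) G" for g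
      using generate_in_carrier[OF G that] by (simp add: sym_group_carrier)
    have sub: "?X \<subseteq> {1..d}" using xy perm permutes_in_image by fastforce
    have inv: "h ` ?X = ?X" if h: "h \<in> G" for h
    proof (rule endo_inj_surj)
      show "finite ?X" by (rule finite_subset[OF sub]) simp
      show "inj_on h ?X"
        using G h sym_group_carrier permutes_inj by (metis inj_on_subset subsetD top_greatest)
      show "h ` ?X \<subseteq> ?X"
      proof
        fix z assume "z \<in> h ` ?X"
        then obtain g where g: "g \<in> generate (sym_group d) G" "z = h (g x)" by auto
        have "h \<circ> g \<in> generate (sym_group d) G"
          using generate.eng[OF generate.incl[OF h] g(1)] by (simp add: sym_group_mult)
        thus "z \<in> ?X" by (rule image_eqI[rotated]) (simp add: g(2))
      qed
    qed
    have xX: "x \<in> ?X"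
    proof (rule image_eqI)
      show "id \<in> generate (sym_group d) G"
        using generate.one[of "sym_group d" G] by (simp only: sym_group_one)
    qed (simp only: id_apply)
    have "?X = {} \<or> ?X = {1..d}" by (rule *[rule_format, OF sub]) (rule inv)
    hence "?X = {1..d}" using xX by (metis empty_iff)
    hence "y \<in> ?X" using xy(2) by (simp only:)
    thus "\<exists>g\<in>generate (sym_group d) G. g x = y" by (elim imageE) (rule bexI, erule sym)
  qed
qed

lemma monotone_solutions_eq: "monotone_solutions d r = trans_fact {1..d} r"
proof -
  have "transitive_on d (generate (sym_group d) ({\<sigma>, \<rho>} \<union> transp ` set \<tau>)) \<longleftrightarrow>
      connected_by {1..d} \<sigma> \<rho> (unsep \<tau>)"
    if "\<sigma> permutes {1..d}" "\<rho> permutes {1..d}" "\<forall>(a, b)\<in>set \<tau>. 1 \<le> a \<and> a < b \<and> b \<le> d" for \<sigma> \<rho> \<tau>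
  proof -
    have "transp p permutes {1..d}" if "p \<in> set \<tau>" for p
      using that \<open>\<forall>(a, b)\<in>set \<tau>. _ a b\<close> by (auto simp: transp_def intro!: permutes_swap_id)
    hence "{\<sigma>, \<rho>} \<union> transp ` set \<tau> \<subseteq> carrier (sym_group d)"
      using that by (auto simp: sym_group_carrier)
    hence "transitive_on d (generate (sym_group d) ({\<sigma>, \<rho>} \<union> transp ` set \<tau>)) \<longleftrightarrow>
        (\<forall>X\<subseteq>{1..d}. (\<forall>g\<in>{\<sigma>, \<rho>} \<union> transp ` set \<tau>. g ` X = X) \<longrightarrow> X = {} \<or> X = {1..d})"
      by (rule transitive_on_generate_iff)
    also have "\<dots> \<longleftrightarrow> connected_by {1..d} \<sigma> \<rho> (unsep \<tau>)"
    proof -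
      have "(\<forall>g\<in>{\<sigma>, \<rho>} \<union> transp ` set \<tau>. g ` X = X) \<longleftrightarrow> X \<in> unsep \<tau> \<and> \<sigma> ` X = X \<and> \<rho> ` X = X" for X
        by (auto simp: unsep_iff_image)
      thus ?thesis unfolding connected_by_def by meson
    qed
    finally show ?thesis .
  qed
  note tr = this
  have prod_eq: "foldr (\<circ>) (map transp \<tau>) id = apply_transps \<tau>" for \<tau>
    by (simp add: apply_transps_def transp_def)
  have words: "\<tau> \<in> words {1..d} r \<longleftrightarrow>
      length \<tau> = r \<and> (\<forall>(a, b)\<in>set \<tau>. 1 \<le> a \<and> a < b \<and> b \<le> d) \<and> sorted (map snd \<tau>)" for \<tau>
  proof -
    have "(\<lambda>(a, b). a \<in> {1..d} \<and> b \<in> {1..d} \<and> a < b) = (\<lambda>(a, b). 1 \<le> a \<and> a < b \<and> b \<le> d)"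
      by (auto simp: fun_eq_iff)
    thus ?thesis by (simp only: words_def mem_Collect_eq)
  qed
  show ?thesis
    unfolding monotone_solutions_def trans_fact_def factorizations_def prod_eq
  proof (rule Set.set_eqI)
    fix s :: "(nat \<Rightarrow> nat) \<times> (nat \<Rightarrow> nat) \<times> (nat \<times> nat) list"
    obtain \<sigma> \<rho> \<tau> where s: "s = (\<sigma>, \<rho>, \<tau>)" by (cases s)
    show "s \<in> {(\<sigma>, \<rho>, \<tau>). \<sigma> permutes {1..d} \<and> \<rho> permutes {1..d} \<and> length \<tau> = r \<and>
          (\<forall>(a, b)\<in>set \<tau>. 1 \<le> a \<and> a < b \<and> b \<le> d) \<and> sorted (map snd \<tau>) \<and>
          \<sigma> \<circ> \<rho> \<circ> apply_transps \<tau> = id \<and>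
          transitive_on d (generate (sym_group d) ({\<sigma>, \<rho>} \<union> transp ` set \<tau>))} \<longleftrightarrow>
        s \<in> {(\<sigma>, \<rho>, \<tau>) \<in> {(\<sigma>, \<rho>, \<tau>). \<sigma> permutes {1..d} \<and> \<rho> permutes {1..d} \<and>
          \<tau> \<in> words {1..d} r \<and> \<sigma> \<circ> \<rho> \<circ> apply_transps \<tau> = id}. connected_by {1..d} \<sigma> \<rho> (unsep \<tau>)}"
      unfolding s mem_Collect_eq prod.case words using tr[of \<sigma> \<rho> \<tau>] by argo
  qed
qed

lemma cycle_type_eq: "cycle_type d \<sigma> = ctype {1..d} \<sigma>"
  by (simp add: cycle_type_def ctype_def)

section \<open>Monomial weights and homogeneous parts of series\<close>

abbreviation mon :: "indet multiset \<Rightarrow> series" where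
  "mon m \<equiv> mps_monom 1 m"

text \<open>The exponents of the monomial that a single tuple contributes. Keeping them as a
  multiset turns the merging of two tuples into an addition.\<close>

definition wt :: "nat set \<Rightarrow> nat \<Rightarrow> (nat \<Rightarrow> nat) \<Rightarrow> (nat \<Rightarrow> nat) \<Rightarrow> indet multiset" where
  "wt A r \<sigma> \<rho> = replicate_mset (card A) ZVar + replicate_mset r TVar +
     image_mset PVar (ctype A \<sigma>) + image_mset QVar (ctype A \<rho>)"

text \<open>The homogeneous component of degree d in z and r in t. In a fixed bidegree the two
  generating series are finite sums, so the whole equation reduces to finite identities.\<close>

definition part :: "nat \<Rightarrow> nat \<Rightarrow> series \<Rightarrow> series" where
  "part d r f = Mps (\<lambda>m. if count m ZVar = d \<and> count m TVar = r then mps_coeff f m else 0)"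

lemma coeff_part:
  "mps_coeff (part d r f) m = (if count m ZVar = d \<and> count m TVar = r then mps_coeff f m else 0)"
  by (simp add: part_def)

lemma series_eq_parts: "(\<And>d r. part d r f = part d r g) \<Longrightarrow> f = g"
  by (rule mps_eqI) (metis coeff_part)

lemma part_linear:
  "part d r 0 = 0"
  "part d r (f + g) = part d r f + part d r g"
  "part d r (f - g) = part d r f - part d r g"
  "part d r (sum F I) = (\<Sum>i\<in>I. part d r (F i))"
proof -
  show 0: "part d r 0 = 0" by (rule mps_eqI) (simp add: coeff_part)
  show add: "part d r (f + g) = part d r f + part d r g" for f g
    by (rule mps_eqI) (simp add: coeff_part)
  show "part d r (f - g) = part d r f - part d r g" by (rule mps_eqI) (simp add: coeff_part)
  show "part d r (sum F I) = (\<Sum>i\<in>I. part d r (F i))"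
    by (induction I rule: infinite_finite_induct) (simp_all add: 0 add)
qed

lemma sum_if_const: "(\<Sum>i\<in>I. if P then f i else 0) = (if P then sum f I else 0)"
  by (cases P) simp_all

lemma coeff_sum: "mps_coeff (sum F I) m = (\<Sum>i\<in>I. mps_coeff (F i) m)"
  by (induction I rule: infinite_finite_induct) simp_all

lemma coeff_monom_mult:
  fixes f :: "('v, 'a :: comm_ring_1) mps"
  shows "mps_coeff (mps_monom c a * f) m = (if a \<subseteq># m then c * mps_coeff f (m - a) else 0)"
proof -
  have "mps_coeff (mps_monom c a * f) m = (\<Sum>p\<in>splits m. if p = (a, m - a) then c * mps_coeff f (m - a) else 0)"
    unfolding mps_coeff_mult
    by (rule sum.cong) (auto simp: mps_coeff_monom split: if_splits)
  moreover have "a + (m - a) = m \<longleftrightarrow> a \<subseteq># m"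
    by (metis mset_subset_eq_add_left subset_mset.add_diff_inverse)
  ultimately show ?thesis by simp
qed

lemma coeff_const_mult:
  fixes f :: "('v, 'a :: comm_ring_1) mps"
  shows "mps_coeff (mps_const c * f) m = c * mps_coeff f m"
  by (simp add: mps_const_monom coeff_monom_mult)

lemma part_monom_mult:
  assumes "count a ZVar = i" "count a TVar = j"
  shows "part d r (mps_monom c a * f) =
    (if i \<le> d \<and> j \<le> r then mps_monom c a * part (d - i) (r - j) f else 0)"
proof (rule mps_eqI)
  fix m
  have "count a ZVar \<le> count m ZVar" "count a TVar \<le> count m TVar" if "a \<subseteq># m"
    using that by (auto simp: mset_subset_eq_count)
  thus "mps_coeff (part d r (mps_monom c a * f)) m =
      mps_coeff (if i \<le> d \<and> j \<le> r then mps_monom c a * part (d - i) (r - j) f else 0) m"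
    using assms by (auto simp: coeff_part coeff_monom_mult)
qed

lemma part_monom:
  "part d r (mps_monom c a) = (if count a ZVar = d \<and> count a TVar = r then mps_monom c a else 0)"
  by (rule mps_eqI) (auto simp: coeff_part mps_coeff_monom)

text \<open>Bidegrees add, so a pair of monomials of total bidegree (d, r) is seen by exactly one
  choice of \<open>d1\<close> and \<open>r1\<close>.\<close>

lemma part_mult:
  "part d r (f * g) = (\<Sum>d1\<le>d. \<Sum>r1\<le>r. part d1 r1 f * part (d - d1) (r - r1) g)"
proof (rule mps_eqI)
  fix m
  let ?c = "mps_coeff"
  let ?t = "\<lambda>a b d1 r1. ?c (part d1 r1 f) a * ?c (part (d - d1) (r - r1) g) b"
  have "(\<Sum>(d1, r1)\<in>{..d} \<times> {..r}. ?t a b d1 r1) =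
      (if count m ZVar = d \<and> count m TVar = r then ?c f a * ?c g b else 0)"
    if "a + b = m" for a b
  proof -
    have m: "count m ZVar = count a ZVar + count b ZVar" "count m TVar = count a TVar + count b TVar"
      using that by auto
    have "(\<Sum>(d1, r1)\<in>{..d} \<times> {..r}. ?t a b d1 r1) =
        (\<Sum>p\<in>{..d} \<times> {..r}. if p = (count a ZVar, count a TVar) then
          (if count m ZVar = d \<and> count m TVar = r then ?c f a * ?c g b else 0) else 0)"
      by (rule sum.cong) (auto simp: coeff_part m split: if_splits)
    also have "\<dots> = (if count m ZVar = d \<and> count m TVar = r then ?c f a * ?c g b else 0)"
      by (auto simp: m)
    finally show ?thesis .
  qed
  note t = this
  have "?c (\<Sum>d1\<le>d. \<Sum>r1\<le>r. part d1 r1 f * part (d - d1) (r - r1) g) m =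
      (\<Sum>(d1, r1)\<in>{..d} \<times> {..r}. \<Sum>(a, b)\<in>splits m. ?t a b d1 r1)"
    by (simp add: sum.cartesian_product coeff_sum mps_coeff_mult case_prod_beta)
  also have "\<dots> = (\<Sum>(a, b)\<in>splits m. \<Sum>(d1, r1)\<in>{..d} \<times> {..r}. ?t a b d1 r1)"
    unfolding case_prod_beta by (rule sum.swap)
  also have "\<dots> = (\<Sum>(a, b)\<in>splits m. if count m ZVar = d \<and> count m TVar = r then ?c f a * ?c g b else 0)"
    by (rule sum.cong) (auto simp: t)
  also have "\<dots> = ?c (part d r (f * g)) m"
    by (simp only: coeff_part mps_coeff_mult split_def sum_if_const)
  finally show "?c (part d r (f * g)) m = ?c (\<Sum>d1\<le>d. \<Sum>r1\<le>r. part d1 r1 f * part (d - d1) (r - r1) g) m" ..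
qed

lemma coeff_deriv: "mps_coeff (mps_deriv x f) m = of_nat (count m x + 1) * mps_coeff f (add_mset x m)"
  by (simp add: mps_deriv_def)

lemma part_d_p: "part d r (d_p i f) = d_p i (part d r f)"
  by (rule mps_eqI) (simp add: coeff_part coeff_deriv)

lemma deriv_linear:
  fixes f g :: "('v, 'a :: comm_ring_1) mps"
  shows "mps_deriv x 0 = (0 :: ('v, 'a) mps)"
  "mps_deriv x (f + g) = mps_deriv x f + mps_deriv x g"
  "mps_deriv x (sum F I) = (\<Sum>i\<in>I. mps_deriv x (F i :: ('v, 'a) mps))"
  "mps_deriv x (mps_const c * f) = mps_const c * mps_deriv x f"
proof -
  show 0: "mps_deriv x 0 = (0 :: ('v, 'a) mps)" by (rule mps_eqI) (simp add: coeff_deriv)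
  show add: "mps_deriv x (f + g) = mps_deriv x f + mps_deriv x g" for f g :: "('v, 'a) mps"
    by (rule mps_eqI) (simp add: coeff_deriv algebra_simps)
  show "mps_deriv x (sum F I) = (\<Sum>i\<in>I. mps_deriv x (F i))"
    by (induction I rule: infinite_finite_induct) (simp_all add: 0 add)
  show "mps_deriv x (mps_const c * f) = mps_const c * mps_deriv x f"
    by (rule mps_eqI) (simp add: coeff_deriv coeff_const_mult mult.left_commute)
qed

lemma deriv_monom:
  "mps_deriv x (mps_monom c m) = (mps_monom (of_nat (count m x) * c) (m - {#x#}) :: ('v, 'a :: comm_ring_1) mps)"
proof (rule mps_eqI)
  fix n
  have "add_mset x n = m \<longleftrightarrow> x \<in># m \<and> n = m - {#x#}" by auto
  thus "mps_coeff (mps_deriv x (mps_monom c m)) n = mps_coeff (mps_monom (of_nat (count m x) * c) (m - {#x#})) n"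
    by (auto simp: coeff_deriv mps_coeff_monom not_in_iff)
qed

lemma part_z_dz: "part d r (zz * d_z f) = of_nat d * part d r f"
proof (rule mps_eqI)
  fix m
  have "mps_coeff (zz * d_z f) m = of_nat (count m ZVar) * mps_coeff f m"
  proof (cases "ZVar \<in># m")
    case True
    then obtain n where "m = add_mset ZVar n" by (metis multi_member_split)
    thus ?thesis by (simp add: mps_var_monom coeff_monom_mult coeff_deriv)
  next
    case False
    hence "count m ZVar = 0" by (simp add: count_eq_zero_iff)
    thus ?thesis using False by (simp add: mps_coeff_var_mult_eq_0)
  qed
  moreover have "mps_coeff (of_nat d * part d r f) m = of_nat d * mps_coeff (part d r f) m"
    unfolding mps_of_nat_monom mps_const_monom[symmetric] by (rule coeff_const_mult)
  ultimately show "mps_coeff (part d r (zz * d_z f)) m = mps_coeff (of_nat d * part d r f) m"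
    by (simp add: coeff_part)
qed

lemma part_mps_sum:
  assumes "finite J" "J \<subseteq> I" "\<And>i. i \<in> I - J \<Longrightarrow> part d r (F i) = 0"
  shows "part d r (mps_sum F I) = (\<Sum>i\<in>J. part d r (F i))"
proof (rule mps_eqI)
  fix m
  show "mps_coeff (part d r (mps_sum F I)) m = mps_coeff (\<Sum>i\<in>J. part d r (F i)) m"
  proof (cases "count m ZVar = d \<and> count m TVar = r")
    case True
    have "mps_coeff (F i) m = 0" if "i \<in> I - J" for i
      using assms(3)[OF that] True coeff_part[of d r "F i" m] by simp
    hence "(\<Sum>i\<in>{i \<in> I. mps_coeff (F i) m \<noteq> 0}. mps_coeff (F i) m) = (\<Sum>i\<in>J. mps_coeff (F i) m)"
      using assms(1,2) by (intro sum.mono_neutral_left) auto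
    thus ?thesis using True by (simp add: coeff_sum coeff_part mps_sum_def)
  next
    case False
    thus ?thesis by (simp only: coeff_sum coeff_part sum_if_const if_False sum.neutral_const)
  qed
qed

section \<open>The coefficients as sums over solutions\<close>

lemma fact_cancel: "of_nat (fact d) * (mps_const (1 / fact d) * f) = (f :: series)"
proof -
  have "of_nat (fact d) * mps_const (1 / fact d) = (1 :: series)"
    by (simp add: mps_const_monom mps_of_nat_monom mps_monom_mult mps_one_monom)
  thus ?thesis by (simp add: mult.assoc[symmetric])
qed

text \<open>For the labels 1 to d with d positive this is d! times the component of bidegree (d, r)
  of the Hurwitz series. Summing over solutions instead of counting them by cycle type lets later
  bijections act on single tuples.\<close>

definition hsum :: "nat set \<Rightarrow> nat \<Rightarrow> series" where
  "hsum A r = (\<Sum>(\<sigma>, \<rho>, \<tau>)\<in>trans_fact A r. mon (wt A r \<sigma> \<rho>))"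

lemma trans_factD:
  assumes "(\<sigma>, \<rho>, \<tau>) \<in> trans_fact A r"
  shows "\<sigma> permutes A" "\<rho> permutes A"
  using assms by (auto simp: trans_fact_def factorizations_def)

lemma count_image_indet [simp]:
  "count (image_mset PVar \<alpha>) ZVar = 0" "count (image_mset PVar \<alpha>) TVar = 0"
  "count (image_mset QVar \<beta>) ZVar = 0" "count (image_mset QVar \<beta>) TVar = 0"
  by (auto simp: count_eq_zero_iff)

text \<open>\<open>g\<close> sends a solution to the index of its term, so its fibres regroup the
  counting numbers into one sum over solutions.\<close>

lemma part_mps_sum_image:
  assumes "finite S" "g ` S \<subseteq> I"
    and "\<And>i. i \<in> I \<Longrightarrow> part d r (F i) = mps_const c * (\<Sum>s\<in>{s \<in> S. g s = i}. w s)"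
  shows "part d r (mps_sum F I) = mps_const c * (\<Sum>s\<in>S. w s)"
proof -
  have "part d r (F i) = 0" if "i \<in> I - g ` S" for i
  proof -
    have e: "{s \<in> S. g s = i} = {}" using that by auto
    show ?thesis using assms(3)[of i] that unfolding e by simp
  qed
  hence "part d r (mps_sum F I) = (\<Sum>i\<in>g ` S. part d r (F i))"
    by (intro part_mps_sum) (use assms in auto)
  also have "\<dots> = (\<Sum>i\<in>g ` S. \<Sum>s\<in>{s \<in> S. g s = i}. mps_const c * w s)"
    by (rule sum.cong) (use assms in \<open>auto simp: sum_distrib_left\<close>)
  also have "\<dots> = (\<Sum>s\<in>S. mps_const c * w s)"
    by (rule sum.image_gen[symmetric, OF assms(1)])
  finally show ?thesis by (simp add: sum_distrib_left)
qed

lemma mps_monom_card_fiber: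
  assumes "\<And>s. s \<in> S \<Longrightarrow> w s = mon m"
  shows "mps_monom (of_nat (card S) / fact d) m = mps_const (1 / fact d) * (\<Sum>s\<in>S. w s)"
proof -
  have "(\<Sum>s\<in>S. w s) = of_nat (card S) * mon m" using assms by simp
  thus ?thesis by (simp add: mps_const_monom mps_of_nat_monom mps_monom_mult)
qed

lemma part_H:
  assumes "d \<ge> 1"
  shows "part d r H_series = mps_const (1 / fact d) * hsum {1..d} r"
proof -
  let ?S = "trans_fact {1..d} r"
  define g where "g = (\<lambda>(\<sigma>, \<rho>, \<tau> :: (nat \<times> nat) list). (d, r, ctype {1..d} \<sigma>, ctype {1..d} \<rho>))"
  have cnt: "mono_hurwitz d r \<alpha> \<beta> = card {s \<in> ?S. g s = (d, r, \<alpha>, \<beta>)}" for \<alpha> \<beta>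
    unfolding mono_hurwitz_def monotone_solutions_eq
    by (rule arg_cong[where f = card])
       (auto simp: g_def conj_class_def cycle_type_eq dest: trans_factD)
  have sub: "g ` ?S \<subseteq> H_index"
  proof
    fix i assume "i \<in> g ` ?S"
    then obtain \<sigma> \<rho> \<tau> where s: "(\<sigma>, \<rho>, \<tau>) \<in> ?S" "i = g (\<sigma>, \<rho>, \<tau>)" by auto
    note c = ctype_partition[OF finite_atLeastAtMost trans_factD(1)[OF s(1)]]
      ctype_partition[OF finite_atLeastAtMost trans_factD(2)[OF s(1)]]
    show "i \<in> H_index" using c assms by (simp add: s(2) g_def H_index_def partitions_def)
  qed
  have "part d r (H_term i) = mps_const (1 / fact d) *
      (\<Sum>s\<in>{s \<in> ?S. g s = i}. case s of (\<sigma>, \<rho>, \<tau>) \<Rightarrow> mon (wt {1..d} r \<sigma> \<rho>))" if "i \<in> H_index" for i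
  proof -
    obtain d' r' \<alpha> \<beta> where i: "i = (d', r', \<alpha>, \<beta>)" by (cases i)
    show ?thesis
    proof (cases "d' = d \<and> r' = r")
      case True
      hence "part d r (H_term i) = mps_monom (of_nat (card {s \<in> ?S. g s = i}) / fact d)
          (replicate_mset d ZVar + replicate_mset r TVar + image_mset PVar \<alpha> + image_mset QVar \<beta>)"
        by (simp add: i H_term_monom part_monom cnt)
      also have "\<dots> = mps_const (1 / fact d) *
          (\<Sum>s\<in>{s \<in> ?S. g s = i}. case s of (\<sigma>, \<rho>, \<tau>) \<Rightarrow> mon (wt {1..d} r \<sigma> \<rho>))"
        by (rule mps_monom_card_fiber) (use True in \<open>auto simp: g_def i wt_def\<close>)
      finally show ?thesis .
    next
      case False
      hence e: "{s \<in> ?S. g s = i} = {}" by (auto simp: g_def i)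
      show ?thesis unfolding e using False by (auto simp: i H_term_monom part_monom)
    qed
  qed
  thus ?thesis
    unfolding H_series_def hsum_def by (intro part_mps_sum_image[OF _ sub]) auto
qed

lemma part_H_0: "part 0 r H_series = 0"
proof -
  have "part 0 r (H_term i) = 0" if "i \<in> H_index" for i
    using that by (auto simp: H_index_def H_term_monom part_monom)
  thus ?thesis unfolding H_series_def by (subst part_mps_sum[of "{}"]) auto
qed

text \<open>Trades p_i q_j for p_{i+1} q_{j+1}: the effect on cycle types of inserting a new label
  into one cycle of each permutation.\<close>

definition insert_wt :: "nat \<Rightarrow> nat \<Rightarrow> indet multiset \<Rightarrow> indet multiset" where
  "insert_wt i j m = m - {#PVar i#} - {#QVar j#} + {#PVar (i + 1), QVar (j + 1)#}"

text \<open>The numbers N mark the largest label only; \<open>x\<close> is free here so that the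
  mark can be moved.\<close>

definition nsum :: "nat set \<Rightarrow> nat \<Rightarrow> nat \<Rightarrow> series" where
  "nsum A r x = (\<Sum>(\<sigma>, \<rho>, \<tau>)\<in>trans_fact A r. mon (insert_wt (clen \<sigma> x) (clen \<rho> x) (wt A r \<sigma> \<rho>)))"

lemma part_N:
  assumes "d \<ge> 1"
  shows "part d r N_series = mps_const (1 / fact d) * nsum {1..d} r d"
proof -
  let ?S = "trans_fact {1..d} r"
  let ?w = "\<lambda>s. case s of (\<sigma>, \<rho>, \<tau>) \<Rightarrow> mon (insert_wt (clen \<sigma> d) (clen \<rho> d) (wt {1..d} r \<sigma> \<rho>))"
  define g where "g = (\<lambda>(\<sigma>, \<rho>, \<tau> :: (nat \<times> nat) list).
    (clen \<sigma> d, clen \<rho> d, d, r, ctype {1..d} \<sigma> - {#clen \<sigma> d#}, ctype {1..d} \<rho> - {#clen \<rho> d#}))"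
  have fin: "finite {1..d}" by simp
  have d: "d \<in> {1..d}" using assms by simp
  have mem: "ctype {1..d} \<sigma> = add_mset (clen \<sigma> d) (ctype {1..d} \<sigma> - {#clen \<sigma> d#})"
    if "\<sigma> permutes {1..d}" for \<sigma>
    using clen_in_ctype[OF fin that d] by simp
  have part': "ctype {1..d} \<sigma> - {#clen \<sigma> d#} \<in> partitions (d - clen \<sigma> d)" "1 \<le> clen \<sigma> d" "clen \<sigma> d \<le> d"
    if p: "\<sigma> permutes {1..d}" for \<sigma>
  proof -
    have s: "sum_mset (ctype {1..d} \<sigma>) = d" using ctype_partition[OF fin p] by simp
    have "sum_mset (add_mset (clen \<sigma> d) (ctype {1..d} \<sigma> - {#clen \<sigma> d#})) = d"
      using s mem[OF p] by simp
    hence *: "clen \<sigma> d + sum_mset (ctype {1..d} \<sigma> - {#clen \<sigma> d#}) = d" by simp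
    have "0 \<notin># ctype {1..d} \<sigma> - {#clen \<sigma> d#}"
      using ctype_partition(1)[OF fin p] by (meson in_diffD)
    thus "ctype {1..d} \<sigma> - {#clen \<sigma> d#} \<in> partitions (d - clen \<sigma> d)" "clen \<sigma> d \<le> d"
      using * by (auto simp: partitions_def)
    show "1 \<le> clen \<sigma> d" using clen_pos[OF fin p, of d] by simp
  qed
  have cnt: "mono_N d r \<alpha> i \<beta> j = card {s \<in> ?S. g s = (i, j, d, r, \<alpha>, \<beta>)}" for \<alpha> \<beta> i j
    unfolding mono_N_def monotone_solutions_eq
  proof (rule arg_cong[where f = card], rule Collect_cong)
    fix s :: "(nat \<Rightarrow> nat) \<times> (nat \<Rightarrow> nat) \<times> (nat \<times> nat) list"
    obtain \<sigma> \<rho> \<tau> where s: "s = (\<sigma>, \<rho>, \<tau>)" by (cases s)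
    have "ctype {1..d} \<sigma> = add_mset i \<alpha> \<and> clen \<sigma> d = i \<longleftrightarrow>
        clen \<sigma> d = i \<and> ctype {1..d} \<sigma> - {#clen \<sigma> d#} = \<alpha>" if "\<sigma> permutes {1..d}" for \<sigma> i \<alpha>
      using mem[OF that] by (metis add_mset_remove_trivial)
    thus "(case s of (\<sigma>, \<rho>, \<tau>) \<Rightarrow> (\<sigma>, \<rho>, \<tau>) \<in> ?S \<and> \<sigma> \<in> conj_class d (add_mset i \<alpha>) \<and>
        \<rho> \<in> conj_class d (add_mset j \<beta>) \<and> clen \<sigma> d = i \<and> clen \<rho> d = j) \<longleftrightarrow> s \<in> ?S \<and> g s = (i, j, d, r, \<alpha>, \<beta>)"
      unfolding s g_def conj_class_def cycle_type_eq using trans_factD[of \<sigma> \<rho> \<tau> "{1..d}" r]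
      by (simp only: prod.case mem_Collect_eq prod.inject) blast
  qed
  have sub: "g ` ?S \<subseteq> N_index"
  proof
    fix i assume "i \<in> g ` ?S"
    then obtain \<sigma> \<rho> \<tau> where s: "(\<sigma>, \<rho>, \<tau>) \<in> ?S" "i = g (\<sigma>, \<rho>, \<tau>)" by auto
    note c = part'[OF trans_factD(1)[OF s(1)]] part'[OF trans_factD(2)[OF s(1)]]
    show "i \<in> N_index" using c by (simp add: s(2) g_def N_index_def)
  qed
  have "part d r (N_term x) = mps_const (1 / fact d) * (\<Sum>s\<in>{s \<in> ?S. g s = x}. ?w s)" if "x \<in> N_index" for x
  proof -
    obtain i j d' r' \<alpha> \<beta> where x: "x = (i, j, d', r', \<alpha>, \<beta>)" by (metis prod_cases6)
    show ?thesis
    proof (cases "d' = d \<and> r' = r")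
      case True
      hence x: "x = (i, j, d, r, \<alpha>, \<beta>)" by (simp add: x)
      let ?m = "replicate_mset d ZVar + replicate_mset r TVar + image_mset PVar (add_mset (i + 1) \<alpha>) + image_mset QVar (add_mset (j + 1) \<beta>)"
      have "?w s = mon ?m" if "s \<in> {s \<in> ?S. g s = x}" for s
      proof -
        obtain \<sigma> \<rho> \<tau> where s: "s = (\<sigma>, \<rho>, \<tau>)" by (cases s)
        have "ctype {1..d} \<sigma> = add_mset i \<alpha>" "ctype {1..d} \<rho> = add_mset j \<beta>" "clen \<sigma> d = i" "clen \<rho> d = j"
          using that mem[of \<sigma>] mem[of \<rho>] trans_factD[of \<sigma> \<rho> \<tau> "{1..d}" r] by (auto simp: s g_def x)
        thus ?thesis by (simp add: s insert_wt_def wt_def ac_simps)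
      qed
      note w = this
      have "part d r (N_term x) = mps_monom (of_nat (card {s \<in> ?S. g s = x}) / fact d) ?m"
        by (simp add: x N_term_monom part_monom cnt)
      also have "\<dots> = mps_const (1 / fact d) * (\<Sum>s\<in>{s \<in> ?S. g s = x}. ?w s)"
        by (rule mps_monom_card_fiber) (rule w)
      finally show ?thesis .
    next
      case False
      hence e: "{s \<in> ?S. g s = x} = {}" by (auto simp: g_def x)
      show ?thesis unfolding e using False by (auto simp: x N_term_monom part_monom)
    qed
  qed
  thus ?thesis
    unfolding N_series_def nsum_def by (intro part_mps_sum_image[OF _ sub]) auto
qed

section \<open>Removal of the largest label\<close>

lemma sum_factorizations:
  assumes "finite A"
  shows "(\<Sum>(\<sigma>, \<rho>, \<tau>)\<in>factorizations A r. f \<sigma> \<rho> \<tau>) =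
    (\<Sum>\<sigma>\<in>{p. p permutes A}. \<Sum>\<rho>\<in>{p. p permutes A}. \<Sum>\<tau>\<in>words A r.
      if \<sigma> \<circ> \<rho> \<circ> apply_transps \<tau> = id then f \<sigma> \<rho> \<tau> else (0 :: 'v :: comm_monoid_add))"
proof -
  let ?P = "{p. p permutes A}" and ?W = "words A r"
  note fin = finite_permutations[OF assms] finite_words[OF assms, of r]
  have "(\<Sum>(\<sigma>, \<rho>, \<tau>)\<in>factorizations A r. f \<sigma> \<rho> \<tau>) =
      (\<Sum>s\<in>{s \<in> ?P \<times> ?P \<times> ?W. case s of (\<sigma>, \<rho>, \<tau>) \<Rightarrow> \<sigma> \<circ> \<rho> \<circ> apply_transps \<tau> = id}. case s of (\<sigma>, \<rho>, \<tau>) \<Rightarrow> f \<sigma> \<rho> \<tau>)"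
    by (rule sum.cong) (auto simp: factorizations_def)
  also have "\<dots> = (\<Sum>s\<in>?P \<times> ?P \<times> ?W. if (case s of (\<sigma>, \<rho>, \<tau>) \<Rightarrow> \<sigma> \<circ> \<rho> \<circ> apply_transps \<tau> = id)
      then (case s of (\<sigma>, \<rho>, \<tau>) \<Rightarrow> f \<sigma> \<rho> \<tau>) else 0)"
    by (rule sum.inter_filter) (use fin in auto)
  also have "\<dots> = (\<Sum>(\<sigma>, \<rho>, \<tau>)\<in>?P \<times> ?P \<times> ?W. if \<sigma> \<circ> \<rho> \<circ> apply_transps \<tau> = id then f \<sigma> \<rho> \<tau> else 0)"
    by (rule sum.cong) auto
  finally show ?thesis by (simp add: sum.cartesian_product)
qed

lemma conj_eq_id_iff:
  assumes "s \<circ> s = id"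
  shows "s \<circ> f \<circ> s = id \<longleftrightarrow> f = id"
proof
  assume "s \<circ> f \<circ> s = id"
  hence "s \<circ> (s \<circ> f \<circ> s) \<circ> s = s \<circ> s" by simp
  moreover have "s \<circ> (s \<circ> f \<circ> s) \<circ> s = (s \<circ> s) \<circ> f \<circ> (s \<circ> s)" by (simp add: comp_assoc)
  ultimately show "f = id" by (simp add: assms)
qed (simp add: assms)

lemma permutes_conj:
  assumes "s permutes A" "p permutes A"
  shows "s \<circ> p \<circ> s permutes A"
  by (intro permutes_compose assms)

text \<open>For fixed \<open>\<sigma>\<close> and \<open>\<rho>\<close> the invariance of words
  takes care of the word; the conjugates of \<open>\<sigma>\<close> and \<open>\<rho>\<close> are
  then absorbed by reindexing the outer sums over all permutations. Transitivity and weights are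
  hidden in \<open>G\<close>.\<close>

lemma sum_factorizations_conj:
  fixes G :: "(nat \<Rightarrow> nat) \<Rightarrow> 'v :: ab_group_add state_fun"
  assumes "Suc (Suc k) \<le> d" and s: "s = transpose (Suc k) (Suc (Suc k))"
  shows "(\<Sum>(\<sigma>, \<rho>, \<tau>)\<in>factorizations {1..d} r. G (s \<circ> \<sigma> \<circ> s) (s \<circ> \<rho> \<circ> s) ((`) s ` unsep \<tau>)) =
    (\<Sum>(\<sigma>, \<rho>, \<tau>)\<in>factorizations {1..d} r. G \<sigma> \<rho> (unsep \<tau>))"
proof -
  let ?P = "{p. p permutes {1..d}}" and ?W = "words {1..d} r"
  have ss: "s \<circ> s = id" by (simp add: s fun_eq_iff)
  have sp: "s permutes {1..d}" unfolding s by (rule permutes_swap_id) (use assms in auto)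
  have bij: "(\<Sum>p\<in>?P. f (s \<circ> p \<circ> s)) = (\<Sum>p\<in>?P. f p)" for f :: "(nat \<Rightarrow> nat) \<Rightarrow> 'v"
    by (rule sum.reindex_bij_witness[where i = "\<lambda>p. s \<circ> p \<circ> s" and j = "\<lambda>p. s \<circ> p \<circ> s"])
       (use permutes_conj[OF sp, unfolded comp_assoc] in \<open>auto simp: rewriteL_comp_comp[OF ss] rewriteR_comp_comp[OF ss] comp_assoc ss\<close>)
  have inner: "(\<Sum>\<tau>\<in>?W. if \<sigma> \<circ> \<rho> \<circ> apply_transps \<tau> = id then G (s \<circ> \<sigma> \<circ> s) (s \<circ> \<rho> \<circ> s) ((`) s ` unsep \<tau>) else 0) =
      (\<Sum>\<tau>\<in>?W. if (s \<circ> \<sigma> \<circ> s) \<circ> (s \<circ> \<rho> \<circ> s) \<circ> apply_transps \<tau> = id then G (s \<circ> \<sigma> \<circ> s) (s \<circ> \<rho> \<circ> s) (unsep \<tau>) else 0)"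
    for \<sigma> \<rho>
  proof -
    \<comment> \<open>\<open>F\<close> sees the word only through its product and its family, as
      \<open>sum_words_conj\<close> requires; the extra conjugation of \<open>g\<close> cancels the
      one introduced there.\<close>
    define F where "F = (\<lambda>g J. if \<sigma> \<circ> \<rho> \<circ> (s \<circ> g \<circ> s) = id then G (s \<circ> \<sigma> \<circ> s) (s \<circ> \<rho> \<circ> s) J else 0)"
    have 1: "s \<circ> (s \<circ> g \<circ> s) \<circ> s = g" for g
      by (simp add: s fun_eq_iff)
    have "(s \<circ> \<sigma> \<circ> s) \<circ> (s \<circ> \<rho> \<circ> s) \<circ> g = s \<circ> (\<sigma> \<circ> \<rho> \<circ> (s \<circ> g \<circ> s)) \<circ> s" for g
      by (simp add: s fun_eq_iff)
    hence 2: "(s \<circ> \<sigma> \<circ> s) \<circ> (s \<circ> \<rho> \<circ> s) \<circ> g = id \<longleftrightarrow> \<sigma> \<circ> \<rho> \<circ> (s \<circ> g \<circ> s) = id" for g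
      by (simp only: conj_eq_id_iff[OF ss])
    show ?thesis
      using sum_words_conj[OF assms(1) s, of F r] by (simp only: F_def 1 2)
  qed
  show ?thesis
    unfolding sum_factorizations[OF finite_atLeastAtMost] inner
    by (subst (1 2) bij[symmetric]) (rule refl)
qed

lemma connected_by_conj:
  assumes ss: "s \<circ> s = id" and sp: "s permutes A"
  shows "connected_by A (s \<circ> \<sigma> \<circ> s) (s \<circ> \<rho> \<circ> s) ((`) s ` J) \<longleftrightarrow> connected_by A \<sigma> \<rho> J"
proof -
  have inv: "s ` s ` X = X" for X
    using ss by (simp add: image_comp)
  have eq: "s ` X = s ` Y \<longleftrightarrow> X = Y" for X Y
    by (metis inv)
  have A: "s ` X \<subseteq> A \<longleftrightarrow> X \<subseteq> A" "s ` X = A \<longleftrightarrow> X = A" for X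
    using inv permutes_image[OF sp] by (metis image_mono, metis)
  have c: "(s \<circ> p \<circ> s) ` s ` X = s ` X \<longleftrightarrow> p ` X = X" for p X
  proof -
    have "(s \<circ> p \<circ> s) ` s ` X = s ` p ` X" unfolding image_comp[symmetric] inv ..
    thus ?thesis by (simp only: eq)
  qed
  show ?thesis
    unfolding connected_by_def ball_simps c A by simp
qed

lemma wt_conj:
  assumes "finite A" "s \<circ> s = id" "s permutes A" "\<sigma> permutes A" "\<rho> permutes A"
  shows "wt A r (s \<circ> \<sigma> \<circ> s) (s \<circ> \<rho> \<circ> s) = wt A r \<sigma> \<rho>"
proof -
  have s: "s (s x) = x" for x using assms(2) by (metis comp_apply id_apply)
  have "ctype A (s \<circ> p \<circ> s) = ctype A p" if "p permutes A" for p
    by (rule ctype_map[OF permutes_imp_bij[OF assms(3)] assms(1) that]) (simp add: s)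
  thus ?thesis using assms by (simp add: wt_def)
qed

lemma clen_conj:
  assumes "finite A" "s \<circ> s = id" "s permutes A" "\<sigma> permutes A" "x \<in> A"
  shows "clen (s \<circ> \<sigma> \<circ> s) x = clen \<sigma> (s x)"
proof -
  have s: "s (s x) = x" for x using assms(2) by (metis comp_apply id_apply)
  have "clen (s \<circ> \<sigma> \<circ> s) (s (s x)) = clen \<sigma> (s x)"
    by (rule clen_map[OF permutes_imp_bij[OF assms(3)] assms(1,4)])
       (use assms s in \<open>auto simp: permutes_in_image\<close>)
  thus ?thesis by (simp add: s)
qed

lemma constant_of_adjacent:
  assumes "\<And>k. Suc (Suc k) \<le> d \<Longrightarrow> f (Suc k) = f (Suc (Suc k))" "x \<in> {1..d}"
  shows "f x = f d"
proof -
  have "1 \<le> x" "x \<le> d" using assms(2) by auto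
  from this(2,1) show ?thesis
  proof (induction x rule: inc_induct)
    case (step n)
    obtain k where "n = Suc k" using step.prems by (cases n) auto
    thus ?case using assms(1)[of k] step by simp
  qed simp
qed

lemma sum_trans_fact:
  assumes "finite A"
  shows "(\<Sum>(\<sigma>, \<rho>, \<tau>)\<in>trans_fact A r. f \<sigma> \<rho> \<tau>) =
    (\<Sum>(\<sigma>, \<rho>, \<tau>)\<in>factorizations A r. if connected_by A \<sigma> \<rho> (unsep \<tau>) then f \<sigma> \<rho> \<tau> else (0 :: 'v :: comm_monoid_add))"
proof -
  have "(\<Sum>(\<sigma>, \<rho>, \<tau>)\<in>trans_fact A r. f \<sigma> \<rho> \<tau>) =
      (\<Sum>s\<in>{s \<in> factorizations A r. case s of (\<sigma>, \<rho>, \<tau>) \<Rightarrow> connected_by A \<sigma> \<rho> (unsep \<tau>)}. case s of (\<sigma>, \<rho>, \<tau>) \<Rightarrow> f \<sigma> \<rho> \<tau>)"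
    by (rule sum.cong) (auto simp: trans_fact_def)
  also have "\<dots> = (\<Sum>s\<in>factorizations A r. if (case s of (\<sigma>, \<rho>, \<tau>) \<Rightarrow> connected_by A \<sigma> \<rho> (unsep \<tau>))
      then (case s of (\<sigma>, \<rho>, \<tau>) \<Rightarrow> f \<sigma> \<rho> \<tau>) else 0)"
    by (rule sum.inter_filter) (use assms in auto)
  also have "\<dots> = (\<Sum>(\<sigma>, \<rho>, \<tau>)\<in>factorizations A r. if connected_by A \<sigma> \<rho> (unsep \<tau>) then f \<sigma> \<rho> \<tau> else 0)"
    by (rule sum.cong) auto
  finally show ?thesis .
qed

lemma factorizationsD:
  assumes "(\<sigma>, \<rho>, \<tau>) \<in> factorizations A r"
  shows "\<sigma> permutes A" "\<rho> permutes A" "\<tau> \<in> words A r" "\<sigma> \<circ> \<rho> \<circ> apply_transps \<tau> = id"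
  using assms by (auto simp: factorizations_def)

lemma sum_factorizations_cong:
  assumes "\<And>\<sigma> \<rho> \<tau>. \<sigma> permutes A \<Longrightarrow> \<rho> permutes A \<Longrightarrow> \<tau> \<in> words A r \<Longrightarrow> \<sigma> \<circ> \<rho> \<circ> apply_transps \<tau> = id \<Longrightarrow>
    f \<sigma> \<rho> \<tau> = g \<sigma> \<rho> \<tau>"
  shows "(\<Sum>(\<sigma>, \<rho>, \<tau>)\<in>factorizations A r. f \<sigma> \<rho> \<tau>) = (\<Sum>(\<sigma>, \<rho>, \<tau>)\<in>factorizations A r. g \<sigma> \<rho> \<tau>)"
  by (rule sum.cong) (use assms in \<open>auto simp: factorizations_def\<close>)

text \<open>Cycle types and connectivity survive conjugation by an adjacent transposition, which
  moves the mark to the neighbouring label.\<close>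

lemma nsum_constant:
  assumes "x \<in> {1..d}"
  shows "nsum {1..d} r x = nsum {1..d} r d"
proof (rule constant_of_adjacent[OF _ assms])
  fix k assume k: "Suc (Suc k) \<le> d"
  define s where "s = transpose (Suc k) (Suc (Suc k))"
  have ss: "s \<circ> s = id" by (simp add: s_def fun_eq_iff)
  have sp: "s permutes {1..d}" unfolding s_def by (rule permutes_swap_id) (use k in auto)
  define G where "G x = (\<lambda>\<sigma> \<rho> J. if connected_by {1..d} \<sigma> \<rho> J
    then mon (insert_wt (clen \<sigma> x) (clen \<rho> x) (wt {1..d} r \<sigma> \<rho>)) else 0)" for x
  have n: "nsum {1..d} r x = (\<Sum>(\<sigma>, \<rho>, \<tau>)\<in>factorizations {1..d} r. G x \<sigma> \<rho> (unsep \<tau>))" for x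
    unfolding nsum_def G_def by (rule sum_trans_fact) simp
  have "G x (s \<circ> \<sigma> \<circ> s) (s \<circ> \<rho> \<circ> s) ((`) s ` J) = G (s x) \<sigma> \<rho> J"
    if "\<sigma> permutes {1..d}" "\<rho> permutes {1..d}" "x \<in> {1..d}" for \<sigma> \<rho> J x
    unfolding G_def using that
    by (simp only: connected_by_conj[OF ss sp] wt_conj[OF _ ss sp] clen_conj[OF _ ss sp] finite_atLeastAtMost)
  note G = this
  have "nsum {1..d} r (Suc k) =
      (\<Sum>(\<sigma>, \<rho>, \<tau>)\<in>factorizations {1..d} r. G (Suc k) (s \<circ> \<sigma> \<circ> s) (s \<circ> \<rho> \<circ> s) ((`) s ` unsep \<tau>))"
    unfolding n by (rule sum_factorizations_conj[OF k s_def, symmetric])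
  also have "\<dots> = (\<Sum>(\<sigma>, \<rho>, \<tau>)\<in>factorizations {1..d} r. G (s (Suc k)) \<sigma> \<rho> (unsep \<tau>))"
    by (rule sum_factorizations_cong) (use G k in auto)
  also have "\<dots> = nsum {1..d} r (Suc (Suc k))" by (simp only: n s_def transpose_apply_first)
  finally show "nsum {1..d} r (Suc k) = nsum {1..d} r (Suc (Suc k))" .
qed

text \<open>What remains of solutions whose last letter has been multiplied into the first
  permutation. The remaining tuple itself may be disconnected, but becomes connected once x and y
  are tied together; its weight is that of the original first permutation, hence the transposition
  in \<open>wt\<close>.\<close>

definition ksum :: "nat set \<Rightarrow> nat \<Rightarrow> nat \<Rightarrow> series" where
  "ksum A r x = (\<Sum>(\<sigma>, \<rho>, \<tau>)\<in>factorizations A r. \<Sum>y\<in>A - {x}.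
    if connected_by A \<sigma> \<rho> (unsep \<tau> \<inter> together x y) then mon (wt A r (transpose x y \<circ> \<sigma>) \<rho>) else 0)"

lemma image_together:
  assumes "s \<circ> s = id"
  shows "(`) s ` (J \<inter> together x y) = (`) s ` J \<inter> together (s x) (s y)"
proof -
  have s: "s (s z) = z" for z using assms by (metis comp_apply id_apply)
  have "s z \<in> s ` X \<longleftrightarrow> z \<in> X" for z X by (metis image_iff s)
  thus ?thesis by (auto simp: together_def)
qed

text \<open>The partner y runs over all labels other than x, a range that relabelling carries to the
  corresponding range for the new mark.\<close>

lemma ksum_constant:
  assumes "x \<in> {1..d}"
  shows "ksum {1..d} r x = ksum {1..d} r d"
proof (rule constant_of_adjacent[OF _ assms])
  fix k assume k: "Suc (Suc k) \<le> d"
  define s where "s = transpose (Suc k) (Suc (Suc k))"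
  have ss: "s \<circ> s = id" by (simp add: s_def fun_eq_iff)
  have s: "s (s z) = z" for z by (simp add: s_def)
  have sp: "s permutes {1..d}" unfolding s_def by (rule permutes_swap_id) (use k in auto)
  define H where "H x y = (\<lambda>\<sigma> \<rho> J. if connected_by {1..d} \<sigma> \<rho> (J \<inter> together x y)
    then mon (wt {1..d} r (transpose x y \<circ> \<sigma>) \<rho>) else 0)" for x y
  have n: "ksum {1..d} r x = (\<Sum>(\<sigma>, \<rho>, \<tau>)\<in>factorizations {1..d} r. \<Sum>y\<in>{1..d} - {x}. H x y \<sigma> \<rho> (unsep \<tau>))" for x
    by (simp only: ksum_def H_def)
  have H: "H (s x) (s y) (s \<circ> \<sigma> \<circ> s) (s \<circ> \<rho> \<circ> s) ((`) s ` J) = H x y \<sigma> \<rho> J"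
    if "\<sigma> permutes {1..d}" "\<rho> permutes {1..d}" "x \<in> {1..d}" "y \<in> {1..d}" for \<sigma> \<rho> J x y
  proof -
    have "transpose (s x) (s y) \<circ> (s \<circ> \<sigma> \<circ> s) = s \<circ> (transpose x y \<circ> \<sigma>) \<circ> s"
      using comp_transpose[of s x y] permutes_inj[OF sp] by (simp add: comp_assoc[symmetric])
    moreover have "transpose x y \<circ> \<sigma> permutes {1..d}"
      using that by (intro permutes_compose permutes_swap_id)
    ultimately show ?thesis
      unfolding H_def image_together[OF ss, symmetric] using that
      by (simp only: connected_by_conj[OF ss sp] wt_conj[OF _ ss sp] finite_atLeastAtMost)
  qed
  have "(\<Sum>y\<in>{1..d} - {s x}. H (s x) y (s \<circ> \<sigma> \<circ> s) (s \<circ> \<rho> \<circ> s) ((`) s ` J)) = (\<Sum>y\<in>{1..d} - {x}. H x y \<sigma> \<rho> J)"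
    if "\<sigma> permutes {1..d}" "\<rho> permutes {1..d}" "x \<in> {1..d}" for \<sigma> \<rho> J x
    by (rule sum.reindex_bij_witness[where i = s and j = s])
       (use that H[OF that, symmetric] permutes_in_image[OF sp] s inj_eq[OF permutes_inj[OF sp]]
         in \<open>auto simp del: atLeastAtMost_iff\<close>)
  note G = this
  have "ksum {1..d} r (s (Suc (Suc k))) =
      (\<Sum>(\<sigma>, \<rho>, \<tau>)\<in>factorizations {1..d} r. \<Sum>y\<in>{1..d} - {s (Suc (Suc k))}. H (s (Suc (Suc k))) y (s \<circ> \<sigma> \<circ> s) (s \<circ> \<rho> \<circ> s) ((`) s ` unsep \<tau>))"
    unfolding n by (rule sum_factorizations_conj[OF k s_def, symmetric])
  also have "\<dots> = (\<Sum>(\<sigma>, \<rho>, \<tau>)\<in>factorizations {1..d} r. \<Sum>y\<in>{1..d} - {Suc (Suc k)}. H (Suc (Suc k)) y \<sigma> \<rho> (unsep \<tau>))"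
    by (rule sum_factorizations_cong, rule G) (use k in auto)
  also have "\<dots> = ksum {1..d} r (Suc (Suc k))" by (simp only: n)
  finally show "ksum {1..d} r (Suc k) = ksum {1..d} r (Suc (Suc k))" by (simp add: s_def)
qed

section \<open>The two ways of removing the largest label\<close>

lemma connected_by_transpose:
  assumes "\<And>X. X \<in> J \<Longrightarrow> x \<in> X \<longleftrightarrow> y \<in> X"
  shows "connected_by A (transpose x y \<circ> \<sigma>) \<rho> J \<longleftrightarrow> connected_by A \<sigma> \<rho> J"
proof -
  have "(transpose x y \<circ> \<sigma>) ` X = X \<longleftrightarrow> \<sigma> ` X = X" if "X \<in> J" for X
  proof -
    have t: "transpose x y ` X = X" using assms[OF that] by (simp add: transpose_image_eq_iff)
    have "(transpose x y \<circ> \<sigma>) ` X = X \<longleftrightarrow> transpose x y ` \<sigma> ` X = transpose x y ` X"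
      by (simp only: image_comp[symmetric] t)
    also have "\<dots> \<longleftrightarrow> \<sigma> ` X = X"
      by (rule inj_image_eq_iff) simp
    finally show ?thesis .
  qed
  thus ?thesis by (simp add: connected_by_def)
qed

text \<open>The last letter (a d) leaves the right end of the product and reappears to the left of
  \<open>\<sigma>\<close>: conjugation by it preserves the condition that the product is the
  identity. The edge from a to d stays recorded, so connectivity is unchanged, and the lost letter
  is the factor t.\<close>

lemma sum_last:
  "(\<Sum>(\<sigma>, \<rho>, \<tau>)\<in>{(\<sigma>, \<rho>, \<tau>) \<in> trans_fact {1..Suc n} (Suc r). snd (last \<tau>) = Suc n}. mon (wt {1..Suc n} (Suc r) \<sigma> \<rho>)) =
    tt * ksum {1..Suc n} r (Suc n)"
proof -
  let ?d = "Suc n" and ?A = "{1..Suc n}"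
  let ?C = "\<lambda>\<sigma> \<rho> \<tau> a. connected_by ?A \<sigma> \<rho> (unsep \<tau> \<inter> together ?d a)"
  let ?f = "\<lambda>((\<sigma>, \<rho>, \<tau>), a). (transpose ?d a \<circ> \<sigma>, \<rho>, \<tau> @ [(a, ?d)])"
  let ?S = "{(\<sigma>, \<rho>, \<tau>) \<in> trans_fact ?A (Suc r). snd (last \<tau>) = ?d}"
  let ?T = "{((\<sigma>, \<rho>, \<tau>), a). (\<sigma>, \<rho>, \<tau>) \<in> factorizations ?A r \<and> a \<in> {1..n} \<and> ?C \<sigma> \<rho> \<tau> a}"
  have A: "?A - {?d} = {1..n}" by auto
  have tr: "transpose ?d a permutes ?A" if "a \<in> {1..n}" for a
    by (rule permutes_swap_id) (use that in auto)
  have move: "transpose ?d a \<circ> \<sigma> \<circ> \<rho> \<circ> apply_transps (\<tau> @ [(a, ?d)]) = id \<longleftrightarrow> \<sigma> \<circ> \<rho> \<circ> apply_transps \<tau> = id" for \<sigma> \<rho> \<tau> a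
  proof -
    have "transpose ?d a \<circ> \<sigma> \<circ> \<rho> \<circ> apply_transps (\<tau> @ [(a, ?d)]) = transpose ?d a \<circ> (\<sigma> \<circ> \<rho> \<circ> apply_transps \<tau>) \<circ> transpose ?d a"
      by (simp add: comp_assoc transpose_commute)
    moreover have "transpose ?d a \<circ> transpose ?d a = id" by (simp add: fun_eq_iff)
    ultimately show ?thesis by (simp only: conj_eq_id_iff)
  qed
  have conn: "connected_by ?A (transpose ?d a \<circ> \<sigma>) \<rho> (unsep (\<tau> @ [(a, ?d)])) \<longleftrightarrow> ?C \<sigma> \<rho> \<tau> a" for \<sigma> \<rho> \<tau> a
  proof -
    have "together a ?d = together ?d a" by (auto simp: together_def)
    thus ?thesis
      by (subst connected_by_transpose) (auto simp: unsep_append together_def)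
  qed
  have wt: "mon (wt ?A (Suc r) \<sigma> \<rho>) = tt * mon (wt ?A r \<sigma> \<rho>)" for \<sigma> \<rho>
    by (simp add: wt_def mps_var_monom mps_monom_mult ac_simps)
  have im: "?S = ?f ` ?T"
  proof (intro equalityI subsetI)
    fix s assume s: "s \<in> ?S"
    obtain \<sigma> \<rho> \<tau> where seq: "s = (\<sigma>, \<rho>, \<tau>)" by (cases s)
    have fact: "(\<sigma>, \<rho>, \<tau>) \<in> factorizations ?A (Suc r)" and con: "connected_by ?A \<sigma> \<rho> (unsep \<tau>)"
      and last: "snd (last \<tau>) = ?d"
      using s by (auto simp: seq trans_fact_def)
    note f = factorizationsD[OF fact]
    have "\<tau> \<in> {\<tau> \<in> words ?A (Suc r). snd (last \<tau>) = ?d}" using f(3) last by simp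
    then obtain \<tau>' a where \<tau>: "\<tau> = \<tau>' @ [(a, ?d)]" "\<tau>' \<in> words ?A r" "a \<in> {1..n}"
      unfolding words_Suc_last by auto
    let ?\<sigma> = "transpose ?d a \<circ> \<sigma>"
    have \<sigma>: "\<sigma> = transpose ?d a \<circ> ?\<sigma>" by (simp add: fun_eq_iff)
    have "?\<sigma> \<circ> \<rho> \<circ> apply_transps \<tau>' = id"
      using f(4) unfolding \<tau>(1) by (subst (asm) \<sigma>) (simp only: move)
    moreover have "?C ?\<sigma> \<rho> \<tau>' a"
      using con unfolding \<tau>(1) by (subst (asm) \<sigma>) (simp only: conn)
    moreover have "?\<sigma> permutes ?A" by (intro permutes_compose f(1) tr \<tau>(3))
    ultimately have "((?\<sigma>, \<rho>, \<tau>'), a) \<in> ?T"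
      using f(2) \<tau>(2,3) by (simp add: factorizations_def)
    moreover have "s = ?f ((?\<sigma>, \<rho>, \<tau>'), a)" by (simp add: seq \<tau>(1))
    ultimately show "s \<in> ?f ` ?T" by (rule image_eqI[rotated])
  next
    fix s assume "s \<in> ?f ` ?T"
    then obtain \<sigma> \<rho> \<tau> a where s: "s = (transpose ?d a \<circ> \<sigma>, \<rho>, \<tau> @ [(a, ?d)])"
      and fact: "(\<sigma>, \<rho>, \<tau>) \<in> factorizations ?A r" and a: "a \<in> {1..n}" and C: "?C \<sigma> \<rho> \<tau> a"
      by auto
    note f = factorizationsD[OF fact]
    have "transpose ?d a \<circ> \<sigma> permutes ?A" by (intro permutes_compose f(1) tr a)
    moreover have "\<tau> @ [(a, ?d)] \<in> words ?A (Suc r)"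
      unfolding words_snoc using f(3) a by simp
    ultimately show "s \<in> ?S"
      using f(2,4) C unfolding s trans_fact_def factorizations_def by (simp only: mem_Collect_eq prod.case move conn) simp
  qed
  \<comment> \<open>The inverse reads a from the last letter of the longer word and multiplies the
    transposition back.\<close>
  have inj: "inj_on ?f ?T"
    by (rule inj_on_inverseI[where g = "\<lambda>(\<sigma>, \<rho>, \<tau>). ((transpose ?d (fst (last \<tau>)) \<circ> \<sigma>, \<rho>, butlast \<tau>), fst (last \<tau>))"])
       auto
  have "(\<Sum>(\<sigma>, \<rho>, \<tau>)\<in>?S. mon (wt ?A (Suc r) \<sigma> \<rho>)) =
      (\<Sum>((\<sigma>, \<rho>, \<tau>), a)\<in>?T. tt * mon (wt ?A r (transpose ?d a \<circ> \<sigma>) \<rho>))"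
    unfolding im sum.reindex[OF inj]
    by (rule sum.cong[OF refl]) (simp only: o_apply split_beta fst_conv snd_conv wt)
  also have "?T = {p \<in> factorizations ?A r \<times> {1..n}. case p of ((\<sigma>, \<rho>, \<tau>), a) \<Rightarrow> ?C \<sigma> \<rho> \<tau> a}"
    by auto
  also have "(\<Sum>((\<sigma>, \<rho>, \<tau>), a)\<in>\<dots>. tt * mon (wt ?A r (transpose ?d a \<circ> \<sigma>) \<rho>)) =
      (\<Sum>p\<in>factorizations ?A r \<times> {1..n}. if (case p of ((\<sigma>, \<rho>, \<tau>), a) \<Rightarrow> ?C \<sigma> \<rho> \<tau> a)
        then (case p of ((\<sigma>, \<rho>, \<tau>), a) \<Rightarrow> tt * mon (wt ?A r (transpose ?d a \<circ> \<sigma>) \<rho>)) else 0)"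
    by (subst sum.inter_filter[symmetric]) (auto intro!: sum.cong)
  also have "\<dots> = (\<Sum>(s, a)\<in>factorizations ?A r \<times> {1..n}. case s of (\<sigma>, \<rho>, \<tau>) \<Rightarrow>
      tt * (if ?C \<sigma> \<rho> \<tau> a then mon (wt ?A r (transpose ?d a \<circ> \<sigma>) \<rho>) else 0))"
    by (rule sum.cong) auto
  also have "\<dots> = (\<Sum>s\<in>factorizations ?A r. \<Sum>a\<in>{1..n}. case s of (\<sigma>, \<rho>, \<tau>) \<Rightarrow>
      tt * (if ?C \<sigma> \<rho> \<tau> a then mon (wt ?A r (transpose ?d a \<circ> \<sigma>) \<rho>) else 0))"
    by (rule sum.cartesian_product[symmetric])
  also have "\<dots> = tt * ksum ?A r ?d"
    unfolding ksum_def A sum_distrib_left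
    by (rule sum.cong[OF refl]) (simp only: split_beta sum_distrib_left)
  finally show ?thesis .
qed

text \<open>The new label is inserted next to x in both permutations, so an invariant set contains
  both of them or neither. Deleting the new label therefore matches the invariant sets of the two
  tuples.\<close>

lemma connected_by_insert:
  assumes \<sigma>: "\<sigma> permutes {1..n}" and \<rho>: "\<rho> permutes {1..n}" and x: "x \<in> {1..n}" and \<tau>: "\<tau> \<in> words {1..n} r"
  shows "connected_by {1..Suc n} (\<sigma> \<circ> transpose x (Suc n)) (transpose x (Suc n) \<circ> \<rho>) (unsep \<tau>) \<longleftrightarrow>
    connected_by {1..n} \<sigma> \<rho> (unsep \<tau>)"
proof -
  let ?d = "Suc n"
  let ?t = "transpose x ?d"
  have d: "\<sigma> ?d = ?d" "\<rho> ?d = ?d" using \<sigma> \<rho> by (auto intro: permutes_not_in)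
  have inj: "inj \<sigma>" "inj \<rho>" using \<sigma> \<rho> by (auto intro: permutes_inj)
  have eq: "Y \<in> unsep \<tau> \<longleftrightarrow> Z \<in> unsep \<tau>" if "Y - {?d} = Z - {?d}" for Y Z
  proof -
    have "Y \<in> together a b \<longleftrightarrow> Z \<in> together a b" if "(a, b) \<in> set \<tau>" for a b
    proof -
      have "a \<noteq> ?d" "b \<noteq> ?d" using \<tau> that by (auto simp: words_def)
      thus ?thesis using \<open>Y - {?d} = Z - {?d}\<close> unfolding together_def by blast
    qed
    thus ?thesis by (auto simp: unsep_def)
  qed
  show ?thesis
  proof
    assume c: "connected_by {1..Suc n} (\<sigma> \<circ> ?t) (?t \<circ> \<rho>) (unsep \<tau>)"
    show "connected_by {1..n} \<sigma> \<rho> (unsep \<tau>)"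
      unfolding connected_by_def
    proof (intro ballI impI)
      fix X assume X: "X \<in> unsep \<tau>" "X \<subseteq> {1..n}" "\<sigma> ` X = X" "\<rho> ` X = X"
      \<comment> \<open>The invariant set on n + 1 labels that lies over \<open>X\<close>.\<close>
      define Y where "Y = (if x \<in> X then insert ?d X else X)"
      have "?d \<notin> X" using X(2) by auto
      hence t: "?t ` Y = Y" using x unfolding transpose_image_eq_iff Y_def by auto
      have "\<sigma> ` Y = Y" "\<rho> ` Y = Y" using X d by (auto simp: Y_def)
      hence "(\<sigma> \<circ> ?t) ` Y = Y" "(?t \<circ> \<rho>) ` Y = Y" by (simp_all only: image_comp[symmetric] t)
      moreover have "Y \<in> unsep \<tau>" using eq[of Y X] X(1) by (auto simp: Y_def)
      moreover have "Y \<subseteq> {1..Suc n}" using X(2) by (auto simp: Y_def)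
      ultimately have "Y = {} \<or> Y = {1..Suc n}" using c unfolding connected_by_def by blast
      moreover have "X = Y - {?d}" using \<open>?d \<notin> X\<close> by (auto simp: Y_def)
      moreover have "{1..Suc n} - {?d} = {1..n}" by auto
      ultimately show "X = {} \<or> X = {1..n}" by auto
    qed
  next
    assume c: "connected_by {1..n} \<sigma> \<rho> (unsep \<tau>)"
    show "connected_by {1..Suc n} (\<sigma> \<circ> ?t) (?t \<circ> \<rho>) (unsep \<tau>)"
      unfolding connected_by_def
    proof (intro ballI impI)
      fix Y assume Y: "Y \<in> unsep \<tau>" "Y \<subseteq> {1..Suc n}" "(\<sigma> \<circ> ?t) ` Y = Y" "(?t \<circ> \<rho>) ` Y = Y"
      have "inj (?t \<circ> \<rho>)" by (intro inj_compose inj) simp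
      hence "(?t \<circ> \<rho>) ?d \<in> (?t \<circ> \<rho>) ` Y \<longleftrightarrow> ?d \<in> Y" by (rule inj_image_mem_iff)
      hence dx: "x \<in> Y \<longleftrightarrow> ?d \<in> Y" unfolding Y(4) by (simp add: d)
      hence t: "?t ` Y = Y" by (simp add: transpose_image_eq_iff)
      have \<sigma>Y: "\<sigma> ` Y = Y" using Y(3) by (simp only: image_comp[symmetric] t)
      have "?t ` \<rho> ` Y = ?t ` Y" using Y(4) by (simp only: image_comp[symmetric] t)
      hence \<rho>Y: "\<rho> ` Y = Y" by (subst (asm) inj_image_eq_iff) auto
      let ?X = "Y - {?d}"
      have "\<sigma> ` ?X = ?X" "\<rho> ` ?X = ?X"
        using \<sigma>Y \<rho>Y d by (simp_all add: image_set_diff inj)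
      moreover have "?X \<in> unsep \<tau>" using eq[of ?X Y] Y(1) by simp
      moreover have "?X \<subseteq> {1..n}" using Y(2) by auto
      ultimately have "?X = {} \<or> ?X = {1..n}" using c unfolding connected_by_def by blast
      thus "Y = {} \<or> Y = {1..Suc n}"
      proof
        assume "?X = {}"
        moreover have "x \<noteq> ?d" using x by auto
        ultimately have "Y = {}" using dx by blast
        thus ?thesis ..
      next
        assume X: "?X = {1..n}"
        hence "?d \<in> Y" using dx x by blast
        hence "Y = insert ?d {1..n}" using X by blast
        thus ?thesis by auto
      qed
    qed
  qed
qed

text \<open>The new label is a cycle of length 1 of both permutations, and the transposition joins
  it to the cycle of x.\<close>

lemma wt_insert:
  assumes \<sigma>: "\<sigma> permutes {1..n}" and \<rho>: "\<rho> permutes {1..n}" and x: "x \<in> {1..n}"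
  shows "wt {1..Suc n} r (\<sigma> \<circ> transpose x (Suc n)) (transpose x (Suc n) \<circ> \<rho>) =
    add_mset ZVar (insert_wt (clen \<sigma> x) (clen \<rho> x) (wt {1..n} r \<sigma> \<rho>))"
proof -
  let ?d = "Suc n" and ?A = "{1..Suc n}"
  have fin: "finite {1..n}" "finite ?A" by simp_all
  have *: "ctype ?A (transpose y ?d \<circ> p) = add_mset (clen p y + 1) (ctype {1..n} p - {#clen p y#})"
    if p: "p permutes {1..n}" and y: "y \<in> {1..n}" for p y
  proof -
    have pA: "p permutes ?A" by (rule permutes_subset[OF p]) auto
    have pd: "p ?d = ?d" using p by (auto intro: permutes_not_in)
    have orb: "orbit p ?d = {?d}" using pd by (simp add: orbit_eq_singleton_iff)
    have A: "?A = {1..n} \<union> {?d}" by auto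
    have "ctype ?A p = ctype {1..n} p + ctype {?d} id"
      unfolding A by (rule ctype_Un) (use p pd in \<open>auto simp: permutes_id\<close>)
    also have "ctype {?d} id = {#1#}"
    proof -
      have "orbit id ?d = {?d}" by (simp add: orbit_eq_singleton_iff)
      thus ?thesis by (simp add: ctype_def)
    qed
    finally have ct: "ctype ?A p = add_mset 1 (ctype {1..n} p)" by simp
    have "?d \<notin> orbit p y" using orbit_in_carrier[OF fin(1) p y] by auto
    hence "ctype ?A (transpose y ?d \<circ> p) = add_mset (clen p y + clen p ?d) (ctype ?A p - {#clen p y#} - {#clen p ?d#})"
      by (intro ctype_join_eq(1) pA) (use y in auto)
    moreover obtain K where "ctype {1..n} p = add_mset (clen p y) K"
      using clen_in_ctype[OF fin(1) p y] by (metis multi_member_split)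
    ultimately show ?thesis unfolding ct orb by simp
  qed
  have \<sigma>d: "\<sigma> ?d = ?d" using \<sigma> by (auto intro: permutes_not_in)
  \<comment> \<open>Here the transposition stands on the right. Moved to the left it involves
    \<open>\<sigma> x\<close> in place of x, a point of the same cycle.\<close>
  have "\<sigma> \<circ> transpose x ?d = transpose (\<sigma> x) ?d \<circ> \<sigma>"
    using comp_transpose[OF permutes_inj[OF \<sigma>], of x ?d] by (simp add: \<sigma>d)
  moreover have "clen \<sigma> (\<sigma> x) = clen \<sigma> x"
    by (rule clen_cong[OF fin(1) \<sigma>]) (rule orbit.base)
  moreover have "\<sigma> x \<in> {1..n}" using x permutes_in_image[OF \<sigma>] by blast
  ultimately have 1: "ctype ?A (\<sigma> \<circ> transpose x ?d) = add_mset (clen \<sigma> x + 1) (ctype {1..n} \<sigma> - {#clen \<sigma> x#})"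
    using *[OF \<sigma>] by simp
  note 2 = *[OF \<rho> x]
  obtain K where K: "ctype {1..n} \<sigma> = add_mset (clen \<sigma> x) K"
    using clen_in_ctype[OF fin(1) \<sigma> x] by (metis multi_member_split)
  obtain L where L: "ctype {1..n} \<rho> = add_mset (clen \<rho> x) L"
    using clen_in_ctype[OF fin(1) \<rho> x] by (metis multi_member_split)
  show ?thesis unfolding wt_def insert_wt_def 1 2 K L by (simp add: ac_simps)
qed

text \<open>When no letter moves d = n + 1, the mark is the image x of d under
  \<open>\<rho>\<close>, and the product condition at d says that \<open>\<sigma>\<close> sends x
  back to d. The same transposition (x d) cuts d out of both permutations and cancels between them
  in the product.\<close>

lemma sum_not_last:
  assumes "n \<ge> 1"
  shows "(\<Sum>(\<sigma>, \<rho>, \<tau>)\<in>{(\<sigma>, \<rho>, \<tau>) \<in> trans_fact {1..Suc n} r. \<tau> \<in> words {1..n} r}. mon (wt {1..Suc n} r \<sigma> \<rho>)) =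
    of_nat n * zz * nsum {1..n} r n"
proof -
  let ?d = "Suc n" and ?A = "{1..Suc n}" and ?B = "{1..n}"
  let ?S = "{(\<sigma>, \<rho>, \<tau>) \<in> trans_fact ?A r. \<tau> \<in> words ?B r}"
  let ?f = "\<lambda>((\<sigma>, \<rho>, \<tau>), x). (\<sigma> \<circ> transpose x ?d, transpose x ?d \<circ> \<rho>, \<tau>)"
  have BA: "?B \<subseteq> ?A" by auto
  have words: "words ?B r \<subseteq> words ?A r" by (fastforce simp: words_def)
  have comp: "(\<sigma> \<circ> t) \<circ> (t \<circ> \<rho>) \<circ> g = \<sigma> \<circ> \<rho> \<circ> g" if "t \<circ> t = id" for \<sigma> \<rho> g t :: "nat \<Rightarrow> nat"
    by (metis comp_assoc comp_id that)
  have im: "?S = ?f ` (trans_fact ?B r \<times> ?B)"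
  proof (intro equalityI subsetI)
    fix s assume s: "s \<in> ?S"
    obtain \<sigma> \<rho> \<tau> where seq: "s = (\<sigma>, \<rho>, \<tau>)" by (cases s)
    have fact: "(\<sigma>, \<rho>, \<tau>) \<in> factorizations ?A r" and con: "connected_by ?A \<sigma> \<rho> (unsep \<tau>)"
      and \<tau>: "\<tau> \<in> words ?B r"
      using s by (auto simp: seq trans_fact_def)
    note f = factorizationsD[OF fact]
    define x where "x = \<rho> ?d"
    have "apply_transps \<tau> permutes ?B" by (rule permutes_apply_transps) (use \<tau> in \<open>auto simp: words_def\<close>)
    hence "apply_transps \<tau> ?d = ?d" by (auto intro: permutes_not_in)
    hence \<sigma>x: "\<sigma> x = ?d" using fun_cong[OF f(4), of ?d] by (simp add: x_def)
    have xA: "x \<in> ?A" using permutes_in_image[OF f(2)] by (simp add: x_def)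
    \<comment> \<open>Otherwise d alone would be an invariant set, which the presence of a second
      label forbids; this is where n must be positive.\<close>
    have "x \<noteq> ?d"
    proof
      assume "x = ?d"
      hence "\<sigma> ` {?d} = {?d}" "\<rho> ` {?d} = {?d}" using \<sigma>x x_def by auto
      moreover have "{?d} \<in> unsep \<tau>" using \<tau> by (fastforce simp: unsep_def together_def words_def)
      moreover have "{?d} \<subseteq> ?A" by simp
      ultimately have "{?d} = {} \<or> {?d} = ?A" using con unfolding connected_by_def by metis
      hence "{?d} = ?A" by simp
      moreover have "1 \<in> ?A" "1 \<noteq> ?d" using assms by auto
      ultimately show False by blast
    qed
    hence x: "x \<in> ?B" using xA by auto
    let ?t = "transpose x ?d"
    have tt: "?t \<circ> ?t = id" by (simp add: fun_eq_iff)
    have tA: "?t permutes ?A" by (rule permutes_swap_id) (use x in auto)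
    have AB: "p permutes ?B" if "p permutes ?A" "p ?d = ?d" for p
    proof (rule permutes_superset[OF that(1)])
      show "p z = z" if "z \<in> ?A - ?B" for z
      proof -
        have "z = ?d" using that by auto
        thus ?thesis using \<open>p ?d = ?d\<close> by simp
      qed
    qed
    have \<sigma>': "\<sigma> \<circ> ?t permutes ?B"
      by (rule AB[OF permutes_compose[OF tA f(1)]]) (simp add: \<sigma>x)
    have \<rho>': "?t \<circ> \<rho> permutes ?B"
      by (rule AB[OF permutes_compose[OF f(2) tA]]) (simp add: x_def[symmetric])
    have cancel: "\<sigma> \<circ> ?t \<circ> ?t = \<sigma>" "?t \<circ> (?t \<circ> \<rho>) = \<rho>"
      by (simp_all add: fun_eq_iff)
    have "connected_by ?B (\<sigma> \<circ> ?t) (?t \<circ> \<rho>) (unsep \<tau>)"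
      using con connected_by_insert[OF \<sigma>' \<rho>' x \<tau>] by (simp only: cancel)
    hence "((\<sigma> \<circ> ?t, ?t \<circ> \<rho>, \<tau>), x) \<in> trans_fact ?B r \<times> ?B"
      using \<sigma>' \<rho>' \<tau> x f(4) unfolding trans_fact_def factorizations_def
      by (simp only: mem_Collect_eq prod.case comp[OF tt] mem_Sigma_iff)
    moreover have "s = ?f ((\<sigma> \<circ> ?t, ?t \<circ> \<rho>, \<tau>), x)" by (simp only: prod.case cancel seq)
    ultimately show "s \<in> ?f ` (trans_fact ?B r \<times> ?B)" by (rule image_eqI[rotated])
  next
    fix s assume "s \<in> ?f ` (trans_fact ?B r \<times> ?B)"
    then obtain \<sigma> \<rho> \<tau> x where s: "s = (\<sigma> \<circ> transpose x ?d, transpose x ?d \<circ> \<rho>, \<tau>)"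
      and fact: "(\<sigma>, \<rho>, \<tau>) \<in> factorizations ?B r" and con: "connected_by ?B \<sigma> \<rho> (unsep \<tau>)" and x: "x \<in> ?B"
      by (auto simp: trans_fact_def)
    note f = factorizationsD[OF fact]
    let ?t = "transpose x ?d"
    have tt: "?t \<circ> ?t = id" by (simp add: fun_eq_iff)
    have tA: "?t permutes ?A" by (rule permutes_swap_id) (use x in auto)
    have "\<sigma> \<circ> ?t permutes ?A" "?t \<circ> \<rho> permutes ?A"
      by (intro permutes_compose tA permutes_subset[OF _ BA] f)+
    thus "s \<in> ?S"
      using con f(3,4) words connected_by_insert[OF f(1,2) x f(3)]
      unfolding trans_fact_def factorizations_def s
      by (simp only: mem_Collect_eq prod.case comp[OF tt]) blast
  qed
  have inj: "inj_on ?f (trans_fact ?B r \<times> ?B)"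
  proof (rule inj_on_inverseI[where g = "\<lambda>(\<sigma>, \<rho>, \<tau>). ((\<sigma> \<circ> transpose (\<rho> ?d) ?d, transpose (\<rho> ?d) ?d \<circ> \<rho>, \<tau>), \<rho> ?d)"])
    fix p assume p: "p \<in> trans_fact ?B r \<times> ?B"
    obtain \<sigma> \<rho> \<tau> x where peq: "p = ((\<sigma>, \<rho>, \<tau>), x)" by (metis prod.exhaust)
    have "\<rho> permutes ?B" using p by (auto simp: peq dest: trans_factD)
    hence "\<rho> ?d = ?d" by (auto intro: permutes_not_in)
    thus "(case ?f p of (\<sigma>, \<rho>, \<tau>) \<Rightarrow> ((\<sigma> \<circ> transpose (\<rho> ?d) ?d, transpose (\<rho> ?d) ?d \<circ> \<rho>, \<tau>), \<rho> ?d)) = p"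
      by (simp add: peq fun_eq_iff)
  qed
  have "(\<Sum>(\<sigma>, \<rho>, \<tau>)\<in>?S. mon (wt ?A r \<sigma> \<rho>)) =
      (\<Sum>p\<in>trans_fact ?B r \<times> ?B. case p of ((\<sigma>, \<rho>, \<tau>), x) \<Rightarrow> mon (wt ?A r (\<sigma> \<circ> transpose x ?d) (transpose x ?d \<circ> \<rho>)))"
    unfolding im by (subst sum.reindex[OF inj]) (auto intro!: sum.cong)
  also have "\<dots> = (\<Sum>(s, x)\<in>trans_fact ?B r \<times> ?B. case s of (\<sigma>, \<rho>, \<tau>) \<Rightarrow>
      zz * mon (insert_wt (clen \<sigma> x) (clen \<rho> x) (wt ?B r \<sigma> \<rho>)))"
  proof (rule sum.cong[OF refl])
    fix p assume p: "p \<in> trans_fact ?B r \<times> ?B"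
    obtain \<sigma> \<rho> \<tau> x where peq: "p = ((\<sigma>, \<rho>, \<tau>), x)" by (metis prod.exhaust)
    have t: "(\<sigma>, \<rho>, \<tau>) \<in> trans_fact ?B r" and x: "x \<in> ?B" using p by (auto simp: peq)
    show "(case p of ((\<sigma>, \<rho>, \<tau>), x) \<Rightarrow> mon (wt ?A r (\<sigma> \<circ> transpose x ?d) (transpose x ?d \<circ> \<rho>))) =
        (case p of (s, x) \<Rightarrow> case s of (\<sigma>, \<rho>, \<tau>) \<Rightarrow> zz * mon (insert_wt (clen \<sigma> x) (clen \<rho> x) (wt ?B r \<sigma> \<rho>)))"
      unfolding peq prod.case wt_insert[OF trans_factD[OF t] x]
      by (simp add: mps_var_monom mps_monom_mult)
  qed
  also have "\<dots> = (\<Sum>x\<in>?B. zz * nsum ?B r x)"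
    unfolding sum.cartesian_product[symmetric] nsum_def sum_distrib_left
    by (subst sum.swap) (auto intro!: sum.cong)
  \<comment> \<open>The series N only knows marks at the largest label, so each of the n possible
    marks is moved there.\<close>
  also have "\<dots> = (\<Sum>x\<in>?B. zz * nsum ?B r n)"
    by (rule sum.cong[OF refl]) (simp only: nsum_constant)
  finally show ?thesis by (simp add: mult.assoc)
qed

text \<open>A monotone word moves the largest label exactly when its last letter does, which
  separates the two kinds of removal; without letters only the first kind occurs.\<close>

lemma hsum_Suc:
  assumes "n \<ge> 1"
  shows "hsum {1..Suc n} r = of_nat n * zz * nsum {1..n} r n +
    (case r of 0 \<Rightarrow> 0 | Suc r' \<Rightarrow> tt * ksum {1..Suc n} r' (Suc n))"
proof -
  let ?A = "{1..Suc n}"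
  let ?S = "{(\<sigma>, \<rho>, \<tau>) \<in> trans_fact ?A r. \<tau> \<in> words {1..n} r}"
  let ?T = "{(\<sigma>, \<rho>, \<tau>) \<in> trans_fact ?A r. \<tau> \<noteq> [] \<and> snd (last \<tau>) = Suc n}"
  have w: "\<tau> \<in> words {1..n} r \<longleftrightarrow> \<not> (\<tau> \<noteq> [] \<and> snd (last \<tau>) = Suc n)" if "\<tau> \<in> words ?A r" for \<tau>
  proof -
    have "\<tau> \<in> words {1..n} r \<longleftrightarrow> \<tau> \<in> {\<tau> \<in> words ?A r. \<tau> = [] \<or> snd (last \<tau>) \<noteq> Suc n}"
      by (simp only: words_Suc_not_last)
    thus ?thesis using that by simp
  qed
  have "\<tau> \<in> words ?A r" if "(\<sigma>, \<rho>, \<tau>) \<in> trans_fact ?A r" for \<sigma> \<rho> \<tau>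
    using that by (auto simp: trans_fact_def factorizations_def)
  hence un: "trans_fact ?A r = ?S \<union> ?T" "?S \<inter> ?T = {}"
    using w by auto
  have fin: "finite ?S" "finite ?T"
    by (rule finite_subset[of _ "trans_fact ?A r"]; auto)+
  have "hsum ?A r = (\<Sum>(\<sigma>, \<rho>, \<tau>)\<in>?S. mon (wt ?A r \<sigma> \<rho>)) + (\<Sum>(\<sigma>, \<rho>, \<tau>)\<in>?T. mon (wt ?A r \<sigma> \<rho>))"
    unfolding hsum_def by (rule trans[OF arg_cong[OF un(1), of "sum _"] sum.union_disjoint[OF fin un(2)]])
  also have "(\<Sum>(\<sigma>, \<rho>, \<tau>)\<in>?T. mon (wt ?A r \<sigma> \<rho>)) =
      (case r of 0 \<Rightarrow> 0 | Suc r' \<Rightarrow> tt * ksum ?A r' (Suc n))"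
  proof (cases r)
    case 0
    hence T: "?T = {}" by (auto simp: trans_fact_def factorizations_def)
    show ?thesis unfolding T by (simp add: 0)
  next
    case (Suc r')
    have "?T = {(\<sigma>, \<rho>, \<tau>) \<in> trans_fact ?A (Suc r'). snd (last \<tau>) = Suc n}"
      unfolding Suc by (auto simp: trans_fact_def factorizations_def words_def)
    thus ?thesis using sum_last[of n r'] by (simp add: Suc)
  qed
  finally show ?thesis by (simp only: sum_not_last[OF assms])
qed

lemma trans_fact_1: "trans_fact {1..1} r = (if r = 0 then {(id, id, [])} else {})"
proof -
  have "words {1..1} (Suc k) = {}" for k
    by (auto simp: words_def length_Suc_conv)
  moreover have "connected_by {1..1} id id UNIV"
    by (auto simp: connected_by_def)
  moreover have "p permutes {1..1} \<longleftrightarrow> p = id" for p :: "nat \<Rightarrow> nat"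
    by simp
  ultimately show ?thesis
    by (cases r) (auto simp: trans_fact_def factorizations_def simp del: atLeastAtMost_singleton)
qed

text \<open>The only solution on one label has no letters; it is the term z p_1 q_1 that the
  equation subtracts.\<close>

lemma hsum_1: "hsum {1..1} r = (if r = 0 then zz * pp 1 * qq 1 else 0)"
proof -
  have "orbit id (1 :: nat) = {1}" by (simp add: orbit_eq_singleton_iff)
  hence "ctype {1..1} (id :: nat \<Rightarrow> nat) = {#1#}" by (simp add: ctype_def)
  thus ?thesis
    unfolding hsum_def trans_fact_1 by (simp add: wt_def mps_var_monom mps_monom_mult add_mset_commute)
qed

lemma ksum_1: "ksum {1..1} r 1 = 0"
  by (simp add: ksum_def)

section \<open>Cutting and joining\<close>

lemma count_wt_PVar: "count (wt A r \<sigma> \<rho>) (PVar k) = count (ctype A \<sigma>) k"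
proof -
  have "count (image_mset QVar K) (PVar k) = 0" for K
    by (auto simp: count_eq_zero_iff)
  moreover have "count (image_mset PVar K) (PVar k) = count K k" for K
    by (induction K) auto
  ultimately show ?thesis by (simp add: wt_def)
qed

lemma wt_transpose:
  assumes "finite A" "\<sigma> permutes A" "x \<in> A" "y \<in> A" "y \<notin> orbit \<sigma> x"
  shows "wt A r (transpose x y \<circ> \<sigma>) \<rho> =
    add_mset (PVar (clen \<sigma> x + clen \<sigma> y)) (wt A r \<sigma> \<rho> - {#PVar (clen \<sigma> x)#} - {#PVar (clen \<sigma> y)#})"
proof -
  from ctype_join[OF assms] obtain K where
    K: "ctype A \<sigma> = add_mset (clen \<sigma> x) (add_mset (clen \<sigma> y) K)"
      "ctype A (transpose x y \<circ> \<sigma>) = add_mset (clen \<sigma> x + clen \<sigma> y) K" .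
  show ?thesis unfolding wt_def K by simp
qed

text \<open>The derivative brings down the number of cycles of length k, and the factor k turns
  cycles into their points.\<close>

lemma d_p_wt:
  assumes "finite A" "\<sigma> permutes A"
  shows "of_nat k * d_p k (mon (wt A r \<sigma> \<rho>)) =
    (\<Sum>x\<in>{x \<in> A. clen \<sigma> x = k}. mon (wt A r \<sigma> \<rho> - {#PVar k#}))"
  by (simp add: deriv_monom count_wt_PVar count_ctype[OF assms] mps_of_nat_monom mps_monom_mult)

text \<open>The second derivative selects a cycle after one of length j has been removed, so the two
  marked labels lie in different cycles, even when i = j.\<close>

lemma d_p_d_p_wt:
  assumes "finite A" "\<sigma> permutes A"
  shows "of_nat (i * j) * d_p i (d_p j (mon (wt A r \<sigma> \<rho>))) =
    (\<Sum>x\<in>{x \<in> A. clen \<sigma> x = j}. \<Sum>y\<in>{y \<in> A. y \<notin> orbit \<sigma> x \<and> clen \<sigma> y = i}.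
      mon (wt A r \<sigma> \<rho> - {#PVar j#} - {#PVar i#}))"
proof -
  let ?W = "wt A r \<sigma> \<rho>"
  let ?M = "mon (?W - {#PVar j#} - {#PVar i#})"
  have "(\<Sum>y\<in>{y \<in> A. y \<notin> orbit \<sigma> x \<and> clen \<sigma> y = i}. ?M) = of_nat (i * count (ctype A \<sigma> - {#j#}) i) * ?M"
    if "x \<in> {x \<in> A. clen \<sigma> x = j}" for x
  proof -
    have x: "x \<in> A" "clen \<sigma> x = j" using that by auto
    show ?thesis
      using count_ctype_minus[OF assms x(1), of i] by (simp only: sum_constant x(2))
  qed
  hence "(\<Sum>x\<in>{x \<in> A. clen \<sigma> x = j}. \<Sum>y\<in>{y \<in> A. y \<notin> orbit \<sigma> x \<and> clen \<sigma> y = i}. ?M) =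
      (\<Sum>x\<in>{x \<in> A. clen \<sigma> x = j}. of_nat (i * count (ctype A \<sigma> - {#j#}) i) * ?M)"
    by (rule sum.cong[OF refl])
  also have "\<dots> = of_nat (j * count (ctype A \<sigma>) j) * (of_nat (i * count (ctype A \<sigma> - {#j#}) i) * ?M)"
    by (simp only: sum_constant count_ctype[OF assms])
  finally have *: "(\<Sum>x\<in>{x \<in> A. clen \<sigma> x = j}. \<Sum>y\<in>{y \<in> A. y \<notin> orbit \<sigma> x \<and> clen \<sigma> y = i}. ?M) =
      of_nat (j * count (ctype A \<sigma>) j) * (of_nat (i * count (ctype A \<sigma> - {#j#}) i) * ?M)" .
  have "count (ctype A \<sigma> - {#j#}) i = count (?W - {#PVar j#}) (PVar i)"
    by (simp add: count_wt_PVar)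
  hence "d_p i (d_p j (mon ?W)) = of_nat (count (ctype A \<sigma> - {#j#}) i) * (of_nat (count (ctype A \<sigma>) j) * ?M)"
    by (simp only: deriv_monom count_wt_PVar mps_of_nat_monom mps_monom_mult) simp
  thus ?thesis unfolding * by (simp only: of_nat_mult ac_simps)
qed

lemma clen_range:
  assumes "finite A" "\<sigma> permutes A" "x \<in> A"
  shows "clen \<sigma> x \<in> {1..card A}"
  using clen_pos[OF assms(1,2), of x] card_mono[OF assms(1) orbit_in_carrier[OF assms]] by auto

text \<open>Labels x in a cycle of length i + j are counted by (i + j) d/dp_{i+j}; for each of them
  exactly one y leaves i points on the side of x.\<close>

lemma sum_pairs_cut:
  assumes "finite A" "\<sigma> permutes A"
  shows "(\<Sum>x\<in>A. \<Sum>y\<in>orbit \<sigma> x - {x}. mon (wt A r (transpose x y \<circ> \<sigma>) \<rho>)) =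
    (\<Sum>(i, j)\<in>{1..card A} \<times> {1..card A}. of_nat (i + j) * pp i * pp j * d_p (i + j) (mon (wt A r \<sigma> \<rho>)))"
proof -
  let ?W = "wt A r \<sigma> \<rho>" and ?I = "{1..card A} \<times> {1..card A}"
  define g where "g x = (\<lambda>(i, j). pp i * pp j * mon (?W - {#PVar (clen \<sigma> x)#}))" for x
  have cut: "(\<Sum>y\<in>orbit \<sigma> x - {x}. mon (wt A r (transpose x y \<circ> \<sigma>) \<rho>)) = (\<Sum>i\<in>{1..<clen \<sigma> x}. g x (i, clen \<sigma> x - i))"
    if x: "x \<in> A" for x
  proof -
    let ?F = "\<lambda>K. mon (replicate_mset (card A) ZVar + replicate_mset r TVar + image_mset PVar K + image_mset QVar (ctype A \<rho>))"
    obtain K where K: "ctype A \<sigma> = add_mset (clen \<sigma> x) K"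
      using clen_in_ctype[OF assms x] by (metis multi_member_split)
    have "(\<Sum>y\<in>orbit \<sigma> x - {x}. ?F (ctype A (transpose x y \<circ> \<sigma>))) =
        (\<Sum>i\<in>{1..<clen \<sigma> x}. ?F (add_mset i (add_mset (clen \<sigma> x - i) (ctype A \<sigma> - {#clen \<sigma> x#}))))"
      by (rule sum_cut[OF assms x])
    also have "\<dots> = (\<Sum>i\<in>{1..<clen \<sigma> x}. g x (i, clen \<sigma> x - i))"
      by (rule sum.cong[OF refl]) (simp add: g_def wt_def K mps_var_monom mps_monom_mult ac_simps add_mset_commute)
    finally show ?thesis by (simp only: wt_def)
  qed
  have pairs: "(\<Sum>i\<in>{1..<clen \<sigma> x}. g x (i, clen \<sigma> x - i)) = (\<Sum>p\<in>?I. if fst p + snd p = clen \<sigma> x then g x p else 0)"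
    if x: "x \<in> A" for x
  proof -
    have "(\<Sum>p\<in>?I. if fst p + snd p = clen \<sigma> x then g x p else 0) = (\<Sum>p\<in>{p \<in> ?I. fst p + snd p = clen \<sigma> x}. g x p)"
      by (rule sum.inter_filter[symmetric]) simp
    also have "\<dots> = (\<Sum>i\<in>{1..<clen \<sigma> x}. g x (i, clen \<sigma> x - i))"
      by (rule sum.reindex_bij_witness[where i = "\<lambda>i. (i, clen \<sigma> x - i)" and j = fst])
         (use clen_range[OF assms x] in \<open>auto intro!: arg_cong[of _ _ "g x"]\<close>)
    finally show ?thesis ..
  qed
  have "(\<Sum>x\<in>A. \<Sum>y\<in>orbit \<sigma> x - {x}. mon (wt A r (transpose x y \<circ> \<sigma>) \<rho>)) =
      (\<Sum>x\<in>A. \<Sum>p\<in>?I. if fst p + snd p = clen \<sigma> x then g x p else 0)"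
    by (rule sum.cong[OF refl]) (simp only: cut pairs)
  also have "\<dots> = (\<Sum>p\<in>?I. \<Sum>x\<in>A. if fst p + snd p = clen \<sigma> x then g x p else 0)"
    by (rule sum.swap)
  also have "\<dots> = (\<Sum>(i, j)\<in>?I. of_nat (i + j) * pp i * pp j * d_p (i + j) (mon ?W))"
  proof (rule sum.cong[OF refl])
    fix p assume "p \<in> ?I"
    obtain i j where p: "p = (i, j)" by (cases p)
    have "(\<Sum>x\<in>A. if fst p + snd p = clen \<sigma> x then g x p else 0) = (\<Sum>x\<in>A. if clen \<sigma> x = i + j then g x p else 0)"
      by (rule sum.cong) (auto simp: p)
    also have "\<dots> = (\<Sum>x\<in>{x \<in> A. clen \<sigma> x = i + j}. g x p)"
      by (rule sum.inter_filter[symmetric, OF assms(1)])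
    also have "\<dots> = (\<Sum>x\<in>{x \<in> A. clen \<sigma> x = i + j}. pp i * pp j * mon (?W - {#PVar (i + j)#}))"
      by (rule sum.cong) (auto simp: p g_def)
    also have "\<dots> = pp i * pp j * (of_nat (i + j) * d_p (i + j) (mon ?W))"
      unfolding d_p_wt[OF assms] sum_distrib_left ..
    also have "\<dots> = of_nat (i + j) * pp i * pp j * d_p (i + j) (mon ?W)"
      by (simp only: ac_simps)
    finally show "(\<Sum>x\<in>A. if fst p + snd p = clen \<sigma> x then g x p else 0) =
        (case p of (i, j) \<Rightarrow> of_nat (i + j) * pp i * pp j * d_p (i + j) (mon ?W))"
      by (simp only: p prod.case)
  qed
  finally show ?thesis .
qed

text \<open>Pairs of labels in different cycles of lengths j and i are counted by the second
  derivative, and the transposition joins these cycles into one of length i + j.\<close>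

lemma sum_pairs_join:
  assumes "finite A" "\<sigma> permutes A"
  shows "(\<Sum>x\<in>A. \<Sum>y\<in>A - orbit \<sigma> x. mon (wt A r (transpose x y \<circ> \<sigma>) \<rho>)) =
    (\<Sum>(i, j)\<in>{1..card A} \<times> {1..card A}. of_nat (i * j) * pp (i + j) * d_p i (d_p j (mon (wt A r \<sigma> \<rho>))))"
proof -
  let ?W = "wt A r \<sigma> \<rho>" and ?I = "{1..card A}"
  let ?V = "SIGMA x:A. A - orbit \<sigma> x"
  let ?l = "\<lambda>(x, y). (clen \<sigma> y, clen \<sigma> x)"
  define g where "g = (\<lambda>(i, j). pp (i + j) * mon (?W - {#PVar j#} - {#PVar i#}))"
  have fin: "finite ?V" using assms by auto
  have "(\<Sum>x\<in>A. \<Sum>y\<in>A - orbit \<sigma> x. mon (wt A r (transpose x y \<circ> \<sigma>) \<rho>)) = (\<Sum>v\<in>?V. g (?l v))"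
  proof -
    have "mon (wt A r (transpose x y \<circ> \<sigma>) \<rho>) = g (?l (x, y))" if "x \<in> A" "y \<in> A - orbit \<sigma> x" for x y
    proof -
      have "wt A r (transpose x y \<circ> \<sigma>) \<rho> =
          add_mset (PVar (clen \<sigma> x + clen \<sigma> y)) (?W - {#PVar (clen \<sigma> x)#} - {#PVar (clen \<sigma> y)#})"
        by (rule wt_transpose) (use that assms in auto)
      thus ?thesis by (simp add: g_def mps_var_monom mps_monom_mult add.commute add_mset_commute)
    qed
    hence "(\<Sum>x\<in>A. \<Sum>y\<in>A - orbit \<sigma> x. mon (wt A r (transpose x y \<circ> \<sigma>) \<rho>)) =
        (\<Sum>x\<in>A. \<Sum>y\<in>A - orbit \<sigma> x. g (?l (x, y)))"
      by (intro sum.cong refl) blast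
    also have "\<dots> = (\<Sum>(x, y)\<in>?V. g (?l (x, y)))"
      by (rule sum.Sigma) (use assms in auto)
    finally show ?thesis by (simp add: case_prod_beta)
  qed
  also have "\<dots> = (\<Sum>p\<in>?I \<times> ?I. \<Sum>v\<in>{v \<in> ?V. ?l v = p}. g (?l v))"
    by (rule sum.group[symmetric]) (use fin clen_range[OF assms] in auto)
  also have "\<dots> = (\<Sum>(i, j)\<in>?I \<times> ?I. of_nat (i * j) * pp (i + j) * d_p i (d_p j (mon ?W)))"
  proof (rule sum.cong[OF refl])
    fix p assume "p \<in> ?I \<times> ?I"
    obtain i j where p: "p = (i, j)" by (cases p)
    have "(\<Sum>v\<in>{v \<in> ?V. ?l v = p}. g (?l v)) =
        (\<Sum>v\<in>(SIGMA x:{x \<in> A. clen \<sigma> x = j}. {y \<in> A. y \<notin> orbit \<sigma> x \<and> clen \<sigma> y = i}). g p)"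
      by (rule sum.cong) (auto simp: p)
    also have "\<dots> = (\<Sum>x\<in>{x \<in> A. clen \<sigma> x = j}. \<Sum>y\<in>{y \<in> A. y \<notin> orbit \<sigma> x \<and> clen \<sigma> y = i}. g p)"
      by (subst sum.Sigma) (use assms in auto)
    also have "\<dots> = pp (i + j) * (of_nat (i * j) * d_p i (d_p j (mon ?W)))"
      unfolding d_p_d_p_wt[OF assms] sum_distrib_left by (simp only: p g_def prod.case)
    finally show "(\<Sum>v\<in>{v \<in> ?V. ?l v = p}. g (?l v)) =
        (case p of (i, j) \<Rightarrow> of_nat (i * j) * pp (i + j) * d_p i (d_p j (mon ?W)))"
      by (simp only: p prod.case ac_simps)
  qed
  finally show ?thesis .
qed

lemma sum_pairs:
  assumes "finite A" "\<sigma> permutes A"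
  shows "(\<Sum>x\<in>A. \<Sum>y\<in>A - {x}. mon (wt A r (transpose x y \<circ> \<sigma>) \<rho>)) =
    (\<Sum>(i, j)\<in>{1..card A} \<times> {1..card A}.
      of_nat (i + j) * pp i * pp j * d_p (i + j) (mon (wt A r \<sigma> \<rho>)) +
      of_nat (i * j) * pp (i + j) * d_p i (d_p j (mon (wt A r \<sigma> \<rho>))))"
proof -
  have "(\<Sum>y\<in>A - {x}. f y) = (\<Sum>y\<in>orbit \<sigma> x - {x}. f y) + (\<Sum>y\<in>A - orbit \<sigma> x. f y)"
    if "x \<in> A" for x and f :: "nat \<Rightarrow> series"
  proof -
    have "A - {x} = (orbit \<sigma> x - {x}) \<union> (A - orbit \<sigma> x)"
      using orbit_in_carrier[OF assms that] self_in_orbit[OF assms, of x] by auto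
    thus ?thesis
      using finite_orbit_of[OF assms, of x] assms(1) by (simp only:) (rule sum.union_disjoint; auto)
  qed
  hence "(\<Sum>x\<in>A. \<Sum>y\<in>A - {x}. mon (wt A r (transpose x y \<circ> \<sigma>) \<rho>)) =
      (\<Sum>x\<in>A. (\<Sum>y\<in>orbit \<sigma> x - {x}. mon (wt A r (transpose x y \<circ> \<sigma>) \<rho>)) +
        (\<Sum>y\<in>A - orbit \<sigma> x. mon (wt A r (transpose x y \<circ> \<sigma>) \<rho>)))"
    by (intro sum.cong refl) blast
  thus ?thesis
    unfolding sum.distrib sum_pairs_cut[OF assms] sum_pairs_join[OF assms] split_def .
qed

lemma sum_pairs_trans_fact:
  assumes "finite A"
  shows "(\<Sum>(\<sigma>, \<rho>, \<tau>)\<in>trans_fact A r. \<Sum>x\<in>A. \<Sum>y\<in>A - {x}. mon (wt A r (transpose x y \<circ> \<sigma>) \<rho>)) =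
    (\<Sum>(i, j)\<in>{1..card A} \<times> {1..card A}.
      of_nat (i + j) * pp i * pp j * d_p (i + j) (hsum A r) +
      of_nat (i * j) * pp (i + j) * d_p i (d_p j (hsum A r)))"
proof -
  let ?I = "{1..card A} \<times> {1..card A}"
  let ?g = "\<lambda>p f. of_nat (fst p + snd p) * pp (fst p) * pp (snd p) * d_p (fst p + snd p) f +
      of_nat (fst p * snd p) * pp (fst p + snd p) * d_p (fst p) (d_p (snd p) f)"
  have "(\<Sum>(\<sigma>, \<rho>, \<tau>)\<in>trans_fact A r. \<Sum>x\<in>A. \<Sum>y\<in>A - {x}. mon (wt A r (transpose x y \<circ> \<sigma>) \<rho>)) =
      (\<Sum>(\<sigma>, \<rho>, \<tau>)\<in>trans_fact A r. \<Sum>p\<in>?I. ?g p (mon (wt A r \<sigma> \<rho>)))"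
  proof (rule sum.cong[OF refl])
    fix s assume s: "s \<in> trans_fact A r"
    obtain \<sigma> \<rho> \<tau> where seq: "s = (\<sigma>, \<rho>, \<tau>)" by (cases s)
    have "\<sigma> permutes A" using s by (auto simp: seq dest: trans_factD)
    hence "(\<Sum>x\<in>A. \<Sum>y\<in>A - {x}. mon (wt A r (transpose x y \<circ> \<sigma>) \<rho>)) = (\<Sum>p\<in>?I. ?g p (mon (wt A r \<sigma> \<rho>)))"
      using sum_pairs[OF assms, of \<sigma> r \<rho>] unfolding split_def by blast
    thus "(case s of (\<sigma>, \<rho>, \<tau>) \<Rightarrow> \<Sum>x\<in>A. \<Sum>y\<in>A - {x}. mon (wt A r (transpose x y \<circ> \<sigma>) \<rho>)) =
        (case s of (\<sigma>, \<rho>, \<tau>) \<Rightarrow> \<Sum>p\<in>?I. ?g p (mon (wt A r \<sigma> \<rho>)))"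
      unfolding seq prod.case .
  qed
  also have "\<dots> = (\<Sum>p\<in>?I. \<Sum>(\<sigma>, \<rho>, \<tau>)\<in>trans_fact A r. ?g p (mon (wt A r \<sigma> \<rho>)))"
    unfolding split_def by (rule sum.swap)
  also have "\<dots> = (\<Sum>p\<in>?I. ?g p (hsum A r))"
    unfolding hsum_def split_def deriv_linear(3) sum_distrib_left sum.distrib ..
  finally show ?thesis by (simp only: split_def)
qed

text \<open>Solutions with a marked label in a cycle of length i whose factor p_i is deleted: the
  expanded form of i d/dp_i, on which gluing can act.\<close>

definition usum :: "nat set \<Rightarrow> nat \<Rightarrow> nat \<Rightarrow> series" where
  "usum A r i = (\<Sum>((\<sigma>, \<rho>, \<tau>), x)\<in>{p \<in> trans_fact A r \<times> A. clen (fst (fst p)) (snd p) = i}.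
    mon (wt A r \<sigma> \<rho> - {#PVar (clen \<sigma> x)#}))"

lemma usum_eq:
  assumes "finite A"
  shows "of_nat i * d_p i (hsum A r) = usum A r i"
proof -
  have "of_nat i * d_p i (hsum A r) = (\<Sum>s\<in>trans_fact A r. of_nat i * d_p i (mon (wt A r (fst s) (fst (snd s)))))"
    unfolding hsum_def split_def deriv_linear(3) sum_distrib_left ..
  also have "\<dots> = (\<Sum>s\<in>trans_fact A r. \<Sum>x\<in>{x \<in> A. clen (fst s) x = i}.
      mon (wt A r (fst s) (fst (snd s)) - {#PVar (clen (fst s) x)#}))"
  proof (rule sum.cong[OF refl])
    fix s assume s: "s \<in> trans_fact A r"
    have "fst s permutes A" using s by (cases s) (auto dest: trans_factD)
    from d_p_wt[OF assms this] show "of_nat i * d_p i (mon (wt A r (fst s) (fst (snd s)))) =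
        (\<Sum>x\<in>{x \<in> A. clen (fst s) x = i}. mon (wt A r (fst s) (fst (snd s)) - {#PVar (clen (fst s) x)#}))"
      by simp
  qed
  also have "\<dots> = (\<Sum>(s, x)\<in>(SIGMA s:trans_fact A r. {x \<in> A. clen (fst s) x = i}).
      mon (wt A r (fst s) (fst (snd s)) - {#PVar (clen (fst s) x)#}))"
    by (rule sum.Sigma) (use assms in auto)
  also have "\<dots> = usum A r i"
    unfolding usum_def by (rule sum.cong) auto
  finally show ?thesis .
qed

lemma usum_zero:
  assumes "finite A" "i > card A"
  shows "usum A r i = 0"
proof -
  have "{p \<in> trans_fact A r \<times> A. clen (fst (fst p)) (snd p) = i} = {}"
    using clen_range[OF assms(1)] assms(2) by (fastforce dest: trans_factD)
  thus ?thesis unfolding usum_def by (simp only: sum.empty)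
qed

text \<open>The coefficient depends on the two items only through their levels, so the double sum
  factors after grouping by level.\<close>

lemma sum_prod_group:
  fixes w w' :: "_ \<Rightarrow> 'c :: comm_ring_1"
  assumes "finite I" "finite V" "finite V'" "l ` V \<subseteq> I" "l' ` V' \<subseteq> I"
  shows "(\<Sum>(i, j)\<in>I \<times> I. h i j * (\<Sum>v\<in>{v \<in> V. l v = i}. w v) * (\<Sum>v\<in>{v \<in> V'. l' v = j}. w' v)) =
    (\<Sum>v\<in>V. \<Sum>v'\<in>V'. h (l v) (l' v') * w v * w' v')"
proof -
  have prod: "(\<Sum>v\<in>S. \<Sum>v'\<in>S'. c * w v * w' v') = c * sum w S * sum w' S'" for c S S'
  proof -
    have "c * sum w S * sum w' S' = c * (\<Sum>v\<in>S. \<Sum>v'\<in>S'. w v * w' v')"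
      by (simp only: mult.assoc sum_product)
    thus ?thesis by (simp only: sum_distrib_left mult.assoc)
  qed
  have "(\<Sum>v\<in>V. \<Sum>v'\<in>V'. h (l v) (l' v') * w v * w' v') =
      (\<Sum>i\<in>I. \<Sum>v\<in>{v \<in> V. l v = i}. \<Sum>j\<in>I. \<Sum>v'\<in>{v' \<in> V'. l' v' = j}. h (l v) (l' v') * w v * w' v')"
    by (simp only: sum.group[OF assms(3,1,5)] sum.group[OF assms(2,1,4)])
  also have "\<dots> = (\<Sum>i\<in>I. \<Sum>j\<in>I. \<Sum>v\<in>{v \<in> V. l v = i}. \<Sum>v'\<in>{v' \<in> V'. l' v' = j}. h i j * w v * w' v')"
    by (intro sum.cong refl, subst sum.swap, intro sum.cong refl) auto
  also have "\<dots> = (\<Sum>i\<in>I. \<Sum>j\<in>I. h i j * (\<Sum>v\<in>{v \<in> V. l v = i}. w v) * (\<Sum>v\<in>{v \<in> V'. l' v = j}. w' v))"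
    by (simp only: prod)
  finally show ?thesis by (simp add: sum.cartesian_product)
qed

section \<open>Merging two factorizations\<close>

definition relabel ::
    "nat set \<Rightarrow> (nat \<Rightarrow> nat) \<Rightarrow> (nat \<Rightarrow> nat) \<times> (nat \<Rightarrow> nat) \<times> (nat \<times> nat) list \<Rightarrow>
     (nat \<Rightarrow> nat) \<times> (nat \<Rightarrow> nat) \<times> (nat \<times> nat) list" where
  "relabel A f = (\<lambda>(\<sigma>, \<rho>, \<tau>).
    (map_permutation A f \<sigma>, map_permutation A f \<rho>, map (map_prod f f) \<tau>))"

text \<open>An increasing bijection keeps both a < b and the order of second entries, so, unlike a
  general relabelling, it carries monotone words to monotone words.\<close>

lemma relabel_trans_fact:
  assumes bij: "bij_betw f A B" and mono: "\<And>a b. a \<in> A \<Longrightarrow> b \<in> A \<Longrightarrow> a < b \<Longrightarrow> f a < f b"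
    and s: "s \<in> trans_fact A r"
  shows "relabel A f s \<in> trans_fact B r"
proof -
  obtain \<sigma> \<rho> \<tau> where seq: "s = (\<sigma>, \<rho>, \<tau>)" by (cases s)
  have fact: "(\<sigma>, \<rho>, \<tau>) \<in> factorizations A r" and con: "connected_by A \<sigma> \<rho> (unsep \<tau>)"
    using s by (auto simp: seq trans_fact_def)
  note f = factorizationsD[OF fact]
  have inj: "inj_on f A" and im: "f ` A = B" using bij by (auto simp: bij_betw_def)
  let ?\<sigma> = "map_permutation A f \<sigma>" and ?\<rho> = "map_permutation A f \<rho>" and ?\<tau> = "map (map_prod f f) \<tau>"
  have \<tau>A: "\<forall>(a, b)\<in>set \<tau>. a \<in> A \<and> b \<in> A \<and> a < b" and len: "length \<tau> = r" and sorted: "sorted (map snd \<tau>)"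
    using f(3) by (auto simp: words_def)
  have "set \<tau> \<subseteq> A \<times> A" using \<tau>A by auto
  have p\<tau>: "apply_transps \<tau> permutes A"
    by (rule permutes_apply_transps) (use \<tau>A in auto)
  have "map_permutation A f (\<sigma> \<circ> \<rho> \<circ> apply_transps \<tau>) = ?\<sigma> \<circ> ?\<rho> \<circ> apply_transps ?\<tau>"
    unfolding map_permutation_apply_transps[OF inj \<open>set \<tau> \<subseteq> A \<times> A\<close>, symmetric]
    by (simp only: map_permutation_compose'[OF inj p\<tau>] map_permutation_compose'[OF inj f(2)])
  hence prod: "?\<sigma> \<circ> ?\<rho> \<circ> apply_transps ?\<tau> = id"
    unfolding f(4) by (simp only: map_permutation_id'[OF inj])
  have le: "f a \<le> f b" if "a \<in> A" "b \<in> A" "a \<le> b" for a b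
    using mono[of a b] that by (cases "a = b") auto
  have sndA: "b \<in> A" if "(a, b) \<in> set \<tau>" for a b using \<tau>A that by auto
  have "sorted (map snd ?\<tau>)"
  proof -
    have "sorted (map f (map snd \<tau>))"
      unfolding sorted_map
      by (rule sorted_wrt_mono_rel[OF _ sorted]) (use sndA le in auto)
    thus ?thesis by (simp add: comp_def)
  qed
  moreover have "\<forall>(a, b)\<in>set ?\<tau>. a \<in> B \<and> b \<in> B \<and> a < b"
    using \<tau>A mono im by fastforce
  ultimately have "?\<tau> \<in> words B r" using len by (simp add: words_def)
  moreover have "?\<sigma> permutes B" "?\<rho> permutes B"
    using map_permutation_permutes[OF bij] f(1,2) by auto
  moreover have "connected_by B ?\<sigma> ?\<rho> (unsep ?\<tau>)"
    unfolding connected_by_def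
  proof (intro ballI impI)
    fix X assume X: "X \<in> unsep ?\<tau>" "X \<subseteq> B" "?\<sigma> ` X = X" "?\<rho> ` X = X"
    define Y where "Y = {a \<in> A. f a \<in> X}"
    have fY: "X = f ` Y" using X(2) im by (auto simp: Y_def)
    have YA: "Y \<subseteq> A" by (auto simp: Y_def)
    have "p ` Y = Y" if "p permutes A" "map_permutation A f p ` X = X" for p
    proof -
      have "f ` p ` Y = map_permutation A f p ` X"
        unfolding fY image_image
        by (rule image_cong) (use YA map_permutation_apply[OF inj] in auto)
      hence "f ` p ` Y = f ` Y" using that(2) fY by simp
      moreover have "p ` Y \<subseteq> A" using permutes_image[OF that(1)] YA by auto
      ultimately show ?thesis using inj_on_image_eq_iff[OF inj _ YA] by blast
    qed
    hence "\<sigma> ` Y = Y" "\<rho> ` Y = Y" using f(1,2) X(3,4) by auto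
    moreover have "Y \<in> unsep \<tau>"
      unfolding unsep_def
    proof clarify
      fix a b assume ab: "(a, b) \<in> set \<tau>"
      hence "(f a, f b) \<in> set ?\<tau>" by force
      hence "f a \<in> X \<longleftrightarrow> f b \<in> X" using X(1) by (auto simp: unsep_def together_def)
      thus "Y \<in> together a b" using \<tau>A ab by (auto simp: together_def Y_def)
    qed
    ultimately have "Y = {} \<or> Y = A" using con YA unfolding connected_by_def by blast
    thus "X = {} \<or> X = B" using fY im by auto
  qed
  ultimately show ?thesis
    using prod by (simp only: seq relabel_def prod.case trans_fact_def factorizations_def mem_Collect_eq)
qed

lemma relabel_inverse:
  assumes "bij_betw f A B" "\<And>a. a \<in> A \<Longrightarrow> g (f a) = a" "s \<in> trans_fact A r"
  shows "relabel B g (relabel A f s) = s"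
proof -
  obtain \<sigma> \<rho> \<tau> where seq: "s = (\<sigma>, \<rho>, \<tau>)" by (cases s)
  have fact: "(\<sigma>, \<rho>, \<tau>) \<in> factorizations A r" using assms(3) by (auto simp: seq trans_fact_def)
  note f = factorizationsD[OF fact]
  have "map (map_prod g g) (map (map_prod f f) \<tau>) = \<tau>"
    unfolding map_map by (rule map_idI) (use f(3) assms(2) in \<open>auto simp: words_def\<close>)
  thus ?thesis
    unfolding seq relabel_def prod.case
    using map_permutation_compose_inv[OF assms(1) f(1) assms(2)] map_permutation_compose_inv[OF assms(1) f(2) assms(2)]
    by simp
qed

lemma usum_relabel:
  assumes A: "finite A" and bij: "bij_betw f A B" and mono: "\<And>a b. a \<in> A \<Longrightarrow> b \<in> A \<Longrightarrow> a < b \<Longrightarrow> f a < f b"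
  shows "usum A r i = usum B r i"
proof -
  define g where "g = inv_into A f"
  have inj: "inj_on f A" and im: "f ` A = B" using bij by (auto simp: bij_betw_def)
  have gf: "g (f a) = a" if "a \<in> A" for a using inj that by (simp add: g_def)
  have fg: "f (g b) = b" if "b \<in> B" for b using im that by (auto simp: g_def f_inv_into_f)
  have bij': "bij_betw g B A" unfolding g_def by (rule bij_betw_inv_into[OF bij])
  hence gA: "g b \<in> A" if "b \<in> B" for b using that by (auto simp: bij_betw_def)
  have mono': "g a < g b" if "a \<in> B" "b \<in> B" "a < b" for a b
    using mono[of "g b" "g a"] gA fg that by (metis less_asym linorder_neqE_nat)
  have len: "clen (map_permutation A f \<sigma>) (f x) = clen \<sigma> x" if "\<sigma> permutes A" "x \<in> A" for \<sigma> x
    by (rule clen_map[OF bij A that(1) _ that(2)]) (simp add: map_permutation_apply[OF inj])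
  have ct: "ctype B (map_permutation A f \<sigma>) = ctype A \<sigma>" if "\<sigma> permutes A" for \<sigma>
    by (rule ctype_map[OF bij A that(1)]) (simp add: map_permutation_apply[OF inj])
  have card: "card B = card A" using bij_betw_same_card[OF bij] ..
  define j where "j = (\<lambda>(s, x). (relabel A f s, f x))"
  define j' where "j' = (\<lambda>(s, x). (relabel B g s, g x))"
  have perm: "fst s permutes A" if "s \<in> trans_fact A r" for s A r
    using that by (cases s) (auto dest: trans_factD)
  have len_j: "clen (fst (fst (j p))) (snd (j p)) = clen (fst (fst p)) (snd p)" if "p \<in> trans_fact A r \<times> A" for p
    using that perm len by (auto simp: j_def relabel_def split: prod.splits)
  have jB: "j p \<in> trans_fact B r \<times> B" if "p \<in> trans_fact A r \<times> A" for p
    using that relabel_trans_fact[OF bij mono, of _ r] im by (auto simp: j_def)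
  have j'A: "j' p \<in> trans_fact A r \<times> A" if "p \<in> trans_fact B r \<times> B" for p
    using that relabel_trans_fact[OF bij' mono', of _ r] gA by (auto simp: j'_def)
  have j'j: "j' (j p) = p" if "p \<in> trans_fact A r \<times> A" for p
    using that relabel_inverse[OF bij gf, of _ r] gf by (auto simp: j_def j'_def)
  have jj': "j (j' p) = p" if "p \<in> trans_fact B r \<times> B" for p
    using that relabel_inverse[OF bij' fg, of _ r] fg by (auto simp: j_def j'_def)
  show ?thesis
    unfolding usum_def
  proof (rule sum.reindex_bij_witness[where i = j' and j = j])
    fix p assume p: "p \<in> {p \<in> trans_fact A r \<times> A. clen (fst (fst p)) (snd p) = i}"
    show "j' (j p) = p" using p j'j by simp
    show "j p \<in> {p \<in> trans_fact B r \<times> B. clen (fst (fst p)) (snd p) = i}"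
      using p jB[of p] len_j[of p] by simp
    obtain \<sigma> \<rho> \<tau> x where peq: "p = ((\<sigma>, \<rho>, \<tau>), x)" by (metis prod.exhaust)
    have pm: "\<sigma> permutes A" "\<rho> permutes A" "x \<in> A" using p by (auto simp: peq dest: trans_factD)
    have "wt B r (map_permutation A f \<sigma>) (map_permutation A f \<rho>) = wt A r \<sigma> \<rho>"
      by (simp add: wt_def ct pm card)
    thus "(\<lambda>((\<sigma>, \<rho>, \<tau>), x). mon (wt B r \<sigma> \<rho> - {#PVar (clen \<sigma> x)#})) (j p) =
        (\<lambda>((\<sigma>, \<rho>, \<tau>), x). mon (wt A r \<sigma> \<rho> - {#PVar (clen \<sigma> x)#})) p"
      using pm by (simp add: peq j_def relabel_def len)
  next
    fix p assume p: "p \<in> {p \<in> trans_fact B r \<times> B. clen (fst (fst p)) (snd p) = i}"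
    show "j (j' p) = p" using p jj' by simp
    show "j' p \<in> {p \<in> trans_fact A r \<times> A. clen (fst (fst p)) (snd p) = i}"
      using p j'A[of p] len_j[of "j' p"] jj'[of p] by simp
  qed
qed

text \<open>A block of labels is order-isomorphic to an initial segment, so its contribution depends
  on its size only.\<close>

lemma usum_card:
  assumes "finite A"
  shows "usum A r i = usum {1..card A} r i"
proof -
  obtain h where h: "bij_betw h {..<card A} A" "strict_mono_on {..<card A} h"
    using ex_bij_betw_strict_mono_card[OF assms] .
  have "usum {1..card A} r i = usum A r i"
  proof (rule usum_relabel)
    \<comment> \<open>The increasing enumeration \<open>h\<close> starts at 0, the labels at
      1.\<close>
    show "bij_betw (\<lambda>x. h (x - 1)) {1..card A} A"
    proof -
      have "bij_betw (\<lambda>x. x - 1) {1..card A} {..<card A}"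
        by (rule bij_betw_byWitness[where f' = Suc]) auto
      from bij_betw_trans[OF this h(1)] show ?thesis by (simp add: comp_def)
    qed
    show "h (a - 1) < h (b - 1)" if "a \<in> {1..card A}" "b \<in> {1..card A}" "a < b" for a b
      by (rule strict_mono_onD[OF h(2)]) (use that in auto)
  qed simp
  thus ?thesis ..
qed

section \<open>Restriction to an invariant block\<close>

lemma apply_transps_filter:
  assumes "\<forall>(a, b)\<in>set \<tau>. a \<in> B \<longleftrightarrow> b \<in> B" "z \<in> B"
  shows "apply_transps \<tau> z = apply_transps (filter (\<lambda>p. fst p \<in> B) \<tau>) z \<and> apply_transps \<tau> z \<in> B"
  using assms(1)
proof (induction \<tau>)
  case Nil
  show ?case using assms(2) by simp
next
  case (Cons p \<tau>)
  obtain a b where p: "p = (a, b)" by (cases p)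
  have IH: "apply_transps \<tau> z = apply_transps (filter (\<lambda>p. fst p \<in> B) \<tau>) z" "apply_transps \<tau> z \<in> B"
    using Cons by auto
  have ab: "a \<in> B \<longleftrightarrow> b \<in> B" using Cons.prems p by auto
  show ?case
  proof (cases "a \<in> B")
    case True
    thus ?thesis using IH ab by (auto simp: p transpose_def)
  next
    case False
    hence "apply_transps \<tau> z \<noteq> a" "apply_transps \<tau> z \<noteq> b" using IH ab by auto
    hence "transpose a b (apply_transps \<tau> z) = apply_transps \<tau> z" by (simp add: transpose_def)
    thus ?thesis using IH False by (simp add: p)
  qed
qed

lemma apply_transps_word:
  assumes "\<tau> \<in> words A r"
  shows "apply_transps \<tau> permutes A"
  by (rule permutes_apply_transps) (use assms in \<open>auto simp: words_def\<close>)

lemma perm_restrict_permutes: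
  assumes "finite B" "\<sigma> permutes A" "\<sigma> ` B = B"
  shows "perm_restrict \<sigma> B permutes B"
proof (rule bij_imp_permutes)
  have "inj_on \<sigma> B" using permutes_inj[OF assms(2)] by (rule inj_on_subset) simp
  hence "bij_betw \<sigma> B B" using assms(3) by (simp add: bij_betw_def)
  thus "bij_betw (perm_restrict \<sigma> B) B B"
    by (rule bij_betw_cong[THEN iffD1, rotated]) (simp add: perm_restrict_simps)
qed (simp add: perm_restrict_simps)

text \<open>Letters on the other side never move a point of \<open>B\<close>, so on \<open>B\<close>
  the restricted product agrees with the full one.\<close>

lemma restrict_factorization:
  assumes B: "finite B" "B \<in> unsep \<tau>" "\<sigma> ` B = B" "\<rho> ` B = B" and fact: "(\<sigma>, \<rho>, \<tau>) \<in> factorizations A r"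
  defines "\<tau>' \<equiv> filter (\<lambda>p. fst p \<in> B) \<tau>"
  shows "(perm_restrict \<sigma> B, perm_restrict \<rho> B, \<tau>') \<in> factorizations B (length \<tau>')"
proof -
  note f = factorizationsD[OF fact]
  have sep: "\<forall>(a, b)\<in>set \<tau>. a \<in> B \<longleftrightarrow> b \<in> B" using B(2) by (auto simp: unsep_def together_def)
  have "sorted (map snd \<tau>')"
    unfolding \<tau>'_def by (rule sorted_filter) (use f(3) in \<open>auto simp: words_def\<close>)
  hence \<tau>': "\<tau>' \<in> words B (length \<tau>')"
    using f(3) sep by (fastforce simp: words_def \<tau>'_def)
  have "(perm_restrict \<sigma> B \<circ> perm_restrict \<rho> B \<circ> apply_transps \<tau>') z = z" for z
  proof (cases "z \<in> B")
    case True
    have "apply_transps \<tau>' z = apply_transps \<tau> z" "apply_transps \<tau> z \<in> B"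
      using apply_transps_filter[OF sep True] by (auto simp: \<tau>'_def)
    moreover from this(2) have "\<rho> (apply_transps \<tau> z) \<in> B" using B(4) by blast
    ultimately show ?thesis using fun_cong[OF f(4), of z] by (simp add: perm_restrict_simps)
  next
    case False
    hence "apply_transps \<tau>' z = z" by (rule permutes_not_in[OF apply_transps_word[OF \<tau>']])
    thus ?thesis using False by (simp add: perm_restrict_simps)
  qed
  hence "perm_restrict \<sigma> B \<circ> perm_restrict \<rho> B \<circ> apply_transps \<tau>' = id" by (auto simp: fun_eq_iff)
  thus ?thesis
    using \<tau>' perm_restrict_permutes[OF B(1) f(1) B(3)] perm_restrict_permutes[OF B(1) f(2) B(4)]
    by (simp add: factorizations_def)
qed

text \<open>Letters with equal second entry lie on the same side, so stability of the sort restores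
  their order within each group.\<close>

lemma sort_filter_partition:
  assumes "sorted (map snd \<tau>)" "\<forall>(a, b)\<in>set \<tau>. a \<in> B \<longleftrightarrow> b \<in> B"
  shows "sort_key snd (filter (\<lambda>p. fst p \<in> B) \<tau> @ filter (\<lambda>p. fst p \<notin> B) \<tau>) = \<tau>"
proof (rule properties_for_sort_key)
  show "mset \<tau> = mset (filter (\<lambda>p. fst p \<in> B) \<tau> @ filter (\<lambda>p. fst p \<notin> B) \<tau>)"
    by simp
  show "sorted (map snd \<tau>)" by fact
  fix k assume k: "k \<in> set \<tau>"
  show "filter (\<lambda>p. snd k = snd p) \<tau> =
      filter (\<lambda>p. snd k = snd p) (filter (\<lambda>p. fst p \<in> B) \<tau> @ filter (\<lambda>p. fst p \<notin> B) \<tau>)"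
  proof (cases "snd k \<in> B")
    case True
    hence "filter (\<lambda>p. snd k = snd p \<and> fst p \<in> B) \<tau> = filter (\<lambda>p. snd k = snd p) \<tau>"
      "filter (\<lambda>p. snd k = snd p \<and> fst p \<notin> B) \<tau> = []"
      using assms(2) by (auto intro!: filter_cong simp: filter_empty_conv)
    thus ?thesis by (simp add: conj_commute)
  next
    case False
    hence "filter (\<lambda>p. snd k = snd p \<and> fst p \<notin> B) \<tau> = filter (\<lambda>p. snd k = snd p) \<tau>"
      "filter (\<lambda>p. snd k = snd p \<and> fst p \<in> B) \<tau> = []"
      using assms(2) by (auto intro!: filter_cong simp: filter_empty_conv)
    thus ?thesis by (simp add: conj_commute)
  qed
qed

lemma replicate_mset_add: "replicate_mset (m + n) x = replicate_mset m x + replicate_mset n x"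
  by (induction m) auto

text \<open>
  Words over disjoint sets of labels never agree in a second entry, so stably sorting their
  concatenation by second entries is their only monotone merge.
\<close>

definition glue where
  "glue = (\<lambda>(\<sigma>, \<rho>, \<tau>) (\<sigma>', \<rho>', \<tau>'). (\<sigma> \<circ> \<sigma>', \<rho> \<circ> \<rho>', sort_key snd (\<tau> @ \<tau>')))"

text \<open>Connectivity is not assumed: the same setting serves to assemble a tuple from two
  connected ones and to take a given tuple apart.\<close>

locale glued =
  fixes B C :: "nat set" and \<sigma> \<rho> \<tau> r \<sigma>' \<rho>' \<tau>' r'
  assumes fin: "finite B" "finite C" and disj: "B \<inter> C = {}"
    and left: "(\<sigma>, \<rho>, \<tau>) \<in> factorizations B r" and right: "(\<sigma>', \<rho>', \<tau>') \<in> factorizations C r'"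
begin

abbreviation merged where "merged \<equiv> sort_key snd (\<tau> @ \<tau>')"

lemmas l = factorizationsD[OF left]
lemmas r = factorizationsD[OF right]

lemma on_left:
  assumes "z \<in> B"
  shows "(\<sigma> \<circ> \<sigma>') z = \<sigma> z" "(\<rho> \<circ> \<rho>') z = \<rho> z"
proof -
  have "z \<notin> C" using assms disj by auto
  thus "(\<sigma> \<circ> \<sigma>') z = \<sigma> z" "(\<rho> \<circ> \<rho>') z = \<rho> z"
    using permutes_not_in[OF r(1)] permutes_not_in[OF r(2)] by auto
qed

lemma on_right:
  assumes "z \<in> C"
  shows "(\<sigma> \<circ> \<sigma>') z = \<sigma>' z" "(\<rho> \<circ> \<rho>') z = \<rho>' z"
proof -
  have "\<sigma>' z \<in> C" "\<rho>' z \<in> C" using assms permutes_in_image[OF r(1)] permutes_in_image[OF r(2)] by auto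
  hence "\<sigma>' z \<notin> B" "\<rho>' z \<notin> B" using disj by auto
  thus "(\<sigma> \<circ> \<sigma>') z = \<sigma>' z" "(\<rho> \<circ> \<rho>') z = \<rho>' z"
    using permutes_not_in[OF l(1)] permutes_not_in[OF l(2)] by auto
qed

text \<open>Filtering commutes with stable sorting, and each word is sorted already, so the merge
  can be undone.\<close>

lemma filter_merged:
  "filter (\<lambda>p. fst p \<in> B) merged = \<tau>" "filter (\<lambda>p. fst p \<in> C) merged = \<tau>'"
proof -
  have inB: "a \<in> B \<and> a \<notin> C" if "(a, b) \<in> set \<tau>" for a b
    using l(3) disj that by (auto simp: words_def)
  have inC: "a \<in> C \<and> a \<notin> B" if "(a, b) \<in> set \<tau>'" for a b
    using r(3) disj that by (auto simp: words_def)
  have "filter (\<lambda>p. fst p \<in> B) \<tau> = \<tau>" "filter (\<lambda>p. fst p \<in> C) \<tau>' = \<tau>'"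
    by (rule filter_True; use inB inC in auto)+
  moreover have "filter (\<lambda>p. fst p \<in> C) \<tau> = []" "filter (\<lambda>p. fst p \<in> B) \<tau>' = []"
    by (rule filter_False; use inB inC in auto)+
  ultimately have "filter (\<lambda>p. fst p \<in> B) (\<tau> @ \<tau>') = \<tau>" "filter (\<lambda>p. fst p \<in> C) (\<tau> @ \<tau>') = \<tau>'"
    by simp_all
  moreover have "sorted (map snd \<tau>)" "sorted (map snd \<tau>')" using l(3) r(3) by (auto simp: words_def)
  ultimately show "filter (\<lambda>p. fst p \<in> B) merged = \<tau>" "filter (\<lambda>p. fst p \<in> C) merged = \<tau>'"
    unfolding filter_sort by (simp_all add: sort_key_id_if_sorted)
qed

lemma set_merged: "set merged = set \<tau> \<union> set \<tau>'"
  by simp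

lemma unsep_merged: "unsep merged = unsep \<tau> \<inter> unsep \<tau>'"
  unfolding unsep_def set_merged by auto

lemma merged_word: "merged \<in> words (B \<union> C) (r + r')"
proof -
  have "\<forall>(a, b)\<in>set merged. a \<in> B \<union> C \<and> b \<in> B \<union> C \<and> a < b"
    unfolding set_merged using l(3) r(3) by (auto simp: words_def)
  moreover have "length merged = r + r'" using l(3) r(3) by (simp add: words_def)
  moreover have "sorted (map snd merged)" by (rule sorted_sort_key)
  ultimately show ?thesis by (simp only: words_def mem_Collect_eq)
qed

lemma separated: "\<forall>(a, b)\<in>set merged. a \<in> B \<longleftrightarrow> b \<in> B" "\<forall>(a, b)\<in>set merged. a \<in> C \<longleftrightarrow> b \<in> C"
  unfolding set_merged using l(3) r(3) disj by (auto simp: words_def)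

lemma glue_factorization: "(\<sigma> \<circ> \<sigma>', \<rho> \<circ> \<rho>', merged) \<in> factorizations (B \<union> C) (r + r')"
proof -
  have perm: "\<sigma> \<circ> \<sigma>' permutes B \<union> C" "\<rho> \<circ> \<rho>' permutes B \<union> C"
    by (rule permutes_compose; rule permutes_subset[OF l(1)] permutes_subset[OF r(1)]
        permutes_subset[OF l(2)] permutes_subset[OF r(2)]; blast)+
  have "((\<sigma> \<circ> \<sigma>') \<circ> (\<rho> \<circ> \<rho>') \<circ> apply_transps merged) z = z" for z
  proof -
    consider "z \<in> B" | "z \<in> C" | "z \<notin> B \<union> C" by auto
    thus ?thesis
    proof cases
      case 1
      have a: "apply_transps merged z = apply_transps \<tau> z" "apply_transps merged z \<in> B"
        using apply_transps_filter[OF separated(1) 1] unfolding filter_merged by blast+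
      have "\<rho> (apply_transps \<tau> z) \<in> B" by (metis a permutes_in_image[OF l(2)])
      moreover have "((\<sigma> \<circ> \<sigma>') \<circ> (\<rho> \<circ> \<rho>') \<circ> apply_transps merged) z = (\<sigma> \<circ> \<sigma>') ((\<rho> \<circ> \<rho>') (apply_transps merged z))"
        by simp
      ultimately show ?thesis
        using a on_left fun_cong[OF l(4), of z] by (simp del: comp_apply) simp
    next
      case 2
      have a: "apply_transps merged z = apply_transps \<tau>' z" "apply_transps merged z \<in> C"
        using apply_transps_filter[OF separated(2) 2] unfolding filter_merged by blast+
      have "\<rho>' (apply_transps \<tau>' z) \<in> C" by (metis a permutes_in_image[OF r(2)])
      moreover have "((\<sigma> \<circ> \<sigma>') \<circ> (\<rho> \<circ> \<rho>') \<circ> apply_transps merged) z = (\<sigma> \<circ> \<sigma>') ((\<rho> \<circ> \<rho>') (apply_transps merged z))"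
        by simp
      ultimately show ?thesis
        using a on_right fun_cong[OF r(4), of z] by (simp del: comp_apply) simp
    next
      case 3
      hence "apply_transps merged z = z" by (rule permutes_not_in[OF apply_transps_word[OF merged_word]])
      thus ?thesis using permutes_not_in[OF perm(1) 3] permutes_not_in[OF perm(2) 3] by simp
    qed
  qed
  hence "(\<sigma> \<circ> \<sigma>') \<circ> (\<rho> \<circ> \<rho>') \<circ> apply_transps merged = id" by (simp add: fun_eq_iff)
  thus ?thesis using perm merged_word by (simp only: factorizations_def mem_Collect_eq prod.case)
qed

lemma image_left:
  assumes "X \<subseteq> B"
  shows "(\<sigma> \<circ> \<sigma>') ` X = \<sigma> ` X" "(\<rho> \<circ> \<rho>') ` X = \<rho> ` X"
  by (rule image_cong[OF refl]; use assms on_left in blast)+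

lemma image_right:
  assumes "X \<subseteq> C"
  shows "(\<sigma> \<circ> \<sigma>') ` X = \<sigma>' ` X" "(\<rho> \<circ> \<rho>') ` X = \<rho>' ` X"
  by (rule image_cong[OF refl]; use assms on_right in blast)+

lemma unsep_left:
  assumes "X \<subseteq> B"
  shows "X \<in> unsep \<tau>'"
  using assms r(3) disj by (fastforce simp: unsep_def together_def words_def)

lemma unsep_right:
  assumes "X \<subseteq> C"
  shows "X \<in> unsep \<tau>"
  using assms l(3) disj by (fastforce simp: unsep_def together_def words_def)

lemma left_invariant: "(\<sigma> \<circ> \<sigma>') ` B = B" "(\<rho> \<circ> \<rho>') ` B = B" "B \<in> unsep merged"
proof -
  show "(\<sigma> \<circ> \<sigma>') ` B = B" "(\<rho> \<circ> \<rho>') ` B = B"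
    using image_left[of B] permutes_image[OF l(1)] permutes_image[OF l(2)] by simp_all
  have "B \<in> unsep \<tau>" using l(3) by (auto simp: unsep_def together_def words_def)
  thus "B \<in> unsep merged" using unsep_left[of B] by (simp add: unsep_merged)
qed

lemma inter_invariant:
  assumes X: "X \<subseteq> B \<union> C" "X \<in> unsep merged" "(\<sigma> \<circ> \<sigma>') ` X = X" "(\<rho> \<circ> \<rho>') ` X = X"
  shows "\<sigma> ` (X \<inter> B) = X \<inter> B" "\<rho> ` (X \<inter> B) = X \<inter> B" "X \<inter> B \<in> unsep \<tau>"
    and "\<sigma>' ` (X \<inter> C) = X \<inter> C" "\<rho>' ` (X \<inter> C) = X \<inter> C" "X \<inter> C \<in> unsep \<tau>'"
proof -
  note perm = factorizationsD(1,2)[OF glue_factorization]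
  have C: "(\<sigma> \<circ> \<sigma>') ` C = C" "(\<rho> \<circ> \<rho>') ` C = C"
    using image_right[of C] permutes_image[OF r(1)] permutes_image[OF r(2)] by simp_all
  have "(\<sigma> \<circ> \<sigma>') ` (X \<inter> B) = X \<inter> B" "(\<rho> \<circ> \<rho>') ` (X \<inter> B) = X \<inter> B"
    unfolding image_Int[OF permutes_inj[OF perm(1)]] image_Int[OF permutes_inj[OF perm(2)]]
    by (simp_all only: X(3,4) left_invariant)
  thus "\<sigma> ` (X \<inter> B) = X \<inter> B" "\<rho> ` (X \<inter> B) = X \<inter> B" by (simp_all only: image_left Int_lower2)
  have "(\<sigma> \<circ> \<sigma>') ` (X \<inter> C) = X \<inter> C" "(\<rho> \<circ> \<rho>') ` (X \<inter> C) = X \<inter> C"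
    unfolding image_Int[OF permutes_inj[OF perm(1)]] image_Int[OF permutes_inj[OF perm(2)]]
    by (simp_all only: X(3,4) C)
  thus "\<sigma>' ` (X \<inter> C) = X \<inter> C" "\<rho>' ` (X \<inter> C) = X \<inter> C" by (simp_all only: image_right Int_lower2)
  show "X \<inter> B \<in> unsep \<tau>"
    using X(2) l(3) unfolding unsep_merged by (fastforce simp: unsep_def together_def words_def)
  show "X \<inter> C \<in> unsep \<tau>'"
    using X(2) r(3) unfolding unsep_merged by (fastforce simp: unsep_def together_def words_def)
qed

text \<open>If the blocks are connected, the only invariant sets are unions of whole blocks, and the
  edge from x to y excludes a single block. Conversely, a proper nonempty invariant part of a block,
  or else its complement in the block, misses both x and y and violates connectivity of the
  whole.\<close>

lemma connected_iff:
  assumes x: "x \<in> B" and y: "y \<in> C"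
  shows "connected_by (B \<union> C) (\<sigma> \<circ> \<sigma>') (\<rho> \<circ> \<rho>') (unsep merged \<inter> together x y) \<longleftrightarrow>
    connected_by B \<sigma> \<rho> (unsep \<tau>) \<and> connected_by C \<sigma>' \<rho>' (unsep \<tau>')"
proof
  assume c: "connected_by B \<sigma> \<rho> (unsep \<tau>) \<and> connected_by C \<sigma>' \<rho>' (unsep \<tau>')"
  show "connected_by (B \<union> C) (\<sigma> \<circ> \<sigma>') (\<rho> \<circ> \<rho>') (unsep merged \<inter> together x y)"
    unfolding connected_by_def
  proof (intro ballI impI)
    fix X assume X: "X \<in> unsep merged \<inter> together x y" "X \<subseteq> B \<union> C" "(\<sigma> \<circ> \<sigma>') ` X = X" "(\<rho> \<circ> \<rho>') ` X = X"
    note i = inter_invariant[OF X(2) _ X(3,4)]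
    have "X \<inter> B = {} \<or> X \<inter> B = B" "X \<inter> C = {} \<or> X \<inter> C = C"
      using c i X(1) unfolding connected_by_def by (metis IntD1 Int_lower2)+
    moreover have "x \<in> X \<longleftrightarrow> y \<in> X" using X(1) by (auto simp: together_def)
    ultimately show "X = {} \<or> X = B \<union> C" using x y X(2) by blast
  qed
next
  assume c: "connected_by (B \<union> C) (\<sigma> \<circ> \<sigma>') (\<rho> \<circ> \<rho>') (unsep merged \<inter> together x y)"
  \<comment> \<open>A set missing both x and y belongs to \<open>together x y\<close>; this is
    applied to an invariant part of a block or to its complement within the block.\<close>
  have key: "X = {}" if "X \<subseteq> B \<union> C" "X \<in> unsep merged" "(\<sigma> \<circ> \<sigma>') ` X = X" "(\<rho> \<circ> \<rho>') ` X = X" "x \<notin> X" "y \<notin> X" for X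
  proof -
    have "X \<in> unsep merged \<inter> together x y" using that by (auto simp: together_def)
    hence "X = {} \<or> X = B \<union> C" using c that unfolding connected_by_def by blast
    thus ?thesis using that(5) x by blast
  qed
  have "X = {} \<or> X = B" if X: "X \<in> unsep \<tau>" "X \<subseteq> B" "\<sigma> ` X = X" "\<rho> ` X = X" for X
  proof (cases "x \<in> X")
    case True
    have "B - X = {}"
    proof (rule key)
      have "\<sigma> ` (B - X) = B - X" "\<rho> ` (B - X) = B - X"
        using permutes_image[OF l(1)] permutes_image[OF l(2)] X(3,4)
        by (simp_all add: image_set_diff permutes_inj[OF l(1)] permutes_inj[OF l(2)])
      thus "(\<sigma> \<circ> \<sigma>') ` (B - X) = B - X" "(\<rho> \<circ> \<rho>') ` (B - X) = B - X"
        using image_left[of "B - X"] by simp_all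
      have "B - X \<in> unsep \<tau>" using X(1) l(3) by (fastforce simp: unsep_def together_def words_def)
      thus "B - X \<in> unsep merged" using unsep_left[of "B - X"] by (simp add: unsep_merged)
    qed (use True y disj in auto)
    thus ?thesis using X(2) by blast
  next
    case False
    have "X = {}"
      by (rule key) (use X False y disj image_left[OF X(2)] unsep_left[OF X(2)] in \<open>auto simp: unsep_merged\<close>)
    thus ?thesis ..
  qed
  moreover have "X = {} \<or> X = C" if X: "X \<in> unsep \<tau>'" "X \<subseteq> C" "\<sigma>' ` X = X" "\<rho>' ` X = X" for X
  proof (cases "y \<in> X")
    case True
    have "C - X = {}"
    proof (rule key)
      have "\<sigma>' ` (C - X) = C - X" "\<rho>' ` (C - X) = C - X"
        using permutes_image[OF r(1)] permutes_image[OF r(2)] X(3,4)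
        by (simp_all add: image_set_diff permutes_inj[OF r(1)] permutes_inj[OF r(2)])
      thus "(\<sigma> \<circ> \<sigma>') ` (C - X) = C - X" "(\<rho> \<circ> \<rho>') ` (C - X) = C - X"
        using image_right[of "C - X"] by simp_all
      have "C - X \<in> unsep \<tau>'" using X(1) r(3) by (fastforce simp: unsep_def together_def words_def)
      thus "C - X \<in> unsep merged" using unsep_right[of "C - X"] by (simp add: unsep_merged)
    qed (use True x disj in auto)
    thus ?thesis using X(2) by blast
  next
    case False
    have "X = {}"
      by (rule key) (use X False x disj image_right[OF X(2)] unsep_right[OF X(2)] in \<open>auto simp: unsep_merged\<close>)
    thus ?thesis ..
  qed
  ultimately show "connected_by B \<sigma> \<rho> (unsep \<tau>) \<and> connected_by C \<sigma>' \<rho>' (unsep \<tau>')"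
    unfolding connected_by_def by blast
qed

lemma restrict_glued:
  "perm_restrict (\<sigma> \<circ> \<sigma>') B = \<sigma>" "perm_restrict (\<rho> \<circ> \<rho>') B = \<rho>"
  "perm_restrict (\<sigma> \<circ> \<sigma>') C = \<sigma>'" "perm_restrict (\<rho> \<circ> \<rho>') C = \<rho>'"
proof -
  show "perm_restrict (\<sigma> \<circ> \<sigma>') B = \<sigma>" "perm_restrict (\<rho> \<circ> \<rho>') B = \<rho>"
    using on_left l(1,2) permutes_not_in by (fastforce simp: fun_eq_iff perm_restrict_def)+
  show "perm_restrict (\<sigma> \<circ> \<sigma>') C = \<sigma>'" "perm_restrict (\<rho> \<circ> \<rho>') C = \<rho>'"
    using on_right r(1,2) permutes_not_in by (fastforce simp: fun_eq_iff perm_restrict_def)+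
qed

lemma wt_glued:
  "wt (B \<union> C) (r + r') (\<sigma> \<circ> \<sigma>') (\<rho> \<circ> \<rho>') = wt B r \<sigma> \<rho> + wt C r' \<sigma>' \<rho>'"
proof -
  have "ctype (B \<union> C) (\<sigma> \<circ> \<sigma>') = ctype B \<sigma> + ctype C \<sigma>'"
    by (rule ctype_Un[OF fin disj l(1) r(1)]) (use on_left on_right in blast)+
  moreover have "ctype (B \<union> C) (\<rho> \<circ> \<rho>') = ctype B \<rho> + ctype C \<rho>'"
    by (rule ctype_Un[OF fin disj l(2) r(2)]) (use on_left on_right in blast)+
  moreover have "card (B \<union> C) = card B + card C" by (rule card_Un_disjoint[OF fin disj])
  ultimately show ?thesis by (simp add: wt_def replicate_mset_add ac_simps)
qed

lemma orbit_glued: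
  "x \<in> B \<Longrightarrow> orbit (\<sigma> \<circ> \<sigma>') x = orbit \<sigma> x" "y \<in> C \<Longrightarrow> orbit (\<sigma> \<circ> \<sigma>') y = orbit \<sigma>' y"
  by (rule orbit_agree[OF fin(1) l(1)], use on_left in blast, assumption)
     (rule orbit_agree[OF fin(2) r(1)], use on_right in blast, assumption)

end

section \<open>The join-cut equation\<close>

text \<open>The two labels are in different cycles, so the transposition joins these: one p factor
  is lost on each side, and the one for the sum of the lengths is gained.\<close>

lemma (in glued) wt_transpose_glued:
  assumes x: "x \<in> B" and y: "y \<in> C"
  shows "mon (wt (B \<union> C) (r + r') (transpose x y \<circ> (\<sigma> \<circ> \<sigma>')) (\<rho> \<circ> \<rho>')) =
    pp (clen \<sigma> x + clen \<sigma>' y) * mon (wt B r \<sigma> \<rho> - {#PVar (clen \<sigma> x)#}) * mon (wt C r' \<sigma>' \<rho>' - {#PVar (clen \<sigma>' y)#})"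
proof -
  have "y \<notin> orbit (\<sigma> \<circ> \<sigma>') x"
    using orbit_glued(1)[OF x] orbit_in_carrier[OF fin(1) l(1) x] y disj by auto
  hence eq: "wt (B \<union> C) (r + r') (transpose x y \<circ> (\<sigma> \<circ> \<sigma>')) (\<rho> \<circ> \<rho>') =
      add_mset (PVar (clen \<sigma> x + clen \<sigma>' y)) (wt B r \<sigma> \<rho> + wt C r' \<sigma>' \<rho>' - {#PVar (clen \<sigma> x)#} - {#PVar (clen \<sigma>' y)#})"
    using wt_transpose[OF _ factorizationsD(1)[OF glue_factorization], of x y "r + r'" "\<rho> \<circ> \<rho>'"] fin x y
    by (simp add: orbit_glued wt_glued)
  have mem: "PVar (clen p z) \<in># wt A k p q" if "finite A" "p permutes A" "z \<in> A" for A k p q z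
    using clen_in_ctype[OF that] by (simp add: wt_def)
  obtain K where K: "wt B r \<sigma> \<rho> = add_mset (PVar (clen \<sigma> x)) K"
    using mem[OF fin(1) l(1) x] by (metis multi_member_split)
  obtain L where L: "wt C r' \<sigma>' \<rho>' = add_mset (PVar (clen \<sigma>' y)) L"
    using mem[OF fin(2) r(1) y] by (metis multi_member_split)
  show ?thesis
    unfolding eq K L by (simp add: mps_var_monom mps_monom_mult)
qed

section \<open>Decomposition of a tuple that one edge makes connected\<close>

lemma image_complement:
  assumes "p permutes A" "p ` X = X"
  shows "p ` (A - X) = A - X"
  by (simp add: image_set_diff permutes_inj[OF assms(1)] permutes_image[OF assms(1)] assms(2))

lemma unsep_complement:
  assumes "\<tau> \<in> words A r" "X \<in> unsep \<tau>"
  shows "A - X \<in> unsep \<tau>"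
  using assms by (fastforce simp: unsep_def together_def words_def)

lemma perm_restrict_complement:
  assumes "\<sigma> permutes A" "B \<subseteq> A" "\<sigma> ` B = B"
  shows "perm_restrict \<sigma> B \<circ> perm_restrict \<sigma> (A - B) = \<sigma>"
proof
  fix z
  have "\<sigma> z \<in> A - B" if "z \<in> A - B"
    using image_complement[OF assms(1,3)] that by blast
  thus "(perm_restrict \<sigma> B \<circ> perm_restrict \<sigma> (A - B)) z = \<sigma> z"
    using permutes_not_in[OF assms(1), of z] assms(2) by (auto simp: perm_restrict_def)
qed

lemma connected_by_subset:
  "connected_by A \<sigma> \<rho> J \<Longrightarrow> J' \<subseteq> J \<Longrightarrow> connected_by A \<sigma> \<rho> J'"
  unfolding connected_by_def by blast

text \<open>The smallest invariant union of components around x. It recovers the block of x from a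
  glued tuple and so makes the gluing injective.\<close>

definition component :: "nat set \<Rightarrow> (nat \<Rightarrow> nat) \<Rightarrow> (nat \<Rightarrow> nat) \<Rightarrow> nat set set \<Rightarrow> nat \<Rightarrow> nat set" where
  "component A \<sigma> \<rho> J x = \<Inter>{X \<in> J. X \<subseteq> A \<and> \<sigma> ` X = X \<and> \<rho> ` X = X \<and> x \<in> X}"

lemma (in glued) component_glued:
  assumes "connected_by B \<sigma> \<rho> (unsep \<tau>)" "x \<in> B"
  shows "component (B \<union> C) (\<sigma> \<circ> \<sigma>') (\<rho> \<circ> \<rho>') (unsep merged) x = B"
proof (rule antisym)
  show "component (B \<union> C) (\<sigma> \<circ> \<sigma>') (\<rho> \<circ> \<rho>') (unsep merged) x \<subseteq> B"
    unfolding component_def by (rule Inter_lower) (use left_invariant assms(2) in simp)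
  show "B \<subseteq> component (B \<union> C) (\<sigma> \<circ> \<sigma>') (\<rho> \<circ> \<rho>') (unsep merged) x"
    unfolding component_def
  proof (rule Inter_greatest)
    fix X assume "X \<in> {X \<in> unsep merged. X \<subseteq> B \<union> C \<and> (\<sigma> \<circ> \<sigma>') ` X = X \<and> (\<rho> \<circ> \<rho>') ` X = X \<and> x \<in> X}"
    hence X: "X \<in> unsep merged" "X \<subseteq> B \<union> C" "(\<sigma> \<circ> \<sigma>') ` X = X" "(\<rho> \<circ> \<rho>') ` X = X" "x \<in> X" by auto
    note i = inter_invariant[OF X(2,1,3,4)]
    have "X \<inter> B = {} \<or> X \<inter> B = B"
      using assms(1) i(1-3) unfolding connected_by_def by (metis Int_lower2)
    thus "B \<subseteq> X" using assms(2) X(5) by blast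
  qed
qed

lemma trans_fact_iff:
  "(\<sigma>, \<rho>, \<tau>) \<in> trans_fact A r \<longleftrightarrow> (\<sigma>, \<rho>, \<tau>) \<in> factorizations A r \<and> connected_by A \<sigma> \<rho> (unsep \<tau>)"
  by (simp add: trans_fact_def)

text \<open>The disconnected case of \<open>ksum\<close>: such tuples have exactly two blocks, one
  around x and one around y.\<close>

definition joinable where
  "joinable A r = {((\<sigma>, \<rho>, \<tau>), x, y). (\<sigma>, \<rho>, \<tau>) \<in> factorizations A r \<and> x \<in> A \<and> y \<in> A \<and>
    connected_by A \<sigma> \<rho> (unsep \<tau> \<inter> together x y) \<and> \<not> connected_by A \<sigma> \<rho> (unsep \<tau>)}"

text \<open>\<open>B\<close> is the block of x, so the ordered pair (x, y) orders the two blocks and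
  nothing is counted twice; k is the number of letters on the side of x.\<close>

definition glue_data where
  "glue_data A r = (SIGMA B:Pow A. SIGMA k:{..r}. SIGMA s:trans_fact B k.
     SIGMA s':trans_fact (A - B) (r - k). B \<times> (A - B))"

definition glue_map where
  "glue_map = (\<lambda>(B :: nat set, k :: nat, s, s', x :: nat, y :: nat). (glue s s', x, y))"

lemma glue_dataE:
  assumes "u \<in> glue_data A r" "finite A"
  obtains B k \<sigma> \<rho> \<tau> \<sigma>' \<rho>' \<tau>' x y where "u = (B, k, (\<sigma>, \<rho>, \<tau>), (\<sigma>', \<rho>', \<tau>'), x, y)"
    "B \<subseteq> A" "k \<le> r" "(\<sigma>, \<rho>, \<tau>) \<in> trans_fact B k" "(\<sigma>', \<rho>', \<tau>') \<in> trans_fact (A - B) (r - k)"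
    "x \<in> B" "y \<in> A - B" "glued B (A - B) \<sigma> \<rho> \<tau> k \<sigma>' \<rho>' \<tau>' (r - k)"
proof -
  obtain B k s s' x y where u: "u = (B, k, s, s', x, y)" by (metis prod.exhaust)
  obtain \<sigma> \<rho> \<tau> where s: "s = (\<sigma>, \<rho>, \<tau>)" by (cases s)
  obtain \<sigma>' \<rho>' \<tau>' where s': "s' = (\<sigma>', \<rho>', \<tau>')" by (cases s')
  have m: "B \<subseteq> A" "k \<le> r" "s \<in> trans_fact B k" "s' \<in> trans_fact (A - B) (r - k)" "x \<in> B" "y \<in> A - B"
    using assms(1) by (auto simp: u glue_data_def)
  have "glued B (A - B) \<sigma> \<rho> \<tau> k \<sigma>' \<rho>' \<tau>' (r - k)"
    using m assms(2) by unfold_locales (auto simp: s s' trans_fact_iff finite_subset)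
  thus ?thesis using that u s s' m by blast
qed

text \<open>A proper nonempty invariant set must separate x from y, since otherwise it would survive
  the added edge. Its side containing x is the block \<open>B\<close>, and restricting to both sides
  undoes the gluing.\<close>

lemma glue_map_image:
  assumes "finite A"
  shows "glue_map ` glue_data A r = joinable A r"
proof (intro equalityI subsetI)
  fix t assume "t \<in> glue_map ` glue_data A r"
  then obtain u where u: "u \<in> glue_data A r" "t = glue_map u" by auto
  from glue_dataE[OF u(1) assms] obtain B k \<sigma> \<rho> \<tau> \<sigma>' \<rho>' \<tau>' x y where
    ueq: "u = (B, k, (\<sigma>, \<rho>, \<tau>), (\<sigma>', \<rho>', \<tau>'), x, y)" and
    m: "B \<subseteq> A" "k \<le> r" "(\<sigma>, \<rho>, \<tau>) \<in> trans_fact B k" "(\<sigma>', \<rho>', \<tau>') \<in> trans_fact (A - B) (r - k)"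
      "x \<in> B" "y \<in> A - B" and "glued B (A - B) \<sigma> \<rho> \<tau> k \<sigma>' \<rho>' \<tau>' (r - k)" .
  then interpret glued B "A - B" \<sigma> \<rho> \<tau> k \<sigma>' \<rho>' \<tau>' "r - k" by simp
  have A: "B \<union> (A - B) = A" "k + (r - k) = r" using m by auto
  have "(\<sigma> \<circ> \<sigma>', \<rho> \<circ> \<rho>', merged) \<in> factorizations A r" using glue_factorization by (simp only: A)
  moreover have "connected_by A (\<sigma> \<circ> \<sigma>') (\<rho> \<circ> \<rho>') (unsep merged \<inter> together x y)"
    using connected_iff[OF m(5,6)] m(3,4) by (simp only: A trans_fact_iff)
  moreover have "\<not> connected_by A (\<sigma> \<circ> \<sigma>') (\<rho> \<circ> \<rho>') (unsep merged)"
  proof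
    assume "connected_by A (\<sigma> \<circ> \<sigma>') (\<rho> \<circ> \<rho>') (unsep merged)"
    hence "B = {} \<or> B = A" using left_invariant m(1) unfolding connected_by_def by blast
    thus False using m(5,6) by blast
  qed
  ultimately show "t \<in> joinable A r"
    using m by (simp only: u(2) ueq glue_map_def glue_def prod.case joinable_def mem_Collect_eq) blast
next
  fix t assume "t \<in> joinable A r"
  then obtain \<sigma> \<rho> \<tau> x y where t: "t = ((\<sigma>, \<rho>, \<tau>), x, y)" and fact: "(\<sigma>, \<rho>, \<tau>) \<in> factorizations A r"
    and xy: "x \<in> A" "y \<in> A" and con: "connected_by A \<sigma> \<rho> (unsep \<tau> \<inter> together x y)"
    and ncon: "\<not> connected_by A \<sigma> \<rho> (unsep \<tau>)"
    by (auto simp: joinable_def)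
  note f = factorizationsD[OF fact]
  from ncon obtain X where X: "X \<in> unsep \<tau>" "X \<subseteq> A" "\<sigma> ` X = X" "\<rho> ` X = X" "X \<noteq> {}" "X \<noteq> A"
    unfolding connected_by_def by blast
  have sep: "\<not> (x \<in> X \<longleftrightarrow> y \<in> X)"
  proof
    assume "x \<in> X \<longleftrightarrow> y \<in> X"
    hence "X \<in> unsep \<tau> \<inter> together x y" using X(1) by (simp add: together_def)
    thus False using con X unfolding connected_by_def by blast
  qed
  define B where "B = (if x \<in> X then X else A - X)"
  have B: "B \<in> unsep \<tau>" "B \<subseteq> A" "\<sigma> ` B = B" "\<rho> ` B = B" "x \<in> B" "y \<in> A - B"
    using X sep xy unsep_complement[OF f(3) X(1)] image_complement[OF f(1) X(3)] image_complement[OF f(2) X(4)]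
    by (auto simp: B_def)
  let ?C = "A - B"
  have C: "?C \<in> unsep \<tau>" "\<sigma> ` ?C = ?C" "\<rho> ` ?C = ?C"
    by (rule unsep_complement[OF f(3) B(1)] image_complement[OF f(1) B(3)] image_complement[OF f(2) B(4)])+
  let ?l = "filter (\<lambda>p. fst p \<in> B) \<tau>" and ?r = "filter (\<lambda>p. fst p \<in> ?C) \<tau>"
  have r_eq: "?r = filter (\<lambda>p. fst p \<notin> B) \<tau>"
    using f(3) by (auto intro!: filter_cong simp: words_def)
  have len: "length ?l + length ?r = r"
    unfolding r_eq using sum_length_filter_compl[of "\<lambda>p. fst p \<in> B" \<tau>] f(3) by (simp add: words_def)
  have fin: "finite B" "finite ?C" using assms B(2) finite_subset by auto
  interpret glued B ?C "perm_restrict \<sigma> B" "perm_restrict \<rho> B" ?l "length ?l"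
      "perm_restrict \<sigma> ?C" "perm_restrict \<rho> ?C" ?r "length ?r"
    by unfold_locales
      (use fin restrict_factorization[OF fin(1) B(1,3,4) fact] restrict_factorization[OF fin(2) C fact] in auto)
  have merged_eq: "merged = \<tau>"
    unfolding r_eq by (rule sort_filter_partition) (use f(3) B(1) in \<open>auto simp: words_def unsep_def together_def\<close>)
  have perm_eq: "perm_restrict \<sigma> B \<circ> perm_restrict \<sigma> ?C = \<sigma>" "perm_restrict \<rho> B \<circ> perm_restrict \<rho> ?C = \<rho>"
    by (rule perm_restrict_complement[OF f(1) B(2,3)] perm_restrict_complement[OF f(2) B(2,4)])+
  have "B \<union> ?C = A" using B(2) by auto
  hence "connected_by B (perm_restrict \<sigma> B) (perm_restrict \<rho> B) (unsep ?l) \<and>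
      connected_by ?C (perm_restrict \<sigma> ?C) (perm_restrict \<rho> ?C) (unsep ?r)"
    using connected_iff[OF B(5,6)] con by (simp only: merged_eq perm_eq)
  moreover have len_r: "length ?r = r - length ?l" using len by simp
  ultimately have trans: "(perm_restrict \<sigma> B, perm_restrict \<rho> B, ?l) \<in> trans_fact B (length ?l)"
    "(perm_restrict \<sigma> ?C, perm_restrict \<rho> ?C, ?r) \<in> trans_fact ?C (r - length ?l)"
    using left right by (simp_all only: trans_fact_iff)
  have "length ?l \<le> r" using len by linarith
  hence "(B, length ?l, (perm_restrict \<sigma> B, perm_restrict \<rho> B, ?l), (perm_restrict \<sigma> ?C, perm_restrict \<rho> ?C, ?r), x, y)
      \<in> glue_data A r"
    unfolding glue_data_def using B(2,5,6) trans by (intro SigmaI) simp_all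
  moreover have "t = glue_map (B, length ?l, (perm_restrict \<sigma> B, perm_restrict \<rho> B, ?l), (perm_restrict \<sigma> ?C, perm_restrict \<rho> ?C, ?r), x, y)"
    by (simp only: t glue_map_def glue_def prod.case merged_eq perm_eq)
  ultimately show "t \<in> glue_map ` glue_data A r" by (rule image_eqI[rotated])
qed

text \<open>The left inverse takes the component of x as \<open>B\<close>, restricts the
  permutations and filters the merged word.\<close>

lemma glue_map_inj:
  assumes "finite A"
  shows "inj_on glue_map (glue_data A r)"
proof -
  let ?g = "\<lambda>((\<sigma>, \<rho>, \<tau>), x, y). let B = component A \<sigma> \<rho> (unsep \<tau>) x; C = A - B; \<tau>1 = filter (\<lambda>p. fst p \<in> B) \<tau>
    in (B, length \<tau>1, (perm_restrict \<sigma> B, perm_restrict \<rho> B, \<tau>1),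
        (perm_restrict \<sigma> C, perm_restrict \<rho> C, filter (\<lambda>p. fst p \<in> C) \<tau>), x, y)"
  show ?thesis
  proof (rule inj_on_inverseI[where g = ?g])
    fix u assume u: "u \<in> glue_data A r"
    from glue_dataE[OF u assms] obtain B k \<sigma> \<rho> \<tau> \<sigma>' \<rho>' \<tau>' x y where
      ueq: "u = (B, k, (\<sigma>, \<rho>, \<tau>), (\<sigma>', \<rho>', \<tau>'), x, y)" and
      m: "B \<subseteq> A" "k \<le> r" "(\<sigma>, \<rho>, \<tau>) \<in> trans_fact B k" "(\<sigma>', \<rho>', \<tau>') \<in> trans_fact (A - B) (r - k)"
        "x \<in> B" "y \<in> A - B" and "glued B (A - B) \<sigma> \<rho> \<tau> k \<sigma>' \<rho>' \<tau>' (r - k)" .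
    then interpret glued B "A - B" \<sigma> \<rho> \<tau> k \<sigma>' \<rho>' \<tau>' "r - k" by simp
    have A: "B \<union> (A - B) = A" using m by auto
    have "component A (\<sigma> \<circ> \<sigma>') (\<rho> \<circ> \<rho>') (unsep merged) x = B"
      using component_glued[OF _ m(5)] m(3) by (simp only: A trans_fact_iff)
    moreover have "length \<tau> = k" using l(3) by (simp add: words_def)
    ultimately show "?g (glue_map u) = u"
      by (simp only: ueq glue_map_def glue_def prod.case Let_def filter_merged restrict_glued)
  qed
qed

text \<open>Blocks enter only through their sizes, so the choices of \<open>B\<close> with k labels
  give a binomial coefficient. This is the product rule for exponential generating series, and it
  will become the product of first derivatives.\<close>

lemma sum_joinable:
  assumes "finite A"
  shows "(\<Sum>((\<sigma>, \<rho>, \<tau>), x, y)\<in>joinable A r. mon (wt A r (transpose x y \<circ> \<sigma>) \<rho>)) =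
    (\<Sum>(i, j)\<in>{1..card A} \<times> {1..card A}. pp (i + j) *
      (\<Sum>k\<le>card A. \<Sum>r'\<le>r. of_nat (card A choose k) * (usum {1..k} r' i * usum {1..card A - k} (r - r') j)))"
proof -
  let ?I = "{1..card A}"
  let ?l = "\<lambda>v :: ((nat \<Rightarrow> nat) \<times> (nat \<Rightarrow> nat) \<times> (nat \<times> nat) list) \<times> nat. clen (fst (fst v)) (snd v)"
  define w where "w B k = (\<lambda>((\<sigma>, \<rho>, \<tau> :: (nat \<times> nat) list), x). mon (wt B k \<sigma> \<rho> - {#PVar (clen \<sigma> x)#}))" for B k
  have usum_w: "usum B k i = (\<Sum>v\<in>{v \<in> trans_fact B k \<times> B. ?l v = i}. w B k v)" for B k i
    by (simp only: usum_def w_def)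
  define h where "h B k s s' x y = pp (?l (s, x) + ?l (s', y)) * w B k (s, x) * w (A - B) (r - k) (s', y)"
    for B k s s' x y
  have "(\<Sum>((\<sigma>, \<rho>, \<tau>), x, y)\<in>joinable A r. mon (wt A r (transpose x y \<circ> \<sigma>) \<rho>)) =
      (\<Sum>u\<in>glue_data A r. (\<lambda>((\<sigma>, \<rho>, \<tau>), x, y). mon (wt A r (transpose x y \<circ> \<sigma>) \<rho>)) (glue_map u))"
    unfolding glue_map_image[OF assms, symmetric]
    by (subst sum.reindex[OF glue_map_inj[OF assms]]) (simp only: o_def)
  also have "\<dots> = (\<Sum>(B, k, s, s', x, y)\<in>glue_data A r. h B k s s' x y)"
  proof (rule sum.cong[OF refl])
    fix u assume u: "u \<in> glue_data A r"
    from glue_dataE[OF u assms] obtain B k \<sigma> \<rho> \<tau> \<sigma>' \<rho>' \<tau>' x y where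
      ueq: "u = (B, k, (\<sigma>, \<rho>, \<tau>), (\<sigma>', \<rho>', \<tau>'), x, y)" and
      m: "B \<subseteq> A" "k \<le> r" "(\<sigma>, \<rho>, \<tau>) \<in> trans_fact B k" "(\<sigma>', \<rho>', \<tau>') \<in> trans_fact (A - B) (r - k)"
        "x \<in> B" "y \<in> A - B" and "glued B (A - B) \<sigma> \<rho> \<tau> k \<sigma>' \<rho>' \<tau>' (r - k)" .
    then interpret glued B "A - B" \<sigma> \<rho> \<tau> k \<sigma>' \<rho>' \<tau>' "r - k" by simp
    have A: "B \<union> (A - B) = A" "k + (r - k) = r" using m by auto
    show "(\<lambda>((\<sigma>, \<rho>, \<tau>), x, y). mon (wt A r (transpose x y \<circ> \<sigma>) \<rho>)) (glue_map u) =
        (case u of (B, k, s, s', x, y) \<Rightarrow> h B k s s' x y)"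
      using wt_transpose_glued[OF m(5,6)]
      by (simp only: ueq glue_map_def glue_def prod.case A h_def w_def fst_conv snd_conv)
  qed
  also have "\<dots> = (\<Sum>B\<in>Pow A. \<Sum>k\<le>r. \<Sum>s\<in>trans_fact B k. \<Sum>s'\<in>trans_fact (A - B) (r - k). \<Sum>x\<in>B. \<Sum>y\<in>A - B. h B k s s' x y)"
  proof -
    have fin: "finite B" "finite (A - B)" if "B \<in> Pow A" for B using that assms finite_subset by auto
    show ?thesis
      unfolding glue_data_def
      by (subst sum.Sigma[symmetric], use assms fin in \<open>auto intro!: finite_SigmaI\<close>,
          intro sum.cong refl, subst sum.Sigma[symmetric], use assms fin in \<open>auto intro!: finite_SigmaI\<close>,
          intro sum.cong refl, subst sum.Sigma[symmetric], use assms fin in \<open>auto intro!: finite_SigmaI\<close>,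
          intro sum.cong refl, subst sum.Sigma[symmetric], use assms fin in \<open>auto intro!: finite_SigmaI\<close>,
          intro sum.cong refl, subst sum.cartesian_product, rule refl)
  qed
  also have "\<dots> = (\<Sum>B\<in>Pow A. \<Sum>k\<le>r. \<Sum>(i, j)\<in>?I \<times> ?I. pp (i + j) * usum B k i * usum (A - B) (r - k) j)"
  proof (intro sum.cong refl)
    fix B k assume "B \<in> Pow A"
    hence B: "B \<subseteq> A" by simp
    have fin: "finite B" "finite (A - B)" using B assms finite_subset by auto
    let ?V = "trans_fact B k \<times> B" and ?V' = "trans_fact (A - B) (r - k) \<times> (A - B)"
    have range: "?l ` (trans_fact D n \<times> D) \<subseteq> ?I" if D: "D \<subseteq> A" for D n
    proof
      fix i assume "i \<in> ?l ` (trans_fact D n \<times> D)"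
      then obtain \<sigma> \<rho> \<tau> x where s: "(\<sigma>, \<rho>, \<tau>) \<in> trans_fact D n" "x \<in> D" "i = clen \<sigma> x" by auto
      have "finite D" using D assms finite_subset by auto
      thus "i \<in> ?I" using clen_range[OF _ trans_factD(1)[OF s(1)] s(2)] card_mono[OF assms D] s(3) by auto
    qed
    have "(\<Sum>s\<in>trans_fact B k. \<Sum>s'\<in>trans_fact (A - B) (r - k). \<Sum>x\<in>B. \<Sum>y\<in>A - B. h B k s s' x y) =
        (\<Sum>s\<in>trans_fact B k. \<Sum>x\<in>B. \<Sum>s'\<in>trans_fact (A - B) (r - k). \<Sum>y\<in>A - B. h B k s s' x y)"
      by (intro sum.cong refl sum.swap)
    also have "\<dots> = (\<Sum>v\<in>?V. \<Sum>v'\<in>?V'. pp (?l v + ?l v') * w B k v * w (A - B) (r - k) v')"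
      by (simp add: sum.cartesian_product' h_def)
    also have "\<dots> = (\<Sum>(i, j)\<in>?I \<times> ?I. pp (i + j) * usum B k i * usum (A - B) (r - k) j)"
      unfolding usum_w
      by (rule sum_prod_group[symmetric]) (use fin B range in auto)
    finally show "(\<Sum>s\<in>trans_fact B k. \<Sum>s'\<in>trans_fact (A - B) (r - k). \<Sum>x\<in>B. \<Sum>y\<in>A - B. h B k s s' x y) =
        (\<Sum>(i, j)\<in>?I \<times> ?I. pp (i + j) * usum B k i * usum (A - B) (r - k) j)" .
  qed
  also have "\<dots> = (\<Sum>B\<in>Pow A. \<Sum>k\<le>r. \<Sum>(i, j)\<in>?I \<times> ?I. pp (i + j) * usum {1..card B} k i * usum {1..card A - card B} (r - k) j)"
  proof (intro sum.cong refl, clarify)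
    fix B k i j assume "B \<subseteq> A"
    hence "usum B k i = usum {1..card B} k i" "usum (A - B) (r - k) j = usum {1..card A - card B} (r - k) j"
      using usum_card[of B] usum_card[of "A - B"] assms finite_subset[OF \<open>B \<subseteq> A\<close>]
      by (simp_all add: card_Diff_subset)
    thus "pp (i + j) * usum B k i * usum (A - B) (r - k) j =
        pp (i + j) * usum {1..card B} k i * usum {1..card A - card B} (r - k) j" by simp
  qed
  also have "\<dots> = (\<Sum>n\<le>card A. of_nat (card A choose n) *
      (\<Sum>k\<le>r. \<Sum>(i, j)\<in>?I \<times> ?I. pp (i + j) * usum {1..n} k i * usum {1..card A - n} (r - k) j))"
    (is "(\<Sum>B\<in>Pow A. ?F (card B)) = _")
  proof -
    have "(\<Sum>B\<in>Pow A. ?F (card B)) = (\<Sum>n\<le>card A. \<Sum>B\<in>{B \<in> Pow A. card B = n}. ?F (card B))"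
      by (rule sum.group[symmetric]) (use assms in \<open>auto intro: card_mono\<close>)
    also have "\<dots> = (\<Sum>n\<le>card A. of_nat (card A choose n) * ?F n)"
    proof (rule sum.cong[OF refl])
      fix n
      have "(\<Sum>B\<in>{B \<in> Pow A. card B = n}. ?F (card B)) = (\<Sum>B\<in>{B. B \<subseteq> A \<and> card B = n}. ?F n)"
        by (rule sum.cong) auto
      thus "(\<Sum>B\<in>{B \<in> Pow A. card B = n}. ?F (card B)) = of_nat (card A choose n) * ?F n"
        by (simp only: sum_constant n_subsets[OF assms])
    qed
    finally show ?thesis .
  qed
  also have "\<dots> = (\<Sum>n\<le>card A. \<Sum>k\<le>r. \<Sum>p\<in>?I \<times> ?I. pp (fst p + snd p) *
      (of_nat (card A choose n) * (usum {1..n} k (fst p) * usum {1..card A - n} (r - k) (snd p))))"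
    unfolding split_def sum_distrib_left by (simp only: ac_simps)
  also have "\<dots> = (\<Sum>n\<le>card A. \<Sum>p\<in>?I \<times> ?I. \<Sum>k\<le>r. pp (fst p + snd p) *
      (of_nat (card A choose n) * (usum {1..n} k (fst p) * usum {1..card A - n} (r - k) (snd p))))"
    by (intro sum.cong refl sum.swap)
  also have "\<dots> = (\<Sum>p\<in>?I \<times> ?I. \<Sum>n\<le>card A. \<Sum>k\<le>r. pp (fst p + snd p) *
      (of_nat (card A choose n) * (usum {1..n} k (fst p) * usum {1..card A - n} (r - k) (snd p))))"
    by (rule sum.swap)
  finally show ?thesis by (simp only: split_def sum_distrib_left)
qed

text \<open>A tuple that is connected already admits every ordered pair of distinct labels; any
  other tuple contributes only the pairs that join its two blocks.\<close>

lemma sum_ksum: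
  assumes "finite A"
  shows "(\<Sum>x\<in>A. ksum A r x) =
    (\<Sum>(\<sigma>, \<rho>, \<tau>)\<in>trans_fact A r. \<Sum>x\<in>A. \<Sum>y\<in>A - {x}. mon (wt A r (transpose x y \<circ> \<sigma>) \<rho>)) +
    (\<Sum>((\<sigma>, \<rho>, \<tau>), x, y)\<in>joinable A r. mon (wt A r (transpose x y \<circ> \<sigma>) \<rho>))"
proof -
  let ?F = "factorizations A r" and ?P = "SIGMA x:A. A - {x}"
  let ?C = "\<lambda>s. connected_by A (fst s) (fst (snd s)) (unsep (snd (snd s)))"
  let ?D = "\<lambda>s p. connected_by A (fst s) (fst (snd s)) (unsep (snd (snd s)) \<inter> together (fst p) (snd p))"
  let ?m = "\<lambda>s p. mon (wt A r (transpose (fst p) (snd p) \<circ> fst s) (fst (snd s)))"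
  have inner: "(\<Sum>x\<in>A. \<Sum>y\<in>A - {x}. f x y) = (\<Sum>p\<in>?P. f (fst p) (snd p))" for f :: "nat \<Rightarrow> nat \<Rightarrow> series"
    using assms by (subst sum.Sigma) (auto simp: split_def)
  have "(\<Sum>x\<in>A. ksum A r x) = (\<Sum>s\<in>?F. \<Sum>p\<in>?P. if ?D s p then ?m s p else 0)"
    unfolding ksum_def split_def by (subst sum.swap) (simp only: inner)
  also have "\<dots> = (\<Sum>s\<in>?F. (if ?C s then (\<Sum>p\<in>?P. ?m s p) else 0) +
      (\<Sum>p\<in>?P. if ?D s p \<and> \<not> ?C s then ?m s p else 0))"
  proof (rule sum.cong[OF refl])
    fix s
    have "?D s p" if "?C s" for p using connected_by_subset[OF that] by blast
    thus "(\<Sum>p\<in>?P. if ?D s p then ?m s p else 0) = (if ?C s then (\<Sum>p\<in>?P. ?m s p) else 0) +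
      (\<Sum>p\<in>?P. if ?D s p \<and> \<not> ?C s then ?m s p else 0)" by (cases "?C s") simp_all
  qed
  also have "\<dots> = (\<Sum>s\<in>?F. if ?C s then (\<Sum>p\<in>?P. ?m s p) else 0) +
      (\<Sum>s\<in>?F. \<Sum>p\<in>?P. if ?D s p \<and> \<not> ?C s then ?m s p else 0)"
    by (rule sum.distrib)
  also have "(\<Sum>s\<in>?F. if ?C s then (\<Sum>p\<in>?P. ?m s p) else 0) =
      (\<Sum>(\<sigma>, \<rho>, \<tau>)\<in>trans_fact A r. \<Sum>x\<in>A. \<Sum>y\<in>A - {x}. mon (wt A r (transpose x y \<circ> \<sigma>) \<rho>))"
    unfolding sum_trans_fact[OF assms] inner by (simp only: split_def)
  also have "(\<Sum>s\<in>?F. \<Sum>p\<in>?P. if ?D s p \<and> \<not> ?C s then ?m s p else 0) =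
      (\<Sum>q\<in>?F \<times> ?P. if ?D (fst q) (snd q) \<and> \<not> ?C (fst q) then ?m (fst q) (snd q) else 0)"
    by (simp only: sum.cartesian_product split_def)
  also have "\<dots> = (\<Sum>q\<in>{q \<in> ?F \<times> ?P. ?D (fst q) (snd q) \<and> \<not> ?C (fst q)}. ?m (fst q) (snd q))"
    by (rule sum.inter_filter[symmetric]) (use assms in auto)
  also have "{q \<in> ?F \<times> ?P. ?D (fst q) (snd q) \<and> \<not> ?C (fst q)} = joinable A r"
  proof -
    \<comment> \<open>Equal labels add no edge, so x and y differ automatically in
      \<open>joinable\<close>.\<close>
    have "together x x = UNIV" for x by (simp add: together_def)
    thus ?thesis unfolding joinable_def by auto
  qed
  also have "(\<Sum>q\<in>joinable A r. ?m (fst q) (snd q)) =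
      (\<Sum>((\<sigma>, \<rho>, \<tau>), x, y)\<in>joinable A r. mon (wt A r (transpose x y \<circ> \<sigma>) \<rho>))"
    by (simp only: split_def)
  finally show ?thesis .
qed

text \<open>All marked labels contribute equally, so d times the sum with mark d is the sum over all
  ordered pairs of distinct labels.\<close>

lemma ksum_expand:
  "of_nat d * ksum {1..d} r d = (\<Sum>(i, j)\<in>{1..d} \<times> {1..d}.
    of_nat (i + j) * pp i * pp j * d_p (i + j) (hsum {1..d} r) +
    of_nat (i * j) * pp (i + j) * d_p i (d_p j (hsum {1..d} r)) +
    pp (i + j) * (\<Sum>k\<le>d. \<Sum>r'\<le>r. of_nat (d choose k) * (usum {1..k} r' i * usum {1..d - k} (r - r') j)))"
proof -
  have "of_nat d * ksum {1..d} r d = (\<Sum>x\<in>{1..d}. ksum {1..d} r d)" by simp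
  also have "\<dots> = (\<Sum>x\<in>{1..d}. ksum {1..d} r x)"
    by (rule sum.cong[OF refl]) (simp only: ksum_constant)
  also have "\<dots> = (\<Sum>(i, j)\<in>{1..d} \<times> {1..d}.
      of_nat (i + j) * pp i * pp j * d_p (i + j) (hsum {1..d} r) +
      of_nat (i * j) * pp (i + j) * d_p i (d_p j (hsum {1..d} r))) +
    (\<Sum>(i, j)\<in>{1..d} \<times> {1..d}. pp (i + j) *
      (\<Sum>k\<le>d. \<Sum>r'\<le>r. of_nat (d choose k) * (usum {1..k} r' i * usum {1..d - k} (r - r') j)))"
    unfolding sum_ksum[OF finite_atLeastAtMost] sum_pairs_trans_fact[OF finite_atLeastAtMost]
      sum_joinable[OF finite_atLeastAtMost] card_atLeastAtMost by simp
  finally show ?thesis by (simp only: split_def sum.distrib)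
qed

section \<open>Comparison of coefficients\<close>

definition join_cut :: "series \<Rightarrow> nat \<times> nat \<Rightarrow> series" where
  "join_cut H = (\<lambda>(i, j).
      of_nat (i + j) * pp i * pp j * d_p (i + j) H
    + of_nat (i * j) * pp (i + j) * d_p i (d_p j H)
    + of_nat (i * j) * pp (i + j) * d_p i H * d_p j H)"

lemma part_of_nat_pp:
  "part d r (of_nat n * f) = of_nat n * part d r f"
  "part d r (pp i * f) = pp i * part d r f"
  by (simp_all add: mps_of_nat_monom mps_var_monom part_monom_mult)

text \<open>For k = 0 both sides vanish: the series starts in degree 1, and the empty set of labels
  has no point to mark.\<close>

lemma of_nat_d_p_part_H:
  assumes "i \<ge> 1"
  shows "of_nat i * d_p i (part k r H_series) = mps_const (1 / fact k) * usum {1..k} r i"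
proof (cases "k = 0")
  case True
  thus ?thesis using assms usum_zero[of "{1..k}" i r] by (simp add: part_H_0 deriv_linear)
next
  case False
  hence "of_nat i * d_p i (part k r H_series) = mps_const (1 / fact k) * (of_nat i * d_p i (hsum {1..k} r))"
    by (simp only: part_H[of k r] deriv_linear(4) mult.left_commute)
  thus ?thesis by (simp add: usum_eq)
qed

text \<open>Multiplied by d!, the weights 1/k! and 1/(d-k)! of the two first derivatives become the
  binomial coefficient that counts the choices of the block of x.\<close>

lemma part_join_cut:
  assumes "d \<ge> 1" "i \<ge> 1" "j \<ge> 1"
  shows "of_nat (fact d) * part d r (join_cut H_series (i, j)) =
    of_nat (i + j) * pp i * pp j * d_p (i + j) (hsum {1..d} r) +
    of_nat (i * j) * pp (i + j) * d_p i (d_p j (hsum {1..d} r)) +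
    pp (i + j) * (\<Sum>k\<le>d. \<Sum>r'\<le>r. of_nat (d choose k) * (usum {1..k} r' i * usum {1..d - k} (r - r') j))"
proof -
  have H: "of_nat (fact d) * part d r H_series = hsum {1..d} r"
    by (simp only: part_H[OF assms(1)] fact_cancel)
  have of_nat_d: "of_nat n * d_p k f = d_p k (of_nat n * f)" for n k f
    using deriv_linear(4)[of "PVar k" "of_nat n" f] by (simp add: mps_of_nat_monom mps_const_monom)
  have 1: "of_nat (fact d) * part d r (of_nat (i + j) * pp i * pp j * d_p (i + j) H_series) =
      of_nat (i + j) * pp i * pp j * d_p (i + j) (hsum {1..d} r)"
  proof -
    have "part d r (of_nat (i + j) * pp i * pp j * d_p (i + j) H_series) =
        of_nat (i + j) * pp i * pp j * d_p (i + j) (part d r H_series)"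
      by (simp only: mult.assoc part_of_nat_pp part_d_p)
    thus ?thesis by (simp only: mult.left_commute[of "of_nat (fact d)"] of_nat_d H)
  qed
  have 2: "of_nat (fact d) * part d r (of_nat (i * j) * pp (i + j) * d_p i (d_p j H_series)) =
      of_nat (i * j) * pp (i + j) * d_p i (d_p j (hsum {1..d} r))"
  proof -
    have "part d r (of_nat (i * j) * pp (i + j) * d_p i (d_p j H_series)) =
        of_nat (i * j) * pp (i + j) * d_p i (d_p j (part d r H_series))"
      by (simp only: mult.assoc part_of_nat_pp part_d_p)
    thus ?thesis by (simp only: mult.left_commute[of "of_nat (fact d)"] of_nat_d H)
  qed
  have 3: "of_nat (fact d) * part d r (of_nat (i * j) * pp (i + j) * d_p i H_series * d_p j H_series) =
      pp (i + j) * (\<Sum>k\<le>d. \<Sum>r'\<le>r. of_nat (d choose k) * (usum {1..k} r' i * usum {1..d - k} (r - r') j))"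
  proof -
    have b: "of_nat (fact d) * (mps_const (1 / fact k) * mps_const (1 / fact (d - k))) = (of_nat (d choose k) :: series)"
      if "k \<le> d" for k
      using binomial_fact[OF that, where 'a = rat]
      by (simp add: mps_const_monom mps_of_nat_monom mps_monom_mult)
    have "of_nat (i * j) * pp (i + j) * d_p i H_series * d_p j H_series =
        pp (i + j) * ((of_nat i * d_p i H_series) * (of_nat j * d_p j H_series))"
      by (simp only: of_nat_mult ac_simps)
    moreover have "part d r ((of_nat i * d_p i H_series) * (of_nat j * d_p j H_series)) =
        (\<Sum>k\<le>d. \<Sum>r'\<le>r. (of_nat i * d_p i (part k r' H_series)) * (of_nat j * d_p j (part (d - k) (r - r') H_series)))"
      unfolding part_mult[of d r "of_nat i * d_p i H_series"] by (simp only: part_of_nat_pp(1) part_d_p)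
    ultimately have "part d r (of_nat (i * j) * pp (i + j) * d_p i H_series * d_p j H_series) = pp (i + j) *
        (\<Sum>k\<le>d. \<Sum>r'\<le>r. (of_nat i * d_p i (part k r' H_series)) * (of_nat j * d_p j (part (d - k) (r - r') H_series)))"
      by (simp only: part_of_nat_pp(2))
    also have "\<dots> = pp (i + j) * (\<Sum>k\<le>d. \<Sum>r'\<le>r. (mps_const (1 / fact k) * mps_const (1 / fact (d - k))) *
        (usum {1..k} r' i * usum {1..d - k} (r - r') j))"
      unfolding of_nat_d_p_part_H[OF assms(2)] of_nat_d_p_part_H[OF assms(3)] by (simp only: ac_simps)
    finally have "of_nat (fact d) * part d r (of_nat (i * j) * pp (i + j) * d_p i H_series * d_p j H_series) =
        pp (i + j) * (\<Sum>k\<le>d. \<Sum>r'\<le>r. (of_nat (fact d) * (mps_const (1 / fact k) * mps_const (1 / fact (d - k)))) *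
        (usum {1..k} r' i * usum {1..d - k} (r - r') j))"
      by (simp only: sum_distrib_left mult.left_commute mult.assoc)
    also have "(\<Sum>k\<le>d. \<Sum>r'\<le>r. (of_nat (fact d) * (mps_const (1 / fact k) * mps_const (1 / fact (d - k)))) *
        (usum {1..k} r' i * usum {1..d - k} (r - r') j)) =
        (\<Sum>k\<le>d. \<Sum>r'\<le>r. of_nat (d choose k) * (usum {1..k} r' i * usum {1..d - k} (r - r') j))"
      by (intro sum.cong refl) (simp only: atMost_iff b)
    finally show ?thesis .
  qed
  show ?thesis
    unfolding join_cut_def prod.case part_linear distrib_left 1 2 3 ..
qed

lemma d_p_d_p_hsum_zero:
  assumes "finite A" "i > card A \<or> j > card A"
  shows "of_nat (i * j) * d_p i (d_p j (hsum A r)) = 0"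
proof -
  have "of_nat (i * j) * d_p i (d_p j (mon (wt A r \<sigma> \<rho>))) = 0" if "\<sigma> permutes A" for \<sigma> \<rho>
  proof -
    have "clen \<sigma> x \<noteq> i \<or> clen \<sigma> y \<noteq> j" if "x \<in> A" "y \<in> A" for x y
      using clen_range[OF assms(1) \<open>\<sigma> permutes A\<close>] that assms(2) by fastforce
    thus ?thesis
      unfolding d_p_d_p_wt[OF assms(1) that] by (intro sum.neutral ballI) auto
  qed
  hence "(case s of (\<sigma>, \<rho>, \<tau>) \<Rightarrow> of_nat (i * j) * d_p i (d_p j (mon (wt A r \<sigma> \<rho>)))) = 0"
    if "s \<in> trans_fact A r" for s
    using that by (cases s) (auto dest: trans_factD simp del: of_nat_mult)
  hence "(\<Sum>(\<sigma>, \<rho>, \<tau>)\<in>trans_fact A r. of_nat (i * j) * d_p i (d_p j (mon (wt A r \<sigma> \<rho>)))) = 0"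
    by (rule sum.neutral[OF ballI])
  thus ?thesis
    by (simp only: hsum_def split_def deriv_linear(3) sum_distrib_left)
qed

text \<open>Cycles on d labels have length at most d, and in the product of first derivatives i and
  j are bounded by complementary block sizes. Hence only finitely many pairs matter in each
  bidegree.\<close>

lemma part_join_cut_zero:
  assumes "i \<ge> 1" "j \<ge> 1" "i > d \<or> j > d"
  shows "part d r (join_cut H_series (i, j)) = 0"
proof (cases "d = 0")
  case True
  have "part 0 r (d_p i H_series * d_p j H_series) = 0"
    by (simp add: part_mult part_d_p part_H_0 deriv_linear)
  hence "part 0 r (of_nat (i + j) * pp i * pp j * d_p (i + j) H_series) = 0"
    "part 0 r (of_nat (i * j) * pp (i + j) * d_p i (d_p j H_series)) = 0"
    "part 0 r (of_nat (i * j) * pp (i + j) * d_p i H_series * d_p j H_series) = 0"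
    by (simp_all only: mult.assoc part_of_nat_pp part_d_p part_H_0 deriv_linear(1) mult_zero_right)
  thus ?thesis by (simp only: True join_cut_def prod.case part_linear add_0_right)
next
  case False
  hence d: "d \<ge> 1" by simp
  have "of_nat (i + j) * d_p (i + j) (hsum {1..d} r) = 0"
    using usum_eq[of "{1..d}" "i + j" r] usum_zero[of "{1..d}" "i + j" r] assms(3) by auto
  hence 1: "of_nat (i + j) * pp i * pp j * d_p (i + j) (hsum {1..d} r) = 0"
    by (metis (no_types, lifting) mult.assoc mult.commute mult_zero_right)
  have "of_nat (i * j) * d_p i (d_p j (hsum {1..d} r)) = 0"
    by (rule d_p_d_p_hsum_zero) (use assms(3) in auto)
  hence 2: "of_nat (i * j) * pp (i + j) * d_p i (d_p j (hsum {1..d} r)) = 0"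
    by (metis (no_types, lifting) mult.assoc mult.commute mult_zero_right)
  have "usum {1..k} r' i * usum {1..d - k} (r - r') j = 0" if "k \<le> d" for k r'
  proof -
    have "i > k \<or> j > d - k" using that assms(3) by linarith
    thus ?thesis using usum_zero[of "{1..k}" i r'] usum_zero[of "{1..d - k}" j "r - r'"] by auto
  qed
  hence 3: "(\<Sum>k\<le>d. \<Sum>r'\<le>r. of_nat (d choose k) * (usum {1..k} r' i * usum {1..d - k} (r - r') j)) = 0"
    by (intro sum.neutral ballI) simp
  have "of_nat (fact d) * part d r (join_cut H_series (i, j)) = 0"
    unfolding part_join_cut[OF d assms(1,2)] 1 2 3 by simp
  moreover have "of_nat (fact d) * (mps_const (1 / fact d) * f) = f" for f :: series by (rule fact_cancel)
  ultimately show ?thesis by (metis mult.left_commute mult_zero_right)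
qed

lemma part_sum_join_cut:
  "part d r (mps_sum (join_cut H_series) ({1..} \<times> {1..})) = (\<Sum>p\<in>{1..d} \<times> {1..d}. part d r (join_cut H_series p))"
proof (rule part_mps_sum)
  fix p :: "nat \<times> nat" assume p: "p \<in> {1..} \<times> {1..} - {1..d} \<times> {1..d}"
  obtain i j where "p = (i, j)" by (cases p)
  moreover from this p have "1 \<le> i" "1 \<le> j" "i > d \<or> j > d" by auto
  ultimately show "part d r (join_cut H_series p) = 0" by (simp only: part_join_cut_zero)
qed auto

lemma fact_part_sum_join_cut:
  assumes "d \<ge> 1"
  shows "of_nat (fact d) * part d r (mps_sum (join_cut H_series) ({1..} \<times> {1..})) = of_nat d * ksum {1..d} r d"
  unfolding part_sum_join_cut sum_distrib_left[of "of_nat (fact d)"] ksum_expand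
  by (rule sum.cong[OF refl]) (use assms in \<open>auto simp only: part_join_cut mem_Sigma_iff atLeastAtMost_iff split: prod.splits\<close>)

text \<open>In degree d, z^2 d/dz applied to N gives z times d - 1 times its part of degree d - 1,
  so after multiplication by d! the claim is d times the recurrence for \<open>hsum\<close>. Degree
  0 vanishes on both sides, and in degree 1 only z p_1 q_1 occurs and cancels.\<close>

lemma join_cut_equation:
  "zz * d_z H_series - zz * pp 1 * qq 1 - zz ^ 2 * d_z N_series =
    tt * mps_sum (join_cut H_series) ({1..} \<times> {1..})" (is "?L = tt * ?R")
proof (rule series_eq_parts)
  fix d r
  have zpart: "part d r (zz * f) = (if d = 0 then 0 else zz * part (d - 1) r f)" for f
    by (simp add: mps_var_monom part_monom_mult)
  have tpart: "part d r (tt * f) = (case r of 0 \<Rightarrow> 0 | Suc r' \<Rightarrow> tt * part d r' f)" for f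
    by (cases r) (simp_all add: mps_var_monom part_monom_mult)
  have N: "zz ^ 2 * d_z N_series = zz * (zz * d_z N_series)"
    by (simp add: power2_eq_square mult.assoc)
  have e: "zz * pp 1 * qq 1 = mon {#ZVar, PVar 1, QVar 1#}"
    by (simp add: mps_var_monom mps_monom_mult add_mset_commute)
  have E: "part d r (zz * pp 1 * qq 1) = (if d = 1 \<and> r = 0 then zz * pp 1 * qq 1 else 0)"
    unfolding e part_monom by simp
  have L: "part d r ?L = of_nat d * part d r H_series - (if d = 1 \<and> r = 0 then zz * pp 1 * qq 1 else 0) -
      (if d = 0 then 0 else zz * (of_nat (d - 1) * part (d - 1) r N_series))"
    unfolding part_linear part_z_dz E N zpart by (simp only: part_z_dz)
  show "part d r ?L = part d r (tt * ?R)"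
  proof (cases d)
    case 0
    have "part 0 r' ?R = 0" for r' unfolding part_sum_join_cut by simp
    hence "part d r (tt * ?R) = 0"
      unfolding tpart by (cases r) (simp_all add: 0)
    moreover have "part d r ?L = 0" unfolding L by (simp add: 0)
    ultimately show ?thesis by simp
  next
    case (Suc n)
    have d: "d \<ge> 1" by (simp add: Suc)
    have R: "of_nat (fact d) * part d r (tt * ?R) = of_nat d * (case r of 0 \<Rightarrow> 0 | Suc r' \<Rightarrow> tt * ksum {1..d} r' d)"
    proof (cases r)
      case (Suc r')
      have "of_nat (fact d) * (tt * part d r' ?R) = tt * (of_nat d * ksum {1..d} r' d)"
        by (simp only: mult.left_commute[of _ tt] fact_part_sum_join_cut[OF d])
      thus ?thesis unfolding tpart unfolding Suc by (simp only: nat.case mult.left_commute)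
    next
      case 0
      show ?thesis unfolding tpart by (simp add: 0)
    qed
    have H: "of_nat (fact d) * part d r H_series = hsum {1..d} r"
      by (simp only: part_H[OF d] fact_cancel)
    have "of_nat (fact d) * part d r ?L = of_nat (fact d) * part d r (tt * ?R)"
    proof (cases "n = 0")
      case True
      hence d1: "d = 1" by (simp add: Suc)
      have "part d r ?L = hsum {1..1} r - (if r = 0 then zz * pp 1 * qq 1 else 0)"
        unfolding L using H by (simp add: d1)
      hence "part d r ?L = 0" unfolding hsum_1 by simp
      moreover have "of_nat (fact d) * part d r (tt * ?R) = 0"
        unfolding R unfolding d1 ksum_1 by (cases r) simp_all
      ultimately show ?thesis by (simp only: mult_zero_right)
    next
      case False
      hence n: "n \<ge> 1" by simp
      have NS: "of_nat (fact n) * part n r N_series = nsum {1..n} r n"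
        by (simp only: part_N[OF n] fact_cancel)
      \<comment> \<open>With d = n + 1, d! is d times n!, and n! is the normalization of the part of
        N.\<close>
      have "of_nat (fact d) * part d r ?L = of_nat d * (of_nat (fact d) * part d r H_series) -
          of_nat d * (of_nat n * zz * (of_nat (fact n) * part n r N_series))"
        unfolding L using n by (simp add: Suc algebra_simps)
      also have "\<dots> = of_nat d * (case r of 0 \<Rightarrow> 0 | Suc r' \<Rightarrow> tt * ksum {1..d} r' d)"
        unfolding H NS unfolding Suc hsum_Suc[OF n] by (simp only: distrib_left add_diff_cancel_left')
      finally show ?thesis unfolding R .
    qed
    hence "mps_const (1 / fact d) * (of_nat (fact d) * part d r ?L) = mps_const (1 / fact d) * (of_nat (fact d) * part d r (tt * ?R))"
      by (rule arg_cong)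
    thus ?thesis by (simp only: mult.left_commute[of "mps_const (1 / fact d)"] fact_cancel)
  qed
qed

theorem theorem1p10:
  shows "1 / (2 * to_fract tt) *
      to_fract (zz * d_z H_series - zz * pp 1 * qq 1 - zz ^ 2 * d_z N_series)
    = 1 / 2 * to_fract (mps_sum
        (\<lambda>(i, j).
            of_nat (i + j) * pp i * pp j * d_p (i + j) H_series
          + of_nat (i * j) * pp (i + j) * d_p i (d_p j H_series)
          + of_nat (i * j) * pp (i + j) * d_p i H_series * d_p j H_series)
        ({1..} \<times> {1..}))"
proof -
  let ?R = "mps_sum (join_cut H_series) ({1..} \<times> {1..})"
  have "to_fract tt \<noteq> 0" using two_t_nonzero by auto
  hence "1 / (2 * to_fract tt) * to_fract (tt * ?R) = 1 / 2 * to_fract ?R"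
    by (simp add: to_fract_mult)
  thus ?thesis unfolding join_cut_equation unfolding join_cut_def .
qed

end
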